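(* $\mathrm{Aut}\,\mathbb{C}$ acts on the group $\tilde{\mathrm{G}}$ in $\tilde{\mathbb{H}}^{\mathrm{Full}}$ as $\mathrm{Gal}(\mathbb{Q}^{\mathrm{ab}}:\mathbb{Q})\cong\hat{\mathbb{Z}}^\times$: for $\mu\in\hat{\mathbb{Z}}^\times$ and $h=\begin{pmatrix}a&b\\c&d\end{pmatrix}\in\tilde{\mathrm{G}}$, $$h^\mu=\begin{pmatrix}a&\mu b\\ \mu^{-1}c&d\end{pmatrix}.$$
   Context: $\mathbb{H}$ is the upper half-plane, $\mathbb{A}_f$ the finite adeles of $\mathbb{Q}$, $\mathbb{Q}_+$ the positive rationals. $\mathrm{S}=\mathrm{GL}_2(\mathbb{Q})\backslash((\mathbb{C}\setminus\mathbb{R})\times\mathrm{GL}_2(\mathbb{A}_f))$ with $q\cdot(\tau,a)=(q\tau,qa)$; classes $[\tau,a]$; $g*[\tau,a]=[\tau,ag^{-1}]$ for $g\in\mathrm{GL}_2(\mathbb{A}_f)$. $\mathrm{Aut}\,\mathbb{C}$ acts on $\mathrm{S}$ as the limit of the canonical models over $\mathbb{Q}$ of the curves $\mathrm{S}/K(N)$, $K(N)=\{g\in\mathrm{GL}_2(\hat{\mathbb{Z}}):g\equiv1\bmod N\}$; this action commutes with $g*$ for all $g\in\mathrm{GL}_2(\mathbb{A}_f)$. Let $\Delta=\{\mathrm{diag}(\lambda,1):\lambda\in\hat{\mathbb{Z}}^\times\}$ and $\mathrm{S}_\approx=\mathrm{S}/\Delta$, identified with $\tilde{\mathbb{H}}=\varprojlim_N\Gamma(N)\backslash\mathbb{H}$;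 $\mathrm{Aut}\,\mathbb{C}$ acts on it by the induced action. $\tilde{\mathrm{G}}=\{\mathrm{diag}(q,1):q\in\mathbb{Q}_+\}\cdot\mathrm{SL}_2(\mathbb{A}_f)$ acts on $\tilde{\mathbb{H}}=\mathrm{S}_\approx$ by $g*[\tau,a\Delta]=[\tau,ag^{-1}\Delta]$, where $a$ is chosen so that $\tau\in\mathbb{H}$ and $\det a\in\mathbb{Q}_+$. $\tilde{\mathbb{H}}^{\mathrm{Full}}$ is the structure on $(\tilde{\mathbb{H}},\tilde{\mathrm{G}})$ (with this action) induced from the full structure $\mathbf{S}^{\mathrm{Full}}$, which consists of $\mathrm{S}$ and the $\mathrm{S}/K(N)$ with the maps $g*$, the projections, the partition into components, and all relations and points defined over $\mathbb{Q}$ on the curves $\mathrm{S}/K(N)$; $\mathrm{Aut}\,\tilde{\mathbb{H}}^{\mathrm{Full}}=\mathrm{Aut}\,\mathbf{S}^{\mathrm{Full}}$. The action of $\sigma\in\mathrm{Aut}\,\mathbb{C}$ on $h\in\tilde{\mathrm{G}}$ is the one that transports the graph of $h$ in $\tilde{\mathbb{H}}\times\tilde{\mathbb{H}}$ by $\sigma$. The claim says that this action factors through $\mathrm{Gal}(\mathbb{Q}^{\mathrm{ab}}:\mathbb{Q})\cong\hat{\mathbb{Z}}^\times$, the element corresponding to $\mu$ sending $h$ to $h^\mu$. *)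

theory Defs
  imports "HOL-Analysis.Analysis" "HOL-Computational_Algebra.Polynomial"
begin

section \<open>Profinite integers and finite adeles\<close>

text \<open>Profinite integers as the inverse limit of the rings of integers modulo \<open>n\<close>, where \<open>x n\<close> is the
  canonical residue modulo \<open>n\<close>. The index \<open>0\<close> carries no information.\<close>

typedef zhat = "{x :: nat \<Rightarrow> int. x 0 = 0 \<and> (\<forall>m n. 0 < n \<longrightarrow> m dvd n \<longrightarrow> x m = x n mod int m)}"
  morphisms residue Abs_zhat
  by (rule exI[of _ "\<lambda>_. 0"]) simp

setup_lifting type_definition_zhat

lemma residue_0 [simp]: "residue x 0 = 0"
  using residue[of x] by blast

lemma residue_dvd: "0 < n \<Longrightarrow> m dvd n \<Longrightarrow> residue x n mod int m = residue x m"
  using residue[of x] unfolding mem_Collect_eq by metis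

lemma residue_mod [simp]: "residue x n mod int n = residue x n"
  by (cases "n = 0") (auto intro: residue_dvd)

lemma zhat_eqI:
  assumes "\<And>n. 0 < n \<Longrightarrow> residue x n = residue y n"
  shows "x = y"
proof -
  have "residue x n = residue y n" for n
    using assms by (cases "n = 0") auto
  then have "residue x = residue y"
    by (rule ext)
  then show ?thesis
    by (simp only: residue_inject)
qed

lemma mod_of_dvd_mod:
  assumes "m dvd n" shows "(a mod int n) mod int m = a mod int m"
  using assms by (simp add: mod_mod_cancel)

instantiation zhat :: comm_ring_1
begin

lift_definition zero_zhat :: zhat is "\<lambda>_. 0" by simp

lift_definition one_zhat :: zhat is "\<lambda>n. if n = 0 then 0 else 1 mod int n"
  by (auto simp: mod_of_dvd_mod)

lift_definition plus_zhat :: "zhat \<Rightarrow> zhat \<Rightarrow> zhat" is "\<lambda>x y n. (x n + y n) mod int n"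
proof (intro conjI allI impI)
  fix x y :: "nat \<Rightarrow> int" and m n :: nat
  assume x: "x 0 = 0 \<and> (\<forall>m n. 0 < n \<longrightarrow> m dvd n \<longrightarrow> x m = x n mod int m)"
    and y: "y 0 = 0 \<and> (\<forall>m n. 0 < n \<longrightarrow> m dvd n \<longrightarrow> y m = y n mod int m)"
  have "x 0 = 0" "y 0 = 0" using x y by blast+
  then show "(x 0 + y 0) mod int 0 = 0" by simp
  assume "0 < n" "m dvd n"
  then have "x m = x n mod int m" "y m = y n mod int m" using x y by blast+
  then show "(x m + y m) mod int m = (x n + y n) mod int n mod int m"
    using \<open>m dvd n\<close> by (simp add: mod_of_dvd_mod mod_add_eq)
qed

lift_definition times_zhat :: "zhat \<Rightarrow> zhat \<Rightarrow> zhat" is "\<lambda>x y n. (x n * y n) mod int n"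
proof (intro conjI allI impI)
  fix x y :: "nat \<Rightarrow> int" and m n :: nat
  assume x: "x 0 = 0 \<and> (\<forall>m n. 0 < n \<longrightarrow> m dvd n \<longrightarrow> x m = x n mod int m)"
    and y: "y 0 = 0 \<and> (\<forall>m n. 0 < n \<longrightarrow> m dvd n \<longrightarrow> y m = y n mod int m)"
  have "x 0 = 0" using x by blast
  then show "(x 0 * y 0) mod int 0 = 0" by simp
  assume "0 < n" "m dvd n"
  then have "x m = x n mod int m" "y m = y n mod int m" using x y by blast+
  then show "(x m * y m) mod int m = (x n * y n) mod int n mod int m"
    using \<open>m dvd n\<close> by (simp add: mod_of_dvd_mod mod_mult_eq)
qed

lift_definition uminus_zhat :: "zhat \<Rightarrow> zhat" is "\<lambda>x n. (- x n) mod int n"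
proof (intro conjI allI impI)
  fix x :: "nat \<Rightarrow> int" and m n :: nat
  assume x: "x 0 = 0 \<and> (\<forall>m n. 0 < n \<longrightarrow> m dvd n \<longrightarrow> x m = x n mod int m)"
  have "x 0 = 0" using x by blast
  then show "(- x 0) mod int 0 = 0" by simp
  assume "0 < n" "m dvd n"
  then have "x m = x n mod int m" using x by blast
  then show "(- x m) mod int m = (- x n) mod int n mod int m"
    using \<open>m dvd n\<close> by (simp add: mod_of_dvd_mod mod_minus_eq)
qed

definition minus_zhat :: "zhat \<Rightarrow> zhat \<Rightarrow> zhat" where
  "minus_zhat x y = x + - y"

instance
proof
  fix a b c :: zhat
  show "a + b + c = a + (b + c)"
    by (rule zhat_eqI) (simp add: plus_zhat.rep_eq mod_add_left_eq mod_add_right_eq add.assoc)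
  show "a + b = b + a"
    by (rule zhat_eqI) (simp add: plus_zhat.rep_eq add.commute)
  show "0 + a = a"
    by (rule zhat_eqI) (simp add: plus_zhat.rep_eq zero_zhat.rep_eq)
  show "- a + a = 0"
    by (rule zhat_eqI) (simp add: plus_zhat.rep_eq uminus_zhat.rep_eq zero_zhat.rep_eq mod_add_left_eq)
  show "a - b = a + - b"
    by (rule minus_zhat_def)
  show "a * b * c = a * (b * c)"
    by (rule zhat_eqI) (simp add: times_zhat.rep_eq mod_mult_left_eq mod_mult_right_eq mult.assoc)
  show "a * b = b * a"
    by (rule zhat_eqI) (simp add: times_zhat.rep_eq mult.commute)
  show "1 * a = a"
    by (rule zhat_eqI) (simp add: times_zhat.rep_eq one_zhat.rep_eq mod_mult_left_eq)
  show "(a + b) * c = a * c + b * c"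
    by (rule zhat_eqI)
      (simp add: times_zhat.rep_eq plus_zhat.rep_eq mod_mult_left_eq mod_add_eq distrib_right)
  have "residue 0 2 \<noteq> residue 1 2" by (simp add: zero_zhat.rep_eq one_zhat.rep_eq)
  then show "(0::zhat) \<noteq> 1" by auto
qed

end

lemma residue_of_nat: "residue (of_nat k) n = (if n = 0 then 0 else int k mod int n)"
proof (cases "n = 0")
  case False
  have "residue (of_nat k) n = int k mod int n"
    by (induction k) (simp_all add: zero_zhat.rep_eq one_zhat.rep_eq plus_zhat.rep_eq False
        mod_add_left_eq mod_add_right_eq)
  then show ?thesis using False by simp
qed simp

lemma zhat_torsion_free:
  fixes x :: zhat
  assumes "0 < k" and "x * of_nat k = 0"
  shows "x = 0"
proof (rule zhat_eqI)
  fix n :: nat assume n: "0 < n"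
  have "residue (x * of_nat k) (n * k) = 0"
    using assms(2) by (simp add: zero_zhat.rep_eq)
  then have "(residue x (n * k) * int k) mod int (n * k) = 0"
    using assms(1) n by (simp add: times_zhat.rep_eq residue_of_nat mod_mult_right_eq)
  then have "int n * int k dvd residue x (n * k) * int k"
    by (simp add: mod_eq_0_iff_dvd)
  then have "int n dvd residue x (n * k)"
    using assms(1) by simp
  then have "residue x (n * k) mod int n = 0"
    by simp
  then show "residue x n = residue 0 n"
    using residue_dvd[of "n * k" n x] assms(1) n by (simp add: zero_zhat.rep_eq)
qed

text \<open>Finite adeles as the localisation of the profinite integers at the positive integers:
  \<open>(x, m)\<close> stands for \<open>x / m\<close>.\<close>

definition adele_rel :: "zhat \<times> nat \<Rightarrow> zhat \<times> nat \<Rightarrow> bool" where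
  "adele_rel p q \<longleftrightarrow> 0 < snd p \<and> 0 < snd q \<and> fst p * of_nat (snd q) = fst q * of_nat (snd p)"

lemma adele_rel_part_equivp: "part_equivp adele_rel"
proof (rule part_equivpI)
  show "\<exists>p. adele_rel p p"
    by (rule exI[of _ "(0, 1)"]) (simp add: adele_rel_def)
  show "symp adele_rel"
    by (auto simp: symp_def adele_rel_def)
  show "transp adele_rel"
  proof (rule transpI)
    fix p q r assume pq: "adele_rel p q" and qr: "adele_rel q r"
    have "(fst p * of_nat (snd r) - fst r * of_nat (snd p)) * of_nat (snd q)
        = (fst p * of_nat (snd q)) * of_nat (snd r) - (fst r * of_nat (snd q)) * of_nat (snd p)"
      by (simp add: algebra_simps)
    also have "\<dots> = (fst q * of_nat (snd p)) * of_nat (snd r) - (fst q * of_nat (snd r)) * of_nat (snd p)"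
      using pq qr by (simp add: adele_rel_def)
    also have "\<dots> = 0"
      by (simp add: algebra_simps)
    finally have "fst p * of_nat (snd r) - fst r * of_nat (snd p) = 0"
      using zhat_torsion_free pq unfolding adele_rel_def by blast
    then show "adele_rel p r"
      using pq qr by (simp add: adele_rel_def)
  qed
qed

quotient_type fin_adele = "zhat \<times> nat" / partial: adele_rel
  by (rule adele_rel_part_equivp)

instantiation fin_adele :: comm_ring_1
begin

lift_definition zero_fin_adele :: fin_adele is "(0, 1)" by (simp add: adele_rel_def)

lift_definition one_fin_adele :: fin_adele is "(1, 1)" by (simp add: adele_rel_def)

lift_definition plus_fin_adele :: "fin_adele \<Rightarrow> fin_adele \<Rightarrow> fin_adele" is
  "\<lambda>p q. (fst p * of_nat (snd q) + fst q * of_nat (snd p), snd p * snd q)"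
proof -
  fix p p' q q' :: "zhat \<times> nat"
  assume "adele_rel p p'" "adele_rel q q'"
  then have pos: "0 < snd p" "0 < snd p'" "0 < snd q" "0 < snd q'"
    and p: "fst p * of_nat (snd p') = fst p' * of_nat (snd p)"
    and q: "fst q * of_nat (snd q') = fst q' * of_nat (snd q)"
    by (auto simp: adele_rel_def)
  have "(fst p * of_nat (snd q) + fst q * of_nat (snd p)) * of_nat (snd p' * snd q')
      = (fst p * of_nat (snd p')) * of_nat (snd q * snd q')
        + (fst q * of_nat (snd q')) * of_nat (snd p * snd p')"
    by (simp add: algebra_simps)
  also have "\<dots> = (fst p' * of_nat (snd q') + fst q' * of_nat (snd p')) * of_nat (snd p * snd q)"
    unfolding p q by (simp add: algebra_simps)
  finally show "adele_rel (fst p * of_nat (snd q) + fst q * of_nat (snd p), snd p * snd q)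
      (fst p' * of_nat (snd q') + fst q' * of_nat (snd p'), snd p' * snd q')"
    using pos by (simp add: adele_rel_def)
qed

lift_definition times_fin_adele :: "fin_adele \<Rightarrow> fin_adele \<Rightarrow> fin_adele" is
  "\<lambda>p q. (fst p * fst q, snd p * snd q)"
proof -
  fix p p' q q' :: "zhat \<times> nat"
  assume "adele_rel p p'" "adele_rel q q'"
  then have pos: "0 < snd p" "0 < snd p'" "0 < snd q" "0 < snd q'"
    and p: "fst p * of_nat (snd p') = fst p' * of_nat (snd p)"
    and q: "fst q * of_nat (snd q') = fst q' * of_nat (snd q)"
    by (auto simp: adele_rel_def)
  have "(fst p * fst q) * of_nat (snd p' * snd q')
      = (fst p * of_nat (snd p')) * (fst q * of_nat (snd q'))"
    by (simp add: algebra_simps)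
  also have "\<dots> = (fst p' * fst q') * of_nat (snd p * snd q)"
    unfolding p q by (simp add: algebra_simps)
  finally show "adele_rel (fst p * fst q, snd p * snd q) (fst p' * fst q', snd p' * snd q')"
    using pos by (simp add: adele_rel_def)
qed

lift_definition uminus_fin_adele :: "fin_adele \<Rightarrow> fin_adele" is "\<lambda>p. (- fst p, snd p)"
  by (simp add: adele_rel_def)

definition minus_fin_adele :: "fin_adele \<Rightarrow> fin_adele \<Rightarrow> fin_adele" where
  "minus_fin_adele x y = x + - y"

instance
proof
  fix a b c :: fin_adele
  show "a + b + c = a + (b + c)" by transfer (simp add: adele_rel_def algebra_simps)
  show "a + b = b + a" by transfer (simp add: adele_rel_def algebra_simps)
  show "0 + a = a" by transfer (simp add: adele_rel_def algebra_simps)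
  show "- a + a = 0" by transfer (simp add: adele_rel_def algebra_simps)
  show "a - b = a + - b" by (rule minus_fin_adele_def)
  show "a * b * c = a * (b * c)" by transfer (simp add: adele_rel_def algebra_simps)
  show "a * b = b * a" by transfer (simp add: adele_rel_def algebra_simps)
  show "1 * a = a" by transfer (simp add: adele_rel_def algebra_simps)
  show "(a + b) * c = a * c + b * c" by transfer (simp add: adele_rel_def algebra_simps)
  show "(0::fin_adele) \<noteq> 1" by transfer (simp add: adele_rel_def)
qed

end

definition adele_of_zhat :: "zhat \<Rightarrow> fin_adele" where
  "adele_of_zhat x = abs_fin_adele (x, 1)"

definition adele_of_rat :: "rat \<Rightarrow> fin_adele" where
  "adele_of_rat r = (let (m, n) = quotient_of r in abs_fin_adele (of_int m, nat n))"

definition zhat_inverse :: "zhat \<Rightarrow> zhat" where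
  "zhat_inverse \<mu> = (THE \<nu>. \<mu> * \<nu> = 1)"

definition zhat_units :: "zhat set" where
  "zhat_units = {\<mu>. \<mu> dvd 1}"

section \<open>The Shimura variety and its quotient by \<open>Delta\<close>\<close>

type_synonym adelic_matrix = "fin_adele^2^2"

abbreviation mat2 :: "'a::zero \<Rightarrow> 'a \<Rightarrow> 'a \<Rightarrow> 'a \<Rightarrow> 'a^2^2" where
  "mat2 a b c d \<equiv> vector [vector [a, b], vector [c, d]]"

definition GL2Q :: "(rat^2^2) set" where
  "GL2Q = {q. invertible q}"

definition GL2Af :: "adelic_matrix set" where
  "GL2Af = {g. invertible g}"

definition GL2Zhat :: "adelic_matrix set" where
  "GL2Zhat = {map_matrix adele_of_zhat g | g. invertible g}"

definition K_level :: "nat \<Rightarrow> adelic_matrix set" where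
  "K_level N = {map_matrix adele_of_zhat g | g. invertible g \<and> (\<forall>i j. of_nat N dvd (g - mat 1) $ i $ j)}"

definition mobius :: "rat^2^2 \<Rightarrow> complex \<Rightarrow> complex" where
  "mobius q \<tau> = (of_rat (q$1$1) * \<tau> + of_rat (q$1$2)) / (of_rat (q$2$1) * \<tau> + of_rat (q$2$2))"

definition double_half_plane :: "complex set" where
  "double_half_plane = - \<real>"

type_synonym shimura_point = "(complex \<times> adelic_matrix) set"

definition cls :: "complex \<Rightarrow> adelic_matrix \<Rightarrow> shimura_point" where
  "cls \<tau> a = {(mobius q \<tau>, map_matrix adele_of_rat q ** a) | q. q \<in> GL2Q}"

definition Shimura :: "shimura_point set" where
  "Shimura = {cls \<tau> a | \<tau> a. \<tau> \<in> double_half_plane \<and> a \<in> GL2Af}"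

definition hecke :: "adelic_matrix \<Rightarrow> shimura_point \<Rightarrow> shimura_point" where
  "hecke g x = (\<lambda>(\<tau>, a). (\<tau>, a ** matrix_inv g)) ` x"

definition Delta :: "adelic_matrix set" where
  "Delta = {mat2 (adele_of_zhat \<mu>) 0 0 1 | \<mu>. \<mu> \<in> zhat_units}"

definition Delta_orbit :: "shimura_point \<Rightarrow> shimura_point set" where
  "Delta_orbit x = (\<lambda>d. hecke d x) ` Delta"

definition S_approx :: "shimura_point set set" where
  "S_approx = Delta_orbit ` Shimura"

definition Gtilde :: "adelic_matrix set" where
  "Gtilde = {mat2 (adele_of_rat q) 0 0 1 ** s | q s. 0 < q \<and> det s = 1}"

text \<open>The graph of \<open>h\<close> acting on \<open>S_approx\<close>. Only representatives with \<open>\<tau>\<close> in the upper half-plane and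
  positive rational determinant are used: right multiplication by \<open>h\<inverse>\<close> does not preserve
  \<open>Delta\<close>-orbits for arbitrary representatives.\<close>

definition graph :: "adelic_matrix \<Rightarrow> (shimura_point set \<times> shimura_point set) set" where
  "graph h = {(Delta_orbit (cls \<tau> a), Delta_orbit (cls \<tau> (a ** matrix_inv h))) | \<tau> a.
     0 < Im \<tau> \<and> a \<in> GL2Af \<and> (\<exists>q>0. det a = adele_of_rat q)}"

section \<open>Automorphisms of the complex field and the abelian closure of the rationals\<close>

definition Aut_C :: "(complex \<Rightarrow> complex) set" where
  "Aut_C = {\<sigma>. bij \<sigma> \<and> (\<forall>x y. \<sigma> (x + y) = \<sigma> x + \<sigma> y) \<and> (\<forall>x y. \<sigma> (x * y) = \<sigma> x * \<sigma> y)}"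

definition subfield_C :: "complex set \<Rightarrow> bool" where
  "subfield_C F \<longleftrightarrow> 0 \<in> F \<and> 1 \<in> F \<and>
     (\<forall>x\<in>F. \<forall>y\<in>F. x + y \<in> F \<and> x * y \<in> F) \<and> (\<forall>x\<in>F. - x \<in> F \<and> inverse x \<in> F)"

definition embeddings :: "complex set \<Rightarrow> (complex \<Rightarrow> complex) set" where
  "embeddings F = {f \<in> extensional F. f 1 = 1 \<and>
     (\<forall>x\<in>F. \<forall>y\<in>F. f (x + y) = f x + f y \<and> f (x * y) = f x * f y)}"

definition Gal_over_Q :: "complex set \<Rightarrow> (complex \<Rightarrow> complex) set" where
  "Gal_over_Q F = {f \<in> embeddings F. bij_betw f F F}"

definition abelian_extension_of_Q :: "complex set \<Rightarrow> bool" where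
  "abelian_extension_of_Q F \<longleftrightarrow> subfield_C F \<and> (\<forall>x\<in>F. algebraic x) \<and>
     (\<forall>f\<in>embeddings F. f ` F = F) \<and>
     (\<forall>f\<in>Gal_over_Q F. \<forall>g\<in>Gal_over_Q F. \<forall>x\<in>F. f (g x) = g (f x))"

definition Q_ab :: "complex set" where
  "Q_ab = \<Union>{F. abelian_extension_of_Q F}"

text \<open>The identification of the Galois group of \<open>Q_ab\<close> with the profinite units: \<open>\<gamma>\<close> corresponds to \<open>\<mu>\<close> if
  it raises every root of unity to the power \<open>\<mu>\<close>.\<close>

definition cyclotomic :: "(complex \<Rightarrow> complex) \<Rightarrow> zhat \<Rightarrow> bool" where
  "cyclotomic \<gamma> \<mu> \<longleftrightarrow> \<gamma> \<in> Gal_over_Q Q_ab \<and> \<mu> \<in> zhat_units \<and>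
     (\<forall>n \<zeta>. 0 < n \<longrightarrow> \<zeta> ^ n = 1 \<longrightarrow> \<gamma> \<zeta> = \<zeta> ^ nat (residue \<mu> n))"

section \<open>Elliptic curves with level structure\<close>

definition lattice :: "complex \<Rightarrow> complex set" where
  "lattice \<tau> = {of_int m + of_int n * \<tau> | m n. True}"

definition eisenstein :: "nat \<Rightarrow> complex \<Rightarrow> complex" where
  "eisenstein k \<tau> = (\<Sum>\<^sub>\<infinity>\<omega>\<in>lattice \<tau> - {0}. 1 / \<omega> ^ k)"

definition g2 :: "complex \<Rightarrow> complex" where
  "g2 \<tau> = 60 * eisenstein 4 \<tau>"

definition g3 :: "complex \<Rightarrow> complex" where
  "g3 \<tau> = 140 * eisenstein 6 \<tau>"

definition wp :: "complex \<Rightarrow> complex \<Rightarrow> complex" where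
  "wp \<tau> z = 1 / z ^ 2 + (\<Sum>\<^sub>\<infinity>\<omega>\<in>lattice \<tau> - {0}. 1 / (z - \<omega>) ^ 2 - 1 / \<omega> ^ 2)"

text \<open>The image of \<open>z\<close> on the projective curve \<open>y\<^sup>2 = 4x\<^sup>3 - g2 \<tau> x - g3 \<tau>\<close>; \<open>None\<close> is the point at
  infinity.\<close>

definition curve_point :: "complex \<Rightarrow> complex \<Rightarrow> (complex \<times> complex) option" where
  "curve_point \<tau> z = (if z \<in> lattice \<tau> then None else Some (wp \<tau> z, deriv (wp \<tau>) z))"

text \<open>A rational number with the same class modulo the integral adeles as \<open>x\<close>. It is determined up to
  an integer, which does not affect its use in \<open>torsion_point\<close>.\<close>

definition rat_part :: "fin_adele \<Rightarrow> rat" where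
  "rat_part x = (SOME r. x - adele_of_rat r \<in> range adele_of_zhat)"

text \<open>The curve attached to \<open>\<tau>\<close> has rational homology the column vectors, with Hodge filtration
  spanned by the column \<open>(\<tau>, 1)\<close> on which \<open>GL\<^sub>2\<close> acts by Moebius transformations. Thus its Lie algebra
  is the quotient by this line, with coordinate \<open>(x, y) \<mapsto> x - y \<tau>\<close>. This gives the isomorphism from
  column vectors of adeles modulo integral adeles to torsion points.\<close>

definition torsion_point :: "complex \<Rightarrow> fin_adele^2 \<Rightarrow> (complex \<times> complex) option" where
  "torsion_point \<tau> v = curve_point \<tau> (of_rat (rat_part (v$1)) - of_rat (rat_part (v$2)) * \<tau>)"

text \<open>An elliptic curve in Weierstrass form (coefficients \<open>g2\<close>, \<open>g3\<close>) with a pair of points.\<close>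

type_synonym level_curve = "complex \<times> complex \<times> (2 \<Rightarrow> (complex \<times> complex) option)"

text \<open>The curve attached to \<open>\<tau>\<close> with the basis of its \<open>N\<close>-torsion that a matrix \<open>a\<close> over the profinite
  integers induces: the images of the columns of \<open>a / N\<close>.\<close>

definition level_curve_of :: "nat \<Rightarrow> complex \<Rightarrow> adelic_matrix \<Rightarrow> level_curve" where
  "level_curve_of N \<tau> a =
     (g2 \<tau>, g3 \<tau>, \<lambda>j. torsion_point \<tau> (\<chi> i. adele_of_rat (1 / of_nat N) * a$i$j))"

definition conj_level_curve :: "(complex \<Rightarrow> complex) \<Rightarrow> level_curve \<Rightarrow> level_curve" where
  "conj_level_curve \<sigma> = (\<lambda>(A, B, P). (\<sigma> A, \<sigma> B, \<lambda>j. map_option (map_prod \<sigma> \<sigma>) (P j)))"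

definition iso_level_curve :: "level_curve \<Rightarrow> level_curve \<Rightarrow> bool" where
  "iso_level_curve = (\<lambda>(A, B, P) (A', B', P'). \<exists>u. u \<noteq> 0 \<and> A' = u ^ 4 * A \<and> B' = u ^ 6 * B \<and>
     (\<forall>j. P' j = map_option (\<lambda>(x, y). (u ^ 2 * x, u ^ 3 * y)) (P j)))"

section \<open>Canonical models and the action on \<open>Shimura\<close>\<close>

text \<open>Affine \<open>n\<close>-space consists of the sequences that vanish from index \<open>n\<close> on.\<close>

inductive_set rational_polynomials :: "((nat \<Rightarrow> complex) \<Rightarrow> complex) set" where
  const: "(\<lambda>_. of_rat r) \<in> rational_polynomials"
| coord: "(\<lambda>z. z i) \<in> rational_polynomials"
| add: "f \<in> rational_polynomials \<Longrightarrow> g \<in> rational_polynomials \<Longrightarrow> (\<lambda>z. f z + g z) \<in> rational_polynomials"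
| mult: "f \<in> rational_polynomials \<Longrightarrow> g \<in> rational_polynomials \<Longrightarrow> (\<lambda>z. f z * g z) \<in> rational_polynomials"

definition affine_variety_over_Q :: "nat \<Rightarrow> (nat \<Rightarrow> complex) set \<Rightarrow> bool" where
  "affine_variety_over_Q n V \<longleftrightarrow>
     (\<exists>F\<subseteq>rational_polynomials. V = {z. (\<forall>i\<ge>n. z i = 0) \<and> (\<forall>f\<in>F. f z = 0)})"

text \<open>\<open>\<phi>\<close> identifies \<open>Shimura / K_level N\<close> with the complex points of a curve over the rationals. The immersion
  condition is required only for \<open>N \<ge> 2\<close>, because for \<open>N = 1\<close> the map to the quotient is ramified at the
  elliptic points.\<close>

definition model_over_Q :: "nat \<Rightarrow> (shimura_point \<Rightarrow> nat \<Rightarrow> complex) \<Rightarrow> bool" where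
  "model_over_Q N \<phi> \<longleftrightarrow>
     (\<exists>n. affine_variety_over_Q n (\<phi> ` Shimura)) \<and>
     (\<forall>x\<in>Shimura. \<forall>y\<in>Shimura. \<phi> x = \<phi> y \<longleftrightarrow> (\<exists>k\<in>K_level N. y = hecke k x)) \<and>
     (\<forall>a\<in>GL2Af.
        (\<forall>i. (\<lambda>\<tau>. \<phi> (cls \<tau> a) i) holomorphic_on double_half_plane) \<and>
        (2 \<le> N \<longrightarrow> (\<forall>\<tau>\<in>double_half_plane. \<exists>i. deriv (\<lambda>\<tau>. \<phi> (cls \<tau> a) i) \<tau> \<noteq> 0)) \<and>
        (\<forall>U. open U \<longrightarrow> U \<subseteq> double_half_plane \<longrightarrow>
           openin (top_of_set (\<phi> ` Shimura)) ((\<lambda>\<tau>. \<phi> (cls \<tau> a)) ` U)))"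

text \<open>The canonical model is the moduli scheme over the rationals of elliptic curves with level
  \<open>N\<close> structure: conjugating the coordinates of a point amounts to conjugating the coefficients
  of the elliptic curve and the coordinates of the points of its level structure. Every point of \<open>Shimura\<close> has a
  representative \<open>(\<tau>, a)\<close> with \<open>a\<close> in \<open>GL2Zhat\<close>.\<close>

definition canonical_model :: "nat \<Rightarrow> (shimura_point \<Rightarrow> nat \<Rightarrow> complex) \<Rightarrow> bool" where
  "canonical_model N \<phi> \<longleftrightarrow> model_over_Q N \<phi> \<and>
     (\<forall>\<sigma>\<in>Aut_C. \<forall>\<tau>\<in>double_half_plane. \<forall>\<tau>'\<in>double_half_plane. \<forall>a\<in>GL2Zhat. \<forall>a'\<in>GL2Zhat.
        \<phi> (cls \<tau>' a') = \<sigma> \<circ> \<phi> (cls \<tau> a) \<longleftrightarrow>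
        iso_level_curve (conj_level_curve \<sigma> (level_curve_of N \<tau> a)) (level_curve_of N \<tau>' a'))"

text \<open>The action of \<open>Aut_C\<close> on \<open>Shimura\<close> as the limit of the canonical models; \<open>act\<close> is
  uniquely determined on \<open>Shimura\<close> by the last clause.\<close>

definition canonical_action :: "((complex \<Rightarrow> complex) \<Rightarrow> shimura_point \<Rightarrow> shimura_point) \<Rightarrow> bool" where
  "canonical_action act \<longleftrightarrow>
     (\<forall>\<sigma>\<in>Aut_C. bij_betw (act \<sigma>) Shimura Shimura) \<and>
     (\<forall>\<sigma>\<in>Aut_C. \<forall>\<rho>\<in>Aut_C. \<forall>x\<in>Shimura. act (\<sigma> \<circ> \<rho>) x = act \<sigma> (act \<rho> x)) \<and>
     (\<forall>\<sigma>\<in>Aut_C. \<forall>g\<in>GL2Af. \<forall>x\<in>Shimura. act \<sigma> (hecke g x) = hecke g (act \<sigma> x)) \<and>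
     (\<forall>N>0. \<exists>\<phi>. canonical_model N \<phi> \<and> (\<forall>\<sigma>\<in>Aut_C. \<forall>x\<in>Shimura. \<phi> (act \<sigma> x) = \<sigma> \<circ> \<phi> x))"

text \<open>The image of a relation on \<open>S_approx\<close> under the action induced by a permutation \<open>s\<close> of \<open>Shimura\<close>.\<close>

definition transport ::
  "(shimura_point \<Rightarrow> shimura_point) \<Rightarrow> (shimura_point set \<times> shimura_point set) set \<Rightarrow>
   (shimura_point set \<times> shimura_point set) set" where
  "transport s R = (\<lambda>(P, P'). (s ` P, s ` P')) ` R"

end

theory Submission
  imports "HOL-Complex_Analysis.Complex_Analysis" "HOL-Computational_Algebra.Computational_Algebra" Defs
begin

text \<open>
  The action of an automorphism \<open>\<sigma>\<close> commutes with the Hecke operators, so it is determined by the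
  images of the classes of \<open>(\<tau>, 1)\<close>. If \<open>(\<tau>, 1)\<close> goes to \<open>(\<tau>', b)\<close> with both \<open>\<tau>, \<tau>'\<close> in the upper
  half-plane, the claim reduces to \<open>det b \<in> \<mu> \<rat>\<^sub>+\<close>, where \<open>\<mu>\<close> is the cyclotomic character
  of \<open>\<sigma>\<close>: then \<open>b = a' diag(\<mu>, 1)\<close> with \<open>det a'\<close> rational, and moving \<open>diag(\<mu>, 1)\<close> across \<open>h\<inverse>\<close>
  conjugates \<open>h\<close>.

  The determinant is read off from the Weil pairing. To avoid the group law, it is
  written as a product of differences of \<open>x\<close>-coordinates of torsion points: for
  \<open>\<wp>(z) - \<wp>(v) = K \<theta>(z + v) \<theta>(z - v) / \<theta>(z)\<^sup>2\<close> such products telescope to quasi-periods of the theta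
  function. All points that occur are primitive, so the Hecke action of \<open>GL\<^sub>2\<close> of the integers
  transports their \<open>x\<close>-coordinates to the conjugate curve, up to a common factor \<open>u\<^sup>2\<close>; this factor is the same for
  all points once \<open>g2\<close> and \<open>g3\<close> do not vanish, which holds after replacing \<open>\<tau>\<close> by a large multiple.

  The character is onto because cyclotomic polynomials are irreducible and every automorphism of
  a subfield of the complex numbers extends to the complex numbers.
\<close>

text \<open>Each factor of the products involves only points \<open>k P + Q\<close>,
  \<open>k P - Q\<close> and their mirror images. Such a point is the first column of an integral
  matrix of determinant 1 or -1, written in the torsion basis. It therefore belongs to the level
  structure of another point of the same Hecke orbit, and the moduli description of the canonical
  model applies to it directly.

  A single telescoped product still contains the \<open>N\<close>-th power of a theta quotient in
  \<open>P + Q\<close> and \<open>P - Q\<close>, which is not expressed by x-coordinates. Exchanging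
  \<open>P\<close> and \<open>Q\<close> changes this quotient only by a sign, so for even
  \<open>N\<close> it cancels from the ratio of the two products. What remains is a square of the
  pairing; the factor 2 lost in this way is recovered by working at level \<open>4 n\<close> to find
  a determinant modulo \<open>n\<close>.

  Taking both points in the upper half-plane fixes the sign: for an integral representative of the
  image the determinant is exactly \<open>\<mu>\<close>, and the positive rational factor only
  records the scaling of \<open>\<tau>\<close>.\<close>

no_notation fps_nth (infixl \<open>$\<close> 75)
hide_const (open) Complex_Residues.residue

section \<open>Roots of unity and integral polynomials\<close>

text \<open>All inner binomial coefficients of a prime exponent are divisible by that prime.\<close>

lemma prime_dvd_add_power_diff:
  fixes a b :: "'a::comm_ring_1"
  assumes "prime p"
  shows "of_nat p dvd (a + b) ^ p - (a ^ p + b ^ p)"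
proof -
  have p: "0 < p" using assms prime_gt_0_nat by blast
  have "(a + b) ^ p = (\<Sum>k\<le>p. of_nat (p choose k) * a ^ k * b ^ (p - k))"
    by (rule binomial_ring)
  also have "{..p} = insert 0 (insert p {1..<p})"
    using p by auto
  also have "(\<Sum>k\<in>\<dots>. of_nat (p choose k) * a ^ k * b ^ (p - k)) =
     b ^ p + (a ^ p + (\<Sum>k\<in>{1..<p}. of_nat (p choose k) * a ^ k * b ^ (p - k)))"
    using p by simp
  finally have eq: "(a + b) ^ p - (a ^ p + b ^ p) = (\<Sum>k\<in>{1..<p}. of_nat (p choose k) * a ^ k * b ^ (p - k))"
    by simp
  have "of_nat p dvd (of_nat (p choose k) * a ^ k * b ^ (p - k) :: 'a)" if "k \<in> {1..<p}" for k
  proof -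
    have "p dvd (p choose k)"
      by (rule dvd_choose_prime) (use that assms in auto)
    then have "(of_nat p :: 'a) dvd of_nat (p choose k)"
      by (metis dvd_def of_nat_mult)
    then show ?thesis
      by (simp add: dvd_mult2)
  qed
  then show ?thesis
    unfolding eq by (rule dvd_sum)
qed

text \<open>Additivity of the \<open>p\<close>-th power modulo \<open>p\<close> gives the natural
  numbers by induction; other integers are replaced by their residue.\<close>

lemma int_fermat:
  fixes a :: int
  assumes "prime p"
  shows "int p dvd a ^ p - a"
proof -
  have nat: "int p dvd int k ^ p - int k" for k
  proof (induction k)
    case 0
    then show ?case using assms prime_gt_0_nat[of p] by (simp add: power_0_left)
  next
    case (Suc k)
    have "int p dvd (int k + 1) ^ p - (int k ^ p + 1 ^ p)"
      using prime_dvd_add_power_diff[OF assms, of "int k" 1] by simp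
    from dvd_add[OF this Suc] show ?case
      by (simp add: algebra_simps)
  qed
  have "0 < p" using assms prime_gt_0_nat by blast
  then have "a mod int p = int (nat (a mod int p))"
    by simp
  then have "int p dvd (a mod int p) ^ p - a mod int p"
    using nat by metis
  then have "((a mod int p) ^ p) mod int p = (a mod int p) mod int p"
    by (simp only: mod_eq_dvd_iff)
  then have "a ^ p mod int p = a mod int p"
    by (simp add: power_mod)
  then show ?thesis
    by (simp only: mod_eq_dvd_iff)
qed

text \<open>Modulo \<open>p\<close> both sides are additive in \<open>m\<close>; they agree on
  constants by Fermat and are compatible with multiplication by the variable.\<close>

lemma frobenius_int_poly:
  fixes m :: "int poly"
  assumes "prime p"
  shows "of_nat p dvd pcompose m (monom 1 p) - m ^ p"
proof (induction m)
  case 0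
  then show ?case using assms prime_gt_0_nat[of p] by (simp add: power_0_left)
next
  case (pCons a f)
  let ?X = "[:0, 1:] :: int poly"
  have X: "?X ^ p = monom 1 p"
    by (simp add: monom_altdef)
  have pc: "pCons a f = [:a:] + ?X * f"
    by simp
  have 1: "of_nat p dvd (pCons a f) ^ p - ([:a:] ^ p + (?X * f) ^ p)"
    unfolding pc by (rule prime_dvd_add_power_diff[OF assms])
  have 2: "of_nat p dvd [:a:] ^ p - [:a:]"
  proof -
    have "[:a:] ^ p - [:a:] = [:a ^ p - a:]"
      by (simp add: poly_const_pow)
    then show ?thesis
      using int_fermat[OF assms, of a] by (simp add: of_nat_poly)
  qed
  have 3: "of_nat p dvd monom 1 p * (pcompose f (monom 1 p) - f ^ p)"
    using pCons.IH by simp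
  have "pcompose (pCons a f) (monom 1 p) - (pCons a f) ^ p =
      monom 1 p * (pcompose f (monom 1 p) - f ^ p) - ([:a:] ^ p - [:a:])
      - ((pCons a f) ^ p - ([:a:] ^ p + (?X * f) ^ p))"
    by (simp only: pcompose_pCons power_mult_distrib X) (simp add: algebra_simps)
  then show ?case
    using 1 2 3 by (simp only: dvd_diff)
qed

section \<open>Integral polynomials evaluated at complex numbers\<close>

abbreviation int_eval :: "int poly \<Rightarrow> complex \<Rightarrow> complex" where
  "int_eval P z \<equiv> poly (map_poly of_int P) z"

lemma int_eval_pCons: "int_eval (pCons a P) z = of_int a + z * int_eval P z"
  by (simp add: map_poly_pCons)

lemma int_eval_add: "int_eval (P + Q) z = int_eval P z + int_eval Q z"
proof -
  have "map_poly of_int (P + Q) = map_poly of_int P + (map_poly of_int Q :: complex poly)"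
    by (rule poly_eqI) (simp add: coeff_map_poly)
  then show ?thesis by simp
qed

lemma int_eval_minus: "int_eval (P - Q) z = int_eval P z - int_eval Q z"
proof -
  have "map_poly of_int (P - Q) = map_poly of_int P - (map_poly of_int Q :: complex poly)"
    by (rule poly_eqI) (simp add: coeff_map_poly)
  then show ?thesis by simp
qed

lemma int_eval_smult: "int_eval (smult c P) z = of_int c * int_eval P z"
proof -
  have "map_poly of_int (smult c P) = smult (of_int c) (map_poly of_int P :: complex poly)"
    by (rule poly_eqI) (simp add: coeff_map_poly)
  then show ?thesis by simp
qed

lemma int_eval_mult: "int_eval (P * Q) z = int_eval P z * int_eval Q z"
proof (induction P)
  case (pCons a P)
  have "pCons a P * Q = smult a Q + pCons 0 (P * Q)"
    by (simp add: mult_pCons_left)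
  then show ?case
    by (simp add: int_eval_add int_eval_smult int_eval_pCons pCons.IH algebra_simps)
qed simp

lemma int_eval_1: "int_eval 1 z = 1"
  using int_eval_pCons[of 1 0 z] by (simp add: one_pCons)

lemma int_eval_const: "int_eval [:c:] z = of_int c"
  by (simp add: int_eval_pCons)

lemma int_eval_power: "int_eval (P ^ k) z = int_eval P z ^ k"
  by (induction k) (simp_all add: int_eval_1 int_eval_mult)

lemma int_eval_monom: "int_eval (monom 1 k) z = z ^ k"
proof -
  have "monom 1 k = [:0, 1:: int:] ^ k" by (simp add: monom_altdef)
  then show ?thesis
    by (simp only: int_eval_power) (simp add: int_eval_pCons)
qed

lemma int_eval_pcompose: "int_eval (pcompose P Q) z = int_eval P (int_eval Q z)"
  by (induction P) (simp_all add: pcompose_pCons int_eval_add int_eval_mult int_eval_const int_eval_pCons)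

text \<open>The primitive integral minimal polynomial; by Gauss' lemma the integral polynomials
  vanishing at \<open>z\<close> are its multiples over the integers.\<close>

lemma obtain_int_minimal_poly:
  assumes "P \<noteq> 0" "int_eval P z = 0"
  obtains m where "prime_elem m" "0 < degree m" "int_eval m z = 0" "\<And>Q. int_eval Q z = 0 \<Longrightarrow> m dvd Q"
proof -
  define m0 where "m0 = (ARG_MIN degree Q. Q \<noteq> 0 \<and> int_eval Q z = 0)"
  have m0: "m0 \<noteq> 0" "int_eval m0 z = 0"
    using arg_min_natI[of "\<lambda>Q. Q \<noteq> 0 \<and> int_eval Q z = 0" P degree] assms unfolding m0_def by auto
  have min0: "degree m0 \<le> degree Q" if "Q \<noteq> 0" "int_eval Q z = 0" for Q
    unfolding m0_def by (rule arg_min_nat_le) (use that in auto)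
  have prod: "int_eval (prod_mset A) z = 0 \<Longrightarrow> \<exists>q\<in>#A. int_eval q z = 0" for A
    by (induction A) (auto simp: int_eval_1 int_eval_mult)
  have "m0 dvd prod_mset (prime_factorization m0)"
    using m0 prod_mset_prime_factorization_weak[of m0] by (metis associated_iff_dvd)
  then obtain k where "prod_mset (prime_factorization m0) = m0 * k" by blast
  then have "int_eval (prod_mset (prime_factorization m0)) z = 0"
    by (simp add: int_eval_mult m0)
  \<comment> \<open>A prime factor of a polynomial of least degree that still vanishes at
    \<open>z\<close>. Primality among integral polynomials makes it primitive as well as
    irreducible.\<close>
  then obtain m where m: "m \<in># prime_factorization m0" "int_eval m z = 0"
    using prod by blast
  have pm: "prime_elem m" and md: "m dvd m0"
    using m(1) by (auto simp: in_prime_factors_iff)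
  have m_nz: "m \<noteq> 0" using pm by auto
  have min: "degree m \<le> degree Q" if "Q \<noteq> 0" "int_eval Q z = 0" for Q
    using dvd_imp_degree_le[OF md] min0[OF that] m0 by simp
  have deg: "0 < degree m"
  proof (rule ccontr)
    assume "\<not> 0 < degree m"
    then obtain c where "m = [:c:]" by (auto elim: degree_eq_zeroE)
    then show False using m(2) m_nz by (simp add: int_eval_const)
  qed
  have "m dvd Q" if Q: "int_eval Q z = 0" for Q
  proof -
    \<comment> \<open>Pseudo-division stays integral at the price of the factor \<open>a\<close>.
      The remainder vanishes at \<open>z\<close> and has too small a degree, so it is zero;
      primality of \<open>m\<close> then removes \<open>a\<close>, which \<open>m\<close> cannot
      divide for reasons of degree.\<close>
    obtain a q where a: "a \<noteq> 0" and eq: "smult a Q = m * q + pseudo_mod Q m"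
      using pseudo_mod(1)[OF m_nz, of Q] by blast
    have "int_eval (pseudo_mod Q m) z = int_eval (smult a Q - m * q) z"
      by (simp add: eq)
    also have "\<dots> = 0"
      by (simp add: int_eval_minus int_eval_smult int_eval_mult Q m(2))
    finally have "int_eval (pseudo_mod Q m) z = 0" .
    then have "pseudo_mod Q m = 0"
      using pseudo_mod(2)[OF m_nz, of Q] min by force
    then have "m dvd [:a:] * Q"
      using eq by simp
    then have "m dvd [:a:] \<or> m dvd Q"
      using pm by (simp only: prime_elem_dvd_mult_iff)
    then show ?thesis
      using dvd_imp_degree_le[of m "[:a:]"] a deg by auto
  qed
  then show ?thesis using that pm deg m(2) by blast
qed

text \<open>Over the field with \<open>p\<close> elements a polynomial of positive degree does not
  divide a nonzero constant. The argument stays over the integers: \<open>K2\<close> is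
  \<open>K\<close> without the coefficients divisible by \<open>p\<close>, so its leading
  coefficient survives modulo \<open>p\<close>, and so does that of \<open>m * K2\<close>.\<close>

lemma int_poly_const_not_dvd_mod_prime:
  fixes m G K :: "int poly"
  assumes p: "prime p" and lc: "\<not> int p dvd lead_coeff m" and deg: "0 < degree m"
    and eq: "m * K = smult (int p) G - [:c:]"
  shows "int p dvd c"
proof (rule ccontr)
  assume c: "\<not> int p dvd c"
  define K2 where "K2 = map_poly (\<lambda>c. if int p dvd c then 0 else c) K"
  have cK2: "coeff K2 i = (if int p dvd coeff K i then 0 else coeff K i)" for i
    unfolding K2_def by (simp add: coeff_map_poly)
  have "[:int p:] dvd K - K2"
    by (simp add: const_poly_dvd_iff cK2)
  then obtain K1 where K1: "K - K2 = [:int p:] * K1" by blast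
  have eq2: "m * K2 = smult (int p) (G - m * K1) - [:c:]"
  proof -
    have "m * K2 = m * K - m * (K - K2)" by (simp add: algebra_simps)
    also have "\<dots> = smult (int p) (G - m * K1) - [:c:]"
      unfolding K1 eq by (simp add: smult_diff_right)
    finally show ?thesis .
  qed
  have K2nz: "K2 \<noteq> 0"
  proof
    assume "K2 = 0"
    then have "coeff (smult (int p) (G - m * K1)) 0 = c"
      using eq2 by (metis coeff_0 coeff_diff coeff_pCons_0 mult_zero_right eq_iff_diff_eq_0)
    then show False using c by auto
  qed
  have "lead_coeff K2 \<noteq> 0" using K2nz by simp
  then have "\<not> int p dvd lead_coeff K2"
    using cK2[of "degree K2"] by (auto split: if_splits)
  then have nd: "\<not> int p dvd lead_coeff (m * K2)"
    using lc p by (simp add: lead_coeff_mult prime_dvd_mult_iff)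
  have "degree (m * K2) > 0"
    using deg K2nz by (subst degree_mult_eq) auto
  then have "coeff (m * K2) (degree (m * K2)) = int p * coeff (G - m * K1) (degree (m * K2))"
    by (subst eq2) (auto simp: coeff_pCons split: nat.splits)
  then show False using nd by simp
qed

text \<open>Dedekind's argument for the irreducibility of cyclotomic polynomials. If the minimal
  polynomial \<open>m\<close> of \<open>z\<close> did not vanish at \<open>b = z ^ p\<close>, the
  cofactor \<open>s\<close> of \<open>m\<close> in \<open>X ^ n - 1\<close> would; differentiating
  at \<open>b\<close> and using the Frobenius congruence for \<open>m\<close> would then express
  \<open>n\<close> as \<open>p\<close> times an integral polynomial in \<open>z\<close>.\<close>

lemma int_poly_root_of_unity_prime_power:
  assumes n: "0 < n" and z: "z ^ n = 1" and p: "prime p" "\<not> p dvd n" and P: "int_eval P z = 0"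
  shows "int_eval P (z ^ p) = 0"
proof -
  define U where "U = monom 1 n - (1 :: int poly)"
  have evU: "int_eval U w = w ^ n - 1" for w
    by (simp add: U_def int_eval_minus int_eval_monom int_eval_1)
  have lcU: "degree U = n" "lead_coeff U = 1"
  proof -
    have "degree (monom 1 n + - (1 :: int poly)) = degree (monom 1 n :: int poly)"
      by (rule degree_add_eq_left) (use n in \<open>simp add: degree_monom_eq\<close>)
    then show d: "degree U = n" by (simp add: U_def degree_monom_eq)
    show "lead_coeff U = 1" unfolding d using n by (simp add: U_def)
  qed
  have U0: "U \<noteq> 0" using lcU by auto
  obtain m where m: "prime_elem m" "0 < degree m" "int_eval m z = 0"
      "\<And>Q. int_eval Q z = 0 \<Longrightarrow> m dvd Q"
    by (rule obtain_int_minimal_poly[of U z]) (use U0 evU z in auto)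
  obtain s where s: "U = m * s"
    using m(4)[of U] evU z by auto
  have "lead_coeff m * lead_coeff s = 1"
    using lcU(2) s lead_coeff_mult[of m s] by metis
  then have lcm: "lead_coeff m dvd 1" by (metis dvd_triv_left)
  define b where "b = z ^ p"
  have bn: "b ^ n = 1"
    unfolding b_def using z by (metis power_mult mult.commute power_one)
  have "int_eval m b = 0"
  proof (rule ccontr)
    assume mb: "int_eval m b \<noteq> 0"
    have "int_eval m b * int_eval s b = 0"
      using evU[of b] bn s by (simp add: int_eval_mult)
    then have sb: "int_eval s b = 0" using mb by simp
    obtain G where G: "pcompose m (monom 1 p) - m ^ p = of_nat p * G"
      using frobenius_int_poly[OF p(1), of m] by (auto elim: dvdE)
    have p0: "p > 0" using p(1) prime_gt_0_nat by blast
    have "int_eval m b = int_eval (of_nat p * G) z"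
      using p0 by (simp add: G[symmetric] int_eval_minus int_eval_pcompose int_eval_monom int_eval_power m(3) b_def)
    then have mb': "int_eval m b = of_nat p * int_eval G z"
      by (simp add: of_nat_poly int_eval_smult)
    \<comment> \<open>Since \<open>s\<close> vanishes at \<open>b\<close>, only the term
      \<open>m * pderiv s\<close> contributes there, and the value of \<open>m\<close> at
      \<open>b\<close> is already known to be \<open>p\<close> times an integral expression in
      \<open>z\<close>.\<close>
    have "pderiv U = m * pderiv s + s * pderiv m"
      by (simp add: s pderiv_mult)
    moreover have "pderiv U = smult (int n) (monom 1 (n - 1))"
      by (simp add: U_def pderiv_diff pderiv_monom smult_monom pderiv_1)
    ultimately have "int_eval (smult (int n) (monom 1 (n - 1))) b = int_eval (m * pderiv s + s * pderiv m) b"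
      by simp
    then have "of_nat n * b ^ (n - 1) = int_eval m b * int_eval (pderiv s) b"
      by (simp add: int_eval_add int_eval_mult int_eval_smult int_eval_monom sb)
    then have "of_nat n * (b ^ (n - 1) * b) = of_nat p * (int_eval G z * int_eval (pderiv s) b * b)"
      using mb' by (simp add: mult_ac)
    also have "b ^ (n - 1) * b = 1"
      using bn n by (metis power_minus_mult)
    finally have "of_nat n = of_nat p * (int_eval G z * int_eval (pderiv s) b * b)"
      by simp
    also have "int_eval G z * int_eval (pderiv s) b * b
        = int_eval (G * pcompose (pderiv s) (monom 1 p) * monom 1 p) z"
      by (simp add: int_eval_mult int_eval_pcompose int_eval_monom b_def)
    finally have "int_eval (smult (int p) (G * pcompose (pderiv s) (monom 1 p) * monom 1 p) - [:int n:]) z = 0"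
      by (simp add: int_eval_minus int_eval_smult int_eval_const)
    from m(4)[OF this] obtain K where
      "m * K = smult (int p) (G * pcompose (pderiv s) (monom 1 p) * monom 1 p) - [:int n:]"
      by (metis dvdE)
    moreover have "\<not> int p dvd lead_coeff m"
      using lcm p(1) by (metis dvd_trans not_prime_unit prime_int_nat_transfer nat_int of_nat_0_le_iff prime_nat_int_transfer)
    ultimately have "int p dvd int n"
      using int_poly_const_not_dvd_mod_prime[OF p(1) _ m(2)] by blast
    then show False using p(2) by simp
  qed
  moreover obtain q where "P = m * q" using m(4)[OF P] by blast
  ultimately show ?thesis by (simp add: int_eval_mult b_def)
qed

text \<open>The prime factors of \<open>k\<close> are peeled off one at a time; after each power the
  result is again a root of unity of order dividing \<open>n\<close>.\<close>

lemma int_poly_root_of_unity_power: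
  assumes n: "0 < n" and z: "z ^ n = 1" and k: "coprime k n" and P: "int_eval P z = 0"
  shows "int_eval P (z ^ k) = 0"
proof -
  have "0 < k \<Longrightarrow> coprime k n \<Longrightarrow> z ^ n = 1 \<Longrightarrow> int_eval P z = 0 \<Longrightarrow> int_eval P (z ^ k) = 0" for z
  proof (induction k arbitrary: z rule: less_induct)
    case (less k)
    show ?case
    proof (cases "k = 1")
      case False
      then obtain p where p: "prime p" "p dvd k"
        using prime_factor_nat by blast
      then obtain l where l: "k = p * l" by blast
      have "1 < p" using p(1) prime_gt_1_nat by blast
      then have "l < k" "0 < l" using less.prems(1) l by auto
      have "coprime p n" "coprime l n" using less.prems(2) l by auto
      then have "\<not> p dvd n" using p(1) by (metis coprime_absorb_left not_prime_unit)
      then have "int_eval P (z ^ p) = 0"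
        using int_poly_root_of_unity_prime_power[OF n _ p(1)] less.prems by blast
      moreover have "(z ^ p) ^ n = 1"
        using less.prems(3) by (metis power_mult mult.commute power_one)
      ultimately have "int_eval P ((z ^ p) ^ l) = 0"
        using less.IH[OF \<open>l < k\<close> \<open>0 < l\<close> \<open>coprime l n\<close>] by blast
      then show ?thesis by (simp add: l power_mult)
    qed (use less.prems in auto)
  qed
  \<comment> \<open>The induction covers positive \<open>k\<close>. For \<open>k = 0\<close>
    coprimality forces \<open>n = 1\<close>, hence \<open>z = 1\<close>.\<close>
  then show ?thesis
    using assms by (cases "k = 0") auto
qed

section \<open>Extension of field automorphisms\<close>

text \<open>An isomorphism between two subfields, encoded by its graph; the fields are
  \<open>Domain R\<close> and \<open>Range R\<close>. With relations, unions of chains and inverses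
  need no bookkeeping of domains. The clause that \<open>x\<close> and \<open>y\<close> vanish
  together makes the relation single valued in both directions.\<close>

definition partial_iso :: "(complex \<times> complex) set \<Rightarrow> bool" where
  "partial_iso R \<longleftrightarrow> (0, 0) \<in> R \<and> (1, 1) \<in> R \<and>
     (\<forall>x y u v. (x, y) \<in> R \<longrightarrow> (u, v) \<in> R \<longrightarrow> (x + u, y + v) \<in> R \<and> (x * u, y * v) \<in> R) \<and>
     (\<forall>x y. (x, y) \<in> R \<longrightarrow> (- x, - y) \<in> R \<and> (inverse x, inverse y) \<in> R \<and> (x = 0 \<longleftrightarrow> y = 0))"

lemma partial_isoD:
  assumes "partial_iso R"
  shows "(0, 0) \<in> R" "(1, 1) \<in> R"
    and "(x, y) \<in> R \<Longrightarrow> (u, v) \<in> R \<Longrightarrow> (x + u, y + v) \<in> R"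
    and "(x, y) \<in> R \<Longrightarrow> (u, v) \<in> R \<Longrightarrow> (x * u, y * v) \<in> R"
    and "(x, y) \<in> R \<Longrightarrow> (- x, - y) \<in> R"
    and "(x, y) \<in> R \<Longrightarrow> (inverse x, inverse y) \<in> R"
    and "(x, y) \<in> R \<Longrightarrow> x = 0 \<longleftrightarrow> y = 0"
  using assms unfolding partial_iso_def by blast+

lemma partial_iso_diff:
  assumes "partial_iso R" "(x, y) \<in> R" "(u, v) \<in> R"
  shows "(x - u, y - v) \<in> R"
  using partial_isoD(3)[OF assms(1,2) partial_isoD(5)[OF assms(1,3)]] by simp

lemma partial_iso_single_valued:
  assumes "partial_iso R" "(x, y) \<in> R" "(x, y') \<in> R"
  shows "y = y'"
  using partial_isoD(7)[OF assms(1) partial_iso_diff[OF assms]] by simp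

lemma partial_iso_sum:
  assumes "partial_iso R" "\<And>i. i \<in> A \<Longrightarrow> (f i, g i) \<in> R"
  shows "(sum f A, sum g A) \<in> R"
  using assms(2)
  by (induction A rule: infinite_finite_induct) (auto intro: partial_isoD[OF assms(1)])

lemma partial_iso_converse:
  assumes "partial_iso R"
  shows "partial_iso (R\<inverse>)"
  using assms unfolding partial_iso_def by simp

text \<open>Pairs of a polynomial over the first field and its image over the second.\<close>

definition coeffs_rel :: "(complex \<times> complex) set \<Rightarrow> (complex poly \<times> complex poly) set" where
  "coeffs_rel R = {(P, P'). \<forall>i. (coeff P i, coeff P' i) \<in> R}"

lemma coeffs_relD: "(P, P') \<in> coeffs_rel R \<Longrightarrow> (coeff P i, coeff P' i) \<in> R"
  by (simp add: coeffs_rel_def)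

section \<open>Polynomial arithmetic along a partial isomorphism\<close>

context
  fixes R assumes R: "partial_iso R"
begin

lemma coeffs_rel_add:
  "(P, P') \<in> coeffs_rel R \<Longrightarrow> (Q, Q') \<in> coeffs_rel R \<Longrightarrow> (P + Q, P' + Q') \<in> coeffs_rel R"
  using partial_isoD(3)[OF R] by (simp add: coeffs_rel_def)

lemma coeffs_rel_diff:
  "(P, P') \<in> coeffs_rel R \<Longrightarrow> (Q, Q') \<in> coeffs_rel R \<Longrightarrow> (P - Q, P' - Q') \<in> coeffs_rel R"
  using partial_iso_diff[OF R] by (simp add: coeffs_rel_def)

lemma coeffs_rel_uminus: "(P, P') \<in> coeffs_rel R \<Longrightarrow> (- P, - P') \<in> coeffs_rel R"
  using partial_isoD(5)[OF R] by (simp add: coeffs_rel_def)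

lemma coeffs_rel_mult:
  "(P, P') \<in> coeffs_rel R \<Longrightarrow> (Q, Q') \<in> coeffs_rel R \<Longrightarrow> (P * Q, P' * Q') \<in> coeffs_rel R"
  unfolding coeffs_rel_def
  by (auto simp: coeff_mult intro!: partial_iso_sum[OF R] partial_isoD(4)[OF R])

lemma coeffs_rel_monom: "(x, y) \<in> R \<Longrightarrow> (monom x k, monom y k) \<in> coeffs_rel R"
  using partial_isoD(1)[OF R] by (auto simp: coeffs_rel_def)

lemma coeffs_rel_const: "(x, y) \<in> R \<Longrightarrow> ([:x:], [:y:]) \<in> coeffs_rel R"
  using coeffs_rel_monom[of x y 0] by (simp add: monom_0)

lemma coeffs_rel_0_iff: "(P, P') \<in> coeffs_rel R \<Longrightarrow> P = 0 \<longleftrightarrow> P' = 0"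
  using partial_isoD(7)[OF R] by (auto simp: coeffs_rel_def poly_eq_iff)

lemma coeffs_rel_degree:
  assumes "(P, P') \<in> coeffs_rel R" shows "degree P = degree P'"
proof -
  have "coeff P i = 0 \<longleftrightarrow> coeff P' i = 0" for i
    using partial_isoD(7)[OF R] assms by (simp add: coeffs_rel_def)
  then show ?thesis by (simp add: degree_def)
qed

text \<open>Long division is carried out on both sides in parallel: each step uses only field
  operations on coefficients, which the isomorphism respects.\<close>

lemma coeffs_rel_division:
  assumes p: "(p, p') \<in> coeffs_rel R" "p \<noteq> 0" and P: "(P, P') \<in> coeffs_rel R"
  shows "\<exists>Q Q' S S'. (Q, Q') \<in> coeffs_rel R \<and> (S, S') \<in> coeffs_rel R \<and>
    P = Q * p + S \<and> P' = Q' * p' + S' \<and> (S = 0 \<or> degree S < degree p)"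
  using P
\<comment> \<open>The measure distinguishes the zero polynomial from nonzero constants, both of
  degree 0.\<close>
proof (induction "if P = 0 then 0 else Suc (degree P)" arbitrary: P P' rule: less_induct)
  case less
  show ?case
  proof (cases "P = 0 \<or> degree P < degree p")
    case True
    then show ?thesis
      using less.prems coeffs_rel_const[OF partial_isoD(1)[OF R]]
      by (intro exI[of _ 0] exI[of _ P] exI[of _ P']) auto
  next
    case False
    then have P0: "P \<noteq> 0" "degree p \<le> degree P" by auto
    let ?k = "degree P - degree p"
    let ?c = "lead_coeff P * inverse (lead_coeff p)"
    let ?c' = "lead_coeff P' * inverse (lead_coeff p')"
    have c: "(?c, ?c') \<in> R"
      using coeffs_relD[OF less.prems, of "degree P"] coeffs_relD[OF p(1), of "degree p"]
        partial_isoD(4,6)[OF R] coeffs_rel_degree[OF p(1)] coeffs_rel_degree[OF less.prems] by simp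
    define T where "T = P - monom ?c ?k * p"
    define T' where "T' = P' - monom ?c' ?k * p'"
    have T: "(T, T') \<in> coeffs_rel R"
      unfolding T_def T'_def
      by (intro coeffs_rel_diff coeffs_rel_mult coeffs_rel_monom c p less.prems)
    have "T = 0 \<or> degree T < degree P"
    proof (cases "degree P = 0")
      case True
      then have "degree p = 0" using P0 by simp
      with True obtain a b where "P = [:a:]" "p = [:b:]" by (auto elim!: degree_eq_zeroE)
      then show ?thesis using p by (simp add: T_def monom_0)
    next
      case False
      have "degree T \<le> degree P"
        unfolding T_def using P0
        by (intro degree_diff_le order.trans[OF degree_mult_le])
          (auto intro!: order.trans[OF add_mono[OF degree_monom_le order.refl]])
      moreover have "coeff T (degree P) = 0"
      proof -
        have "coeff (monom ?c ?k * p) (?k + degree p) = ?c * coeff p (degree p)"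
          by (simp only: coeff_monom_mult) simp
        then show ?thesis using p P0 by (simp add: T_def)
      qed
      ultimately show ?thesis
        using False by (metis eq_zero_or_degree_less)
    qed
    then have "(if T = 0 then 0 else Suc (degree T)) < (if P = 0 then 0 else Suc (degree P))"
      using P0 by auto
    from less.hyps[OF this T] obtain Q Q' S S' where
      QS: "(Q, Q') \<in> coeffs_rel R" "(S, S') \<in> coeffs_rel R" "T = Q * p + S" "T' = Q' * p' + S'"
        "S = 0 \<or> degree S < degree p"
      by blast
    have "P = (Q + monom ?c ?k) * p + S" "P' = (Q' + monom ?c' ?k) * p' + S'"
      using QS(3,4) unfolding T_def T'_def by (simp_all add: algebra_simps)
    then show ?thesis
      using QS coeffs_rel_add[OF QS(1) coeffs_rel_monom[OF c]] by blast
  qed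
qed

lemma coeffs_rel_lift:
  assumes "\<forall>i. coeff P i \<in> Domain R"
  shows "\<exists>P'. (P, P') \<in> coeffs_rel R"
proof
  let ?f = "\<lambda>x. SOME y. (x, y) \<in> R"
  have f: "x \<in> Domain R \<Longrightarrow> (x, ?f x) \<in> R" for x
    by (metis Domain.cases someI)
  \<comment> \<open>The chosen images must send 0 to 0 for \<open>map_poly\<close> to act
    coefficient by coefficient.\<close>
  have "?f 0 = 0"
    using f[of 0] partial_isoD(1,7)[OF R] by blast
  then show "(P, map_poly ?f P) \<in> coeffs_rel R"
    using f assms by (simp add: coeffs_rel_def coeff_map_poly)
qed

end

text \<open>The extension of the isomorphism to the field generated by \<open>x\<close>, with
  \<open>x\<close> sent to \<open>y\<close>, as pairs of rational expressions. Only the first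
  denominator is required to be nonzero; in the uses below the second follows because corresponding
  polynomials vanish together at \<open>x\<close> and \<open>y\<close>.\<close>

definition adjoin :: "(complex \<times> complex) set \<Rightarrow> complex \<Rightarrow> complex \<Rightarrow> (complex \<times> complex) set" where
  "adjoin R x y = {(poly P x / poly Q x, poly P' y / poly Q' y) | P P' Q Q'.
     (P, P') \<in> coeffs_rel R \<and> (Q, Q') \<in> coeffs_rel R \<and> poly Q x \<noteq> 0}"

lemma adjoinI:
  "(P, P') \<in> coeffs_rel R \<Longrightarrow> (Q, Q') \<in> coeffs_rel R \<Longrightarrow> poly Q x \<noteq> 0 \<Longrightarrow>
   (poly P x / poly Q x, poly P' y / poly Q' y) \<in> adjoin R x y"
  unfolding adjoin_def by blast

text \<open>The hypothesis \<open>H\<close> says that \<open>x\<close> and \<open>y\<close> satisfy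
  the same algebraic relations over the two fields, which is what well-definedness and injectivity
  of the extension require.\<close>

lemma
  assumes R: "partial_iso R"
    and H: "\<And>P P'. (P, P') \<in> coeffs_rel R \<Longrightarrow> poly P x = 0 \<longleftrightarrow> poly P' y = 0"
  shows partial_iso_adjoin: "partial_iso (adjoin R x y)"
    and adjoin_superset: "R \<subseteq> adjoin R x y"
    and adjoin_new: "(x, y) \<in> adjoin R x y"
proof -
  have one: "(1, 1) \<in> coeffs_rel R" and zero: "(0, 0) \<in> coeffs_rel R"
    using coeffs_rel_const[OF R] partial_isoD(1,2)[OF R] by (fastforce simp: one_pCons)+
  show sup: "R \<subseteq> adjoin R x y"
  proof
    fix p assume "p \<in> R"
    then obtain a b where "p = (a, b)" "(a, b) \<in> R" by (cases p) auto
    then show "p \<in> adjoin R x y"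
      using adjoinI[OF coeffs_rel_const[OF R, of a b] one, of x y] by simp
  qed
  have "([:0, 1:], [:0, 1:]) \<in> coeffs_rel R"
    using coeffs_rel_monom[OF R partial_isoD(2)[OF R], of 1] by (simp add: monom_altdef)
  then show "(x, y) \<in> adjoin R x y"
    using adjoinI[OF _ one, of "[:0, 1:]" "[:0, 1:]" x y] by simp
  show "partial_iso (adjoin R x y)"
    unfolding partial_iso_def
  proof (intro conjI allI impI)
    show "(0, 0) \<in> adjoin R x y" "(1, 1) \<in> adjoin R x y"
      using sup partial_isoD(1,2)[OF R] by auto
  next
    fix a b c d assume "(a, b) \<in> adjoin R x y" "(c, d) \<in> adjoin R x y"
    then obtain P P' Q Q' S S' T T' where *:
        "(P, P') \<in> coeffs_rel R" "(Q, Q') \<in> coeffs_rel R" "poly Q x \<noteq> 0"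
        "(S, S') \<in> coeffs_rel R" "(T, T') \<in> coeffs_rel R" "poly T x \<noteq> 0"
        and abcd: "a = poly P x / poly Q x" "b = poly P' y / poly Q' y"
        "c = poly S x / poly T x" "d = poly S' y / poly T' y"
      unfolding adjoin_def by blast
    have nz: "poly Q' y \<noteq> 0" "poly T' y \<noteq> 0" using * H by blast+
    have QT: "(Q * T, Q' * T') \<in> coeffs_rel R" "poly (Q * T) x \<noteq> 0"
      using * by (auto intro: coeffs_rel_mult[OF R])
    have "(P * T + S * Q, P' * T' + S' * Q') \<in> coeffs_rel R"
      using * by (intro coeffs_rel_add[OF R] coeffs_rel_mult[OF R])
    from adjoinI[OF this QT, of y] show "(a + c, b + d) \<in> adjoin R x y"
      using nz * by (simp add: abcd add_frac_eq)
    have "(P * S, P' * S') \<in> coeffs_rel R"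
      using * by (intro coeffs_rel_mult[OF R])
    from adjoinI[OF this QT, of y] show "(a * c, b * d) \<in> adjoin R x y"
      by (simp add: abcd)
  next
    fix a b assume "(a, b) \<in> adjoin R x y"
    then obtain P P' Q Q' where *:
        "(P, P') \<in> coeffs_rel R" "(Q, Q') \<in> coeffs_rel R" "poly Q x \<noteq> 0"
        and ab: "a = poly P x / poly Q x" "b = poly P' y / poly Q' y"
      unfolding adjoin_def by blast
    have nz: "poly Q' y \<noteq> 0" using * H by blast
    show "a = 0 \<longleftrightarrow> b = 0" using * nz H by (simp add: ab)
    show "(- a, - b) \<in> adjoin R x y"
      using adjoinI[OF coeffs_rel_uminus[OF R *(1)] *(2,3), of y] by (simp add: ab)
    show "(inverse a, inverse b) \<in> adjoin R x y"
    proof (cases "poly P x = 0")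
      case True
      then show ?thesis using H[OF *(1)] sup partial_isoD(1)[OF R] by (auto simp: ab)
    next
      case False
      then show ?thesis using adjoinI[OF *(2,1), of x y] by (simp add: ab)
    qed
  qed
qed

text \<open>Any root \<open>y\<close> of the image \<open>p'\<close> of a minimal polynomial
  \<open>p\<close> of \<open>x\<close> will do. Division by \<open>p\<close> shows that relations of
  \<open>x\<close> hold for \<open>y\<close>; for the converse, a polynomial \<open>r\<close> whose
  image is minimal for \<open>y\<close> is shown to vanish at \<open>x\<close>.\<close>

lemma partial_iso_extend_algebraic:
  assumes R: "partial_iso R" and P: "P \<noteq> 0" "\<forall>i. coeff P i \<in> Domain R" "poly P x = 0"
  obtains y where "partial_iso (adjoin R x y)" "R \<subseteq> adjoin R x y" "(x, y) \<in> adjoin R x y"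
proof -
  let ?S = "\<lambda>(p, p'). (p, p') \<in> coeffs_rel R \<and> p \<noteq> 0 \<and> poly p x = 0"
  obtain P' where "(P, P') \<in> coeffs_rel R" using coeffs_rel_lift[OF R P(2)] by blast
  then have "?S (P, P')" using P by simp
  from ex_has_least_nat[of ?S, OF this, of "degree \<circ> fst"] obtain p p' where p: "(p, p') \<in> coeffs_rel R" "p \<noteq> 0" "poly p x = 0"
    and min: "\<And>q q'. (q, q') \<in> coeffs_rel R \<Longrightarrow> q \<noteq> 0 \<Longrightarrow> poly q x = 0 \<Longrightarrow> degree p \<le> degree q"
    by (auto simp: split_beta)
  have "degree p \<noteq> 0"
  proof
    assume "degree p = 0"
    then obtain c where "p = [:c:]" by (rule degree_eq_zeroE)
    then show False using p by simp
  qed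
  then have "degree p' \<noteq> 0" using coeffs_rel_degree[OF R p(1)] by simp
  then obtain y where y: "poly p' y = 0"
    using fundamental_theorem_of_algebra[of p'] constant_degree[of p'] by metis
  have fwd: "poly q' y = 0" if q: "(q, q') \<in> coeffs_rel R" "poly q x = 0" for q q'
  proof -
    obtain Q Q' S S' where QS: "(S, S') \<in> coeffs_rel R" "q = Q * p + S" "q' = Q' * p' + S'"
        "S = 0 \<or> degree S < degree p"
      using coeffs_rel_division[OF R p(1,2) q(1)] by blast
    have "poly S x = 0" using q(2) p(3) by (simp add: QS(2))
    then have "S = 0" using min[OF QS(1)] QS(4) by force
    then have "S' = 0" using coeffs_rel_0_iff[OF R QS(1)] by simp
    then show ?thesis using y by (simp add: QS(3))
  qed
  let ?S' = "\<lambda>(p, p'). (p, p') \<in> coeffs_rel R \<and> p \<noteq> 0 \<and> poly p' y = 0"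
  have "?S' (p, p')" using p y by simp
  from ex_has_least_nat[of ?S', OF this, of "degree \<circ> fst"] obtain r r' where r: "(r, r') \<in> coeffs_rel R" "r \<noteq> 0" "poly r' y = 0"
    and min': "\<And>q q'. (q, q') \<in> coeffs_rel R \<Longrightarrow> q \<noteq> 0 \<Longrightarrow> poly q' y = 0 \<Longrightarrow> degree r \<le> degree q"
    by (auto simp: split_beta)
  have r'0: "r' \<noteq> 0" using r coeffs_rel_0_iff[OF R r(1)] by simp
  have dvd: "\<exists>Q Q'. (Q, Q') \<in> coeffs_rel R \<and> q = Q * r \<and> q' = Q' * r'"
    if q: "(q, q') \<in> coeffs_rel R" "poly q' y = 0" for q q'
  proof -
    obtain Q Q' S S' where QS: "(Q, Q') \<in> coeffs_rel R" "(S, S') \<in> coeffs_rel R" "q = Q * r + S" "q' = Q' * r' + S'"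
        "S = 0 \<or> degree S < degree r"
      using coeffs_rel_division[OF R r(1,2) q(1)] by blast
    have "poly S' y = 0" using q(2) r(3) by (simp add: QS(4))
    then have "S = 0" using min'[OF QS(2)] QS(5) by force
    then have "S' = 0" using coeffs_rel_0_iff[OF R QS(2)] by simp
    then show ?thesis using QS \<open>S = 0\<close> by auto
  qed
  \<comment> \<open>Otherwise the cofactor of \<open>r\<close> in \<open>p\<close> vanishes at
    \<open>x\<close>, so by minimality it has the degree of \<open>p\<close>; then \<open>r\<close>
    is constant, and so is \<open>r'\<close>, which has the root \<open>y\<close>.\<close>
  have rx: "poly r x = 0"
  proof (rule ccontr)
    assume rx: "poly r x \<noteq> 0"
    obtain Q Q' where Q: "(Q, Q') \<in> coeffs_rel R" "p = Q * r" "p' = Q' * r'"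
      using dvd[OF p(1) y] by blast
    then have "poly Q x = 0" "Q \<noteq> 0" using p rx by auto
    then have "degree p \<le> degree Q" using min[OF Q(1)] by blast
    then have "degree r = 0"
      using Q(2) \<open>Q \<noteq> 0\<close> r(2) by (simp add: degree_mult_eq)
    then have "degree r' = 0" using coeffs_rel_degree[OF R r(1)] by simp
    then obtain c where "r' = [:c:]" by (rule degree_eq_zeroE)
    then show False using r(3) r'0 by simp
  qed
  have "poly q x = 0 \<longleftrightarrow> poly q' y = 0" if "(q, q') \<in> coeffs_rel R" for q q'
    using fwd[OF that] dvd[OF that] rx by auto
  then show ?thesis
    using that partial_iso_adjoin[OF R] adjoin_superset[OF R] adjoin_new[OF R] by blast
qed

lemma partial_iso_Union_chain:
  assumes "C \<noteq> {}" and chain: "\<And>X Y. X \<in> C \<Longrightarrow> Y \<in> C \<Longrightarrow> X \<subseteq> Y \<or> Y \<subseteq> X"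
    and iso: "\<And>X. X \<in> C \<Longrightarrow> partial_iso X"
  shows "partial_iso (\<Union>C)"
proof -
  obtain X0 where X0: "X0 \<in> C" using assms(1) by blast
  have two: "\<exists>X\<in>C. p \<in> X \<and> q \<in> X" if pq: "p \<in> \<Union>C" "q \<in> \<Union>C" for p q
  proof -
    obtain X Y where "X \<in> C" "p \<in> X" "Y \<in> C" "q \<in> Y" using pq by blast
    then show ?thesis using chain[of X Y] by blast
  qed
  show ?thesis
    unfolding partial_iso_def
  proof (intro conjI allI impI)
    show "(0, 0) \<in> \<Union>C" "(1, 1) \<in> \<Union>C"
      using X0 partial_isoD(1,2)[OF iso[OF X0]] by blast+
  next
    fix x y u v assume "(x, y) \<in> \<Union>C" "(u, v) \<in> \<Union>C"
    then obtain X where X: "X \<in> C" "(x, y) \<in> X" "(u, v) \<in> X"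
      using two[of "(x, y)" "(u, v)"] by blast
    show "(x + u, y + v) \<in> \<Union>C" "(x * u, y * v) \<in> \<Union>C"
      using partial_isoD(3,4)[OF iso[OF X(1)] X(2,3)] X(1) by blast+
  next
    fix x y assume "(x, y) \<in> \<Union>C"
    then obtain X where X: "X \<in> C" "(x, y) \<in> X" by blast
    show "(- x, - y) \<in> \<Union>C" "(inverse x, inverse y) \<in> \<Union>C" "x = 0 \<longleftrightarrow> y = 0"
      using partial_isoD(5,6,7)[OF iso[OF X(1)] X(2)] X(1) by blast+
  qed
qed

text \<open>A rational expression in the fixed element \<open>x\<close> with coefficients in the
  domain also has its coefficients in the range, and lifting them through the inverse isomorphism
  gives a preimage.\<close>

lemma Domain_adjoin_subset_Range:
  assumes R: "partial_iso R" and sub: "Domain R \<subseteq> Range R"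
    and H: "\<And>P P'. (P, P') \<in> coeffs_rel R \<Longrightarrow> poly P x = 0 \<longleftrightarrow> poly P' x = 0"
  shows "Domain (adjoin R x x) \<subseteq> Range (adjoin R x x)"
proof
  fix z assume "z \<in> Domain (adjoin R x x)"
  then obtain P P' Q Q' where *: "(P, P') \<in> coeffs_rel R" "(Q, Q') \<in> coeffs_rel R" "poly Q x \<noteq> 0"
      "z = poly P x / poly Q x"
    unfolding adjoin_def by blast
  have lift: "\<exists>A. (A, B) \<in> coeffs_rel R" if "(B, B') \<in> coeffs_rel R" for B B'
  proof -
    have "\<forall>i. coeff B i \<in> Domain (R\<inverse>)"
      using that sub by (auto simp: coeffs_rel_def)
    from coeffs_rel_lift[OF partial_iso_converse[OF R] this] show ?thesis
      by (auto simp: coeffs_rel_def)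
  qed
  obtain A B where "(A, P) \<in> coeffs_rel R" "(B, Q) \<in> coeffs_rel R"
    using lift * by blast
  then show "z \<in> Range (adjoin R x x)"
    using adjoinI[of A P R B Q x x] H[of B Q] * by (metis Range.intros)
qed

lemma adjoin_converse_subset:
  assumes "\<And>P P'. (P, P') \<in> coeffs_rel R \<Longrightarrow> poly P x = 0 \<longleftrightarrow> poly P' y = 0"
  shows "(adjoin R x y)\<inverse> \<subseteq> adjoin (R\<inverse>) y x"
proof (rule subrelI)
  fix a b assume "(a, b) \<in> (adjoin R x y)\<inverse>"
  then have "(b, a) \<in> adjoin R x y" by simp
  then obtain P P' Q Q' where *: "(P, P') \<in> coeffs_rel R" "(Q, Q') \<in> coeffs_rel R" "poly Q x \<noteq> 0"
      "b = poly P x / poly Q x" "a = poly P' y / poly Q' y"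
    unfolding adjoin_def by blast
  have "(P', P) \<in> coeffs_rel (R\<inverse>)" "(Q', Q) \<in> coeffs_rel (R\<inverse>)" "poly Q' y \<noteq> 0"
    using * assms by (auto simp: coeffs_rel_def)
  then show "(a, b) \<in> adjoin (R\<inverse>) y x"
    unfolding *(4,5) by (rule adjoinI)
qed

lemma adjoin_converse:
  assumes "\<And>P P'. (P, P') \<in> coeffs_rel R \<Longrightarrow> poly P x = 0 \<longleftrightarrow> poly P' y = 0"
  shows "(adjoin R x y)\<inverse> = adjoin (R\<inverse>) y x"
proof
  show "(adjoin R x y)\<inverse> \<subseteq> adjoin (R\<inverse>) y x"
    by (rule adjoin_converse_subset) (rule assms)
  have "(adjoin (R\<inverse>) y x)\<inverse> \<subseteq> adjoin ((R\<inverse>)\<inverse>) x y"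
    by (rule adjoin_converse_subset) (use assms in \<open>auto simp: coeffs_rel_def\<close>)
  then show "adjoin (R\<inverse>) y x \<subseteq> (adjoin R x y)\<inverse>"
    by auto
qed

text \<open>Adjoining transcendental elements as fixed points keeps the domain equal to the range; a maximal
  such extension has all of the complex numbers algebraic over both sides.\<close>

lemma partial_iso_extend_Aut_C:
  assumes R0: "partial_iso R0" "Domain R0 = Range R0"
  obtains \<sigma> where "\<sigma> \<in> Aut_C" "\<forall>x y. (x, y) \<in> R0 \<longrightarrow> \<sigma> x = y"
proof -
  define A1 where "A1 = {R. partial_iso R \<and> R0 \<subseteq> R \<and> Domain R = Range R}"
  have "\<exists>M\<in>A1. \<forall>X\<in>A1. M \<subseteq> X \<longrightarrow> X = M"
  proof (rule subset_Zorn_nonempty)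
    show "A1 \<noteq> {}" using R0 unfolding A1_def by blast
    fix C assume C: "C \<noteq> {}" "subset.chain A1 C"
    then have "X \<in> A1" if "X \<in> C" for X using that by (auto simp: subset_chain_def)
    moreover have "partial_iso (\<Union>C)"
      by (rule partial_iso_Union_chain[OF C(1)])
        (use C(2) in \<open>auto simp: subset_chain_def A1_def\<close>)
    ultimately show "\<Union>C \<in> A1"
      using C(1) unfolding A1_def by (auto simp: Domain_Union Range_Union)
  qed
  then obtain R1 where R1: "partial_iso R1" "R0 \<subseteq> R1" "Domain R1 = Range R1"
    and max1: "\<And>X. X \<in> A1 \<Longrightarrow> R1 \<subseteq> X \<Longrightarrow> X = R1"
    unfolding A1_def by auto
  have alg: "\<exists>P. P \<noteq> 0 \<and> (\<forall>i. coeff P i \<in> Domain R1) \<and> poly P x = 0" for x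
  proof (rule ccontr)
    assume no: "\<not> ?thesis"
    \<comment> \<open>As \<open>x\<close> is transcendental over the common field, either polynomial
      vanishes at \<open>x\<close> only if it is zero.\<close>
    have H: "poly P x = 0 \<longleftrightarrow> poly P' x = 0" if PP: "(P, P') \<in> coeffs_rel R1" for P P'
    proof -
      have "\<forall>i. coeff P i \<in> Domain R1" "\<forall>i. coeff P' i \<in> Domain R1"
        using PP R1(3) by (auto simp: coeffs_rel_def)
      then have "poly P x = 0 \<longleftrightarrow> P = 0" "poly P' x = 0 \<longleftrightarrow> P' = 0" using no by auto
      then show ?thesis using coeffs_rel_0_iff[OF R1(1) PP] by simp
    qed
    have "Domain (adjoin R1 x x) \<subseteq> Range (adjoin R1 x x)"
      using Domain_adjoin_subset_Range[OF R1(1) _ H] R1(3) by simp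
    moreover have "Domain (adjoin (R1\<inverse>) x x) \<subseteq> Range (adjoin (R1\<inverse>) x x)"
    proof (rule Domain_adjoin_subset_Range[OF partial_iso_converse[OF R1(1)]])
      show "Domain (R1\<inverse>) \<subseteq> Range (R1\<inverse>)" using R1(3) by simp
      show "(P, P') \<in> coeffs_rel (R1\<inverse>) \<Longrightarrow> poly P x = 0 \<longleftrightarrow> poly P' x = 0" for P P'
        using H[of P' P] by (auto simp: coeffs_rel_def)
    qed
    then have "Range (adjoin R1 x x) \<subseteq> Domain (adjoin R1 x x)"
      using adjoin_converse[of R1 x x] H by (metis Domain_converse Range_converse)
    ultimately have "adjoin R1 x x \<in> A1"
      unfolding A1_def using partial_iso_adjoin[OF R1(1) H] adjoin_superset[OF R1(1) H] R1(2) by blast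
    then have "adjoin R1 x x = R1"
      using max1 adjoin_superset[OF R1(1) H] by blast
    then have xx: "(x, x) \<in> R1"
      using adjoin_new[OF R1(1) H] by blast
    have "(- x, - x) \<in> R1" using partial_isoD(5)[OF R1(1) xx] .
    then have "\<forall>i. coeff [:- x, 1:] i \<in> Domain R1"
      using partial_isoD(1,2)[OF R1(1)] by (auto simp: coeff_pCons split: nat.splits)
    moreover have "[:- x, 1:] \<noteq> 0" "poly [:- x, 1:] x = 0" by simp_all
    ultimately show False using no by blast
  qed
  \<comment> \<open>The second maximality argument drops the equality of domain and range: the root
    chosen as image of an algebraic element need not lie in the domain reached so far.\<close>
  define A2 where "A2 = {R. partial_iso R \<and> R1 \<subseteq> R}"
  have "\<exists>M\<in>A2. \<forall>X\<in>A2. M \<subseteq> X \<longrightarrow> X = M"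
  proof (rule subset_Zorn_nonempty)
    show "A2 \<noteq> {}" using R1 unfolding A2_def by blast
    fix C assume C: "C \<noteq> {}" "subset.chain A2 C"
    then have "X \<in> A2" if "X \<in> C" for X using that by (auto simp: subset_chain_def)
    moreover have "partial_iso (\<Union>C)"
      by (rule partial_iso_Union_chain[OF C(1)])
        (use C(2) in \<open>auto simp: subset_chain_def A2_def\<close>)
    ultimately show "\<Union>C \<in> A2"
      using C(1) unfolding A2_def by auto
  qed
  then obtain R2 where R2: "partial_iso R2" "R1 \<subseteq> R2"
    and max2: "\<And>X. partial_iso X \<Longrightarrow> R2 \<subseteq> X \<Longrightarrow> X = R2"
    unfolding A2_def by auto
  have dom: "x \<in> Domain R2" for x
  proof -
    obtain P where P: "P \<noteq> 0" "\<forall>i. coeff P i \<in> Domain R1" "poly P x = 0" using alg by blast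
    then have "\<forall>i. coeff P i \<in> Domain R2" using R2(2) by blast
    from partial_iso_extend_algebraic[OF R2(1) P(1) this P(3)] obtain y where
      "partial_iso (adjoin R2 x y)" "R2 \<subseteq> adjoin R2 x y" "(x, y) \<in> adjoin R2 x y" .
    then show ?thesis using max2 by blast
  qed
  \<comment> \<open>Since the domain of \<open>R1\<close> is also its range, every complex number is
    algebraic over the range too, and the inverse isomorphism can be extended in the same way. This
    yields surjectivity.\<close>
  have ran: "x \<in> Range R2" for x
  proof -
    obtain P where P: "P \<noteq> 0" "\<forall>i. coeff P i \<in> Domain R1" "poly P x = 0" using alg by blast
    then have "\<forall>i. coeff P i \<in> Domain (R2\<inverse>)" using R2(2) R1(3) by blast
    from partial_iso_extend_algebraic[OF partial_iso_converse[OF R2(1)] P(1) this P(3)] obtain y where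
      y: "partial_iso (adjoin (R2\<inverse>) x y)" "R2\<inverse> \<subseteq> adjoin (R2\<inverse>) x y" "(x, y) \<in> adjoin (R2\<inverse>) x y" .
    have "R2 \<subseteq> (adjoin (R2\<inverse>) x y)\<inverse>" using y(2) by auto
    with partial_iso_converse[OF y(1)] have "(adjoin (R2\<inverse>) x y)\<inverse> = R2" by (rule max2)
    then have "(y, x) \<in> R2" using y(3) by (metis converse_iff)
    then show ?thesis by (rule RangeI)
  qed
  define \<sigma> where "\<sigma> x = (THE y. (x, y) \<in> R2)" for x
  have sig: "(x, y) \<in> R2 \<Longrightarrow> \<sigma> x = y" for x y
    unfolding \<sigma>_def using partial_iso_single_valued[OF R2(1)] by blast
  have sig': "(x, \<sigma> x) \<in> R2" for x
    using dom[of x] sig by blast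
  have "\<sigma> \<in> Aut_C"
    unfolding Aut_C_def
  proof (intro CollectI conjI allI)
    show "\<sigma> (x + y) = \<sigma> x + \<sigma> y" "\<sigma> (x * y) = \<sigma> x * \<sigma> y" for x y
      using sig partial_isoD(3,4)[OF R2(1) sig' sig'] by blast+
    show "bij \<sigma>"
    proof (rule bijI)
      show "inj \<sigma>"
      proof (rule injI)
        fix x y assume "\<sigma> x = \<sigma> y"
        then show "x = y"
          using partial_iso_single_valued[OF partial_iso_converse[OF R2(1)]] sig'
          by (metis converse_iff)
      qed
      show "surj \<sigma>" unfolding surj_def using ran sig by (metis Range_iff)
    qed
  qed
  moreover have "\<forall>x y. (x, y) \<in> R0 \<longrightarrow> \<sigma> x = y"
  proof (intro allI impI)
    fix x y assume "(x, y) \<in> R0"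
    then have "(x, y) \<in> R2" using R1(2) R2(2) by (meson subsetD)
    then show "\<sigma> x = y" by (rule sig)
  qed
  ultimately show ?thesis by (rule that)
qed

section \<open>Algebraic numbers\<close>

interpretation rat_vs: vector_space "\<lambda>r x. of_rat r * (x :: complex)"
  by unfold_locales (simp_all add: algebra_simps of_rat_add of_rat_mult)

lemma rat_span_mult:
  assumes "\<And>b. b \<in> B \<Longrightarrow> x * b \<in> rat_vs.span B" and "v \<in> rat_vs.span B"
  shows "x * v \<in> rat_vs.span B"
  using assms(2)
proof (induction v rule: rat_vs.span_induct_alt)
  case base
  then show ?case by (simp add: rat_vs.span_zero)
next
  case (step c b v)
  have "x * (of_rat c * b + v) = of_rat c * (x * b) + x * v"
    by (simp add: algebra_simps)
  then show ?case
    using rat_vs.span_add[OF rat_vs.span_scale[OF assms(1)[OF step(1)]] step(2)] by simp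
qed

text \<open>The powers of \<open>x\<close> all lie in a space of finite dimension over the
  rationals, so they are linearly dependent.\<close>

lemma algebraic_of_rat_span:
  assumes B: "finite B" "1 \<in> rat_vs.span B" and x: "\<And>v. v \<in> rat_vs.span B \<Longrightarrow> x * v \<in> rat_vs.span B"
  shows "algebraic x"
proof -
  have pow: "x ^ k \<in> rat_vs.span B" for k
    by (induction k) (use B x in auto)
  have "\<exists>P :: complex poly. (\<forall>i. coeff P i \<in> \<rat>) \<and> P \<noteq> 0 \<and> poly P x = 0"
  \<comment> \<open>Linear dependence is stated for sets, so coinciding powers are treated
    separately; they give a relation at once.\<close>
  proof (cases "inj_on ((^) x) {..card B}")
    case False
    then obtain i j where ij: "i \<noteq> j" "x ^ i = x ^ j"
      unfolding inj_on_def by blast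
    define P where "P = monom 1 i - (monom 1 j :: complex poly)"
    have "coeff P i = 1" using ij(1) by (simp add: P_def)
    then have "P \<noteq> 0" by auto
    moreover have "coeff P k \<in> \<rat>" for k by (simp add: P_def)
    moreover have "poly P x = 0" using ij(2) by (simp add: P_def poly_monom)
    ultimately show ?thesis by blast
  next
    case inj: True
    define A where "A = (^) x ` {..card B}"
    have cardA: "card A = Suc (card B)" unfolding A_def using inj by (simp add: card_image)
    have "A \<subseteq> rat_vs.span B" unfolding A_def using pow by blast
    then have "rat_vs.dependent A"
      using rat_vs.independent_span_bound[OF B(1), of A] cardA by auto
    moreover have "finite A" unfolding A_def by simp
    ultimately obtain u v where u: "v \<in> A" "u v \<noteq> 0" "(\<Sum>v\<in>A. of_rat (u v) * v) = 0"
      using rat_vs.dependent_finite by blast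
    define P where "P = (\<Sum>k\<le>card B. monom (of_rat (u (x ^ k)) :: complex) k)"
    have cP: "coeff P i = (if i \<le> card B then of_rat (u (x ^ i)) else 0)" for i
      unfolding P_def by (simp add: coeff_sum)
    have "poly P x = (\<Sum>k\<le>card B. of_rat (u (x ^ k)) * x ^ k)"
      unfolding P_def by (simp add: poly_sum poly_monom)
    also have "\<dots> = (\<Sum>v\<in>A. of_rat (u v) * v)"
      unfolding A_def using inj by (simp add: sum.reindex)
    finally have "poly P x = 0" using u(3) by simp
    moreover obtain i where "i \<le> card B" "v = x ^ i" using u(1) unfolding A_def by auto
    then have "coeff P i \<noteq> 0" using u(2) cP by simp
    then have "P \<noteq> 0" by auto
    moreover have "coeff P i \<in> \<rat>" for i by (simp add: cP)
    ultimately show ?thesis by blast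
  qed
  then show ?thesis by (simp add: algebraic_altdef)
qed

lemma algebraic_power_relation:
  fixes x :: complex
  assumes "algebraic x"
  obtains d c where "0 < d" "x ^ d = (\<Sum>i<d. of_rat (c i) * x ^ i)"
proof -
  obtain P where P: "\<forall>i. coeff P i \<in> \<rat>" "P \<noteq> 0" "poly P x = 0"
    using assms by (auto simp: algebraic_altdef)
  let ?d = "degree P"
  have "\<exists>r. coeff P i = of_rat r" for i using P(1) by (auto elim: Rats_cases)
  then obtain r where r: "\<And>i. coeff P i = of_rat (r i)" by metis
  have "r ?d \<noteq> 0" using P(2) r[of ?d] by auto
  have "0 = (\<Sum>i\<le>?d. of_rat (r i) * x ^ i)" using P(3) by (simp add: poly_altdef r)
  also have "\<dots> = (\<Sum>i<?d. of_rat (r i) * x ^ i) + of_rat (r ?d) * x ^ ?d"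
    by (simp add: lessThan_Suc_atMost[symmetric])
  finally have "of_rat (r ?d) * x ^ ?d = - (\<Sum>i<?d. of_rat (r i) * x ^ i)"
    by (simp add: eq_neg_iff_add_eq_0 add.commute)
  then have "x ^ ?d = (\<Sum>i<?d. of_rat (- r i / r ?d) * x ^ i)"
    using \<open>r ?d \<noteq> 0\<close> by (simp add: of_rat_divide of_rat_minus sum_divide_distrib[symmetric] sum_negf field_simps)
  moreover have "0 < ?d"
  proof (rule ccontr)
    assume "\<not> 0 < ?d"
    then obtain c where "P = [:c:]" using degree_eq_zeroE[of P] by blast
    then show False using P(2,3) by simp
  qed
  ultimately show ?thesis by (rule that[rotated])
qed

text \<open>The products \<open>x ^ i * y ^ j\<close> below the two degrees span a space that is
  stable under multiplication by \<open>x\<close> and by \<open>y\<close>, hence under their sum and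
  product.\<close>

lemma
  fixes x y :: complex
  assumes "algebraic x" "algebraic y"
  shows algebraic_add_complex: "algebraic (x + y)"
    and algebraic_mult_complex: "algebraic (x * y)"
proof -
  obtain d c where d: "0 < d" "x ^ d = (\<Sum>i<d. of_rat (c i) * x ^ i)"
    by (rule algebraic_power_relation[OF assms(1)])
  obtain e f where e: "0 < e" "y ^ e = (\<Sum>i<e. of_rat (f i) * y ^ i)"
    by (rule algebraic_power_relation[OF assms(2)])
  define B where "B = (\<lambda>(i, j). x ^ i * y ^ j) ` ({..<d} \<times> {..<e})"
  have B: "x ^ i * y ^ j \<in> rat_vs.span B" if "i < d" "j < e" for i j
    using that by (intro rat_vs.span_base) (auto simp: B_def)
  have x: "x * v \<in> rat_vs.span B" if v: "v \<in> rat_vs.span B" for v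
  proof (rule rat_span_mult[OF _ v])
    fix b assume "b \<in> B"
    then obtain i j where b: "b = x ^ i * y ^ j" "i < d" "j < e" by (auto simp: B_def)
    show "x * b \<in> rat_vs.span B"
    proof (cases "Suc i < d")
      case True
      then show ?thesis using B[of "Suc i" j] b by (simp add: mult.assoc)
    next
      case False
      then have "Suc i = d" using b by simp
      then have "x * b = (\<Sum>i<d. of_rat (c i) * x ^ i) * y ^ j"
        using b d(2) by (metis mult.assoc power_Suc)
      also have "\<dots> = (\<Sum>i<d. of_rat (c i) * (x ^ i * y ^ j))"
        by (simp add: sum_distrib_right mult.assoc)
      also have "\<dots> \<in> rat_vs.span B"
        using B b by (intro rat_vs.span_sum rat_vs.span_scale) auto
      finally show ?thesis .
    qed
  qed
  have y: "y * v \<in> rat_vs.span B" if v: "v \<in> rat_vs.span B" for v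
  proof (rule rat_span_mult[OF _ v])
    fix b assume "b \<in> B"
    then obtain i j where b: "b = x ^ i * y ^ j" "i < d" "j < e" by (auto simp: B_def)
    show "y * b \<in> rat_vs.span B"
    proof (cases "Suc j < e")
      case True
      then show ?thesis using B[of i "Suc j"] b by (simp add: mult_ac)
    next
      case False
      then have "Suc j = e" using b by simp
      then have "y * b = x ^ i * (\<Sum>j<e. of_rat (f j) * y ^ j)"
        using b e(2) by (metis mult.left_commute power_Suc)
      also have "\<dots> = (\<Sum>j<e. of_rat (f j) * (x ^ i * y ^ j))"
        by (simp add: sum_distrib_left mult_ac)
      also have "\<dots> \<in> rat_vs.span B"
        using B b by (intro rat_vs.span_sum rat_vs.span_scale) auto
      finally show ?thesis .
    qed
  qed
  have fin: "finite B" "1 \<in> rat_vs.span B"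
    using B[of 0 0] d e by (auto simp: B_def)
  show "algebraic (x + y)"
    by (rule algebraic_of_rat_span[OF fin]) (use x y in \<open>simp add: distrib_right rat_vs.span_add\<close>)
  show "algebraic (x * y)"
    by (rule algebraic_of_rat_span[OF fin]) (use x y in \<open>simp add: mult.assoc\<close>)
qed

section \<open>The abelian closure of the rationals\<close>

text \<open>The generated field as an inductive set, so that facts about homomorphisms and
  algebraicity follow by rule induction. Closure under \<open>inverse\<close> includes 0, whose
  \<open>inverse\<close> is 0.\<close>

inductive_set field_closure :: "complex set \<Rightarrow> complex set" for S where
  base: "x \<in> S \<Longrightarrow> x \<in> field_closure S"
| zero: "0 \<in> field_closure S"
| one: "1 \<in> field_closure S"
| add: "x \<in> field_closure S \<Longrightarrow> y \<in> field_closure S \<Longrightarrow> x + y \<in> field_closure S"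
| mult: "x \<in> field_closure S \<Longrightarrow> y \<in> field_closure S \<Longrightarrow> x * y \<in> field_closure S"
| uminus: "x \<in> field_closure S \<Longrightarrow> - x \<in> field_closure S"
| inverse: "x \<in> field_closure S \<Longrightarrow> inverse x \<in> field_closure S"

lemma subfield_field_closure: "subfield_C (field_closure S)"
  unfolding subfield_C_def by (auto intro: field_closure.intros)

lemma field_closure_least:
  assumes "subfield_C F" "S \<subseteq> F"
  shows "field_closure S \<subseteq> F"
proof
  fix x assume "x \<in> field_closure S"
  then show "x \<in> F"
    by induction (use assms in \<open>auto simp: subfield_C_def\<close>)
qed

lemma embeddings_hom:
  assumes F: "subfield_C F" and f: "f \<in> embeddings F"
  shows "f 0 = 0" "f 1 = 1"
    and "x \<in> F \<Longrightarrow> y \<in> F \<Longrightarrow> f (x + y) = f x + f y"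
    and "x \<in> F \<Longrightarrow> y \<in> F \<Longrightarrow> f (x * y) = f x * f y"
    and "x \<in> F \<Longrightarrow> f (- x) = - f x"
    and "x \<in> F \<Longrightarrow> f (inverse x) = inverse (f x)"
    and "x \<in> F \<Longrightarrow> f (x ^ k) = f x ^ k"
    and "x \<in> F \<Longrightarrow> x ^ k \<in> F"
    and "inj_on f F"
proof -
  have one: "f 1 = 1" and add: "\<And>x y. x \<in> F \<Longrightarrow> y \<in> F \<Longrightarrow> f (x + y) = f x + f y"
    and mult: "\<And>x y. x \<in> F \<Longrightarrow> y \<in> F \<Longrightarrow> f (x * y) = f x * f y"
    using f by (auto simp: embeddings_def)
  have F': "0 \<in> F" "1 \<in> F" "\<And>x. x \<in> F \<Longrightarrow> - x \<in> F" "\<And>x. x \<in> F \<Longrightarrow> inverse x \<in> F"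
    "\<And>x y. x \<in> F \<Longrightarrow> y \<in> F \<Longrightarrow> x * y \<in> F" "\<And>x y. x \<in> F \<Longrightarrow> y \<in> F \<Longrightarrow> x + y \<in> F"
    using F by (auto simp: subfield_C_def)
  show "f 1 = 1" by (rule one)
  show "x \<in> F \<Longrightarrow> y \<in> F \<Longrightarrow> f (x + y) = f x + f y" "x \<in> F \<Longrightarrow> y \<in> F \<Longrightarrow> f (x * y) = f x * f y"
    by (fact add mult)+
  show zero: "f 0 = 0" using add[of 0 0] F' by simp
  show minus: "f (- x) = - f x" if "x \<in> F" for x
  proof -
    have "f x + f (- x) = f (x + - x)" using that F' by (intro add[symmetric])
    also have "\<dots> = 0" using zero by simp
    finally show ?thesis by (simp add: eq_neg_iff_add_eq_0 add.commute)
  qed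
  have inv: "f x * f (inverse x) = 1" if "x \<in> F" "x \<noteq> 0" for x
    using mult[of x "inverse x"] that F' one by simp
  show "f (inverse x) = inverse (f x)" if "x \<in> F" for x
    using inv[OF that] zero by (cases "x = 0") (auto simp: inverse_unique[symmetric])
  show pow: "x \<in> F \<Longrightarrow> x ^ k \<in> F" for x k by (induction k) (use F' in auto)
  show "x \<in> F \<Longrightarrow> f (x ^ k) = f x ^ k" for x
    by (induction k) (use F' one mult pow in auto)
  show "inj_on f F"
  proof (rule inj_onI)
    fix x y assume xy: "x \<in> F" "y \<in> F" "f x = f y"
    have d: "x + - y \<in> F" using F'(6)[OF xy(1) F'(3)[OF xy(2)]] .
    have "f (x + - y) = 0"
      using add[OF xy(1) F'(3)[OF xy(2)]] minus[OF xy(2)] xy(3) by simp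
    then have "x + - y = 0" using inv[OF d] by (cases "x + - y = 0") auto
    then show "x = y" by simp
  qed
qed

lemma embeddings_restrict:
  assumes "f \<in> embeddings K" "F \<subseteq> K" "subfield_C F"
  shows "restrict f F \<in> embeddings F"
  using assms unfolding embeddings_def subfield_C_def subset_eq by (auto simp: restrict_apply)

lemma subfield_image:
  assumes K: "subfield_C K" "f \<in> embeddings K" and G: "subfield_C G" "G \<subseteq> K"
  shows "subfield_C (f ` G)"
proof -
  note h = embeddings_hom[OF K]
  have "0 \<in> f ` G" "1 \<in> f ` G"
    using G(1) h(1,2) by (auto simp: subfield_C_def image_iff)
  moreover have "f x + f y \<in> f ` G" "f x * f y \<in> f ` G" "- f x \<in> f ` G" "inverse (f x) \<in> f ` G"
    if "x \<in> G" "y \<in> G" for x y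
  proof -
    have K': "x \<in> K" "y \<in> K" using that G by auto
    have "x + y \<in> G" "x * y \<in> G" "- x \<in> G" "inverse x \<in> G"
      using that G(1) by (auto simp: subfield_C_def)
    then show "f x + f y \<in> f ` G" "f x * f y \<in> f ` G" "- f x \<in> f ` G" "inverse (f x) \<in> f ` G"
      using h(3-6) K' by (metis image_eqI)+
  qed
  ultimately show ?thesis unfolding subfield_C_def by auto
qed

lemma subfield_vimage:
  assumes K: "subfield_C K" "f \<in> embeddings K" and G: "subfield_C G"
  shows "subfield_C {x \<in> K. f x \<in> G}"
  using K(1) G embeddings_hom(1-6)[OF K] unfolding subfield_C_def by auto

lemma embeddings_maps_onto:
  assumes f: "f \<in> embeddings (field_closure S)" and S: "f ` S = S"
  shows "f ` field_closure S = field_closure S"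
proof
  let ?K = "field_closure S"
  have sub: "S \<subseteq> ?K" by (auto intro: field_closure.base)
  have "?K \<subseteq> {x \<in> ?K. f x \<in> ?K}"
    by (rule field_closure_least[OF subfield_vimage[OF subfield_field_closure f subfield_field_closure]])
      (use S sub in auto)
  then show "f ` ?K \<subseteq> ?K" by auto
  show "?K \<subseteq> f ` ?K"
    by (rule field_closure_least[OF subfield_image[OF subfield_field_closure f subfield_field_closure]])
      (use S sub in auto)
qed

text \<open>Algebraicity, stability under embeddings and commutation all pass from generators to the
  generated field.\<close>

lemma abelian_field_closure:
  assumes alg: "\<And>x. x \<in> S \<Longrightarrow> algebraic x"
    and onto: "\<And>f. f \<in> embeddings (field_closure S) \<Longrightarrow> f ` S = S"
    and comm: "\<And>f g x. f \<in> Gal_over_Q (field_closure S) \<Longrightarrow> g \<in> Gal_over_Q (field_closure S) \<Longrightarrow>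
      x \<in> S \<Longrightarrow> f (g x) = g (f x)"
  shows "abelian_extension_of_Q (field_closure S)"
proof -
  let ?K = "field_closure S"
  have "algebraic x" if "x \<in> ?K" for x
    using that by induction (auto intro: alg algebraic_add_complex algebraic_mult_complex)
  moreover have "f ` ?K = ?K" if "f \<in> embeddings ?K" for f
    by (rule embeddings_maps_onto[OF that onto[OF that]])
  moreover have "f (g x) = g (f x)" if f: "f \<in> Gal_over_Q ?K" and g: "g \<in> Gal_over_Q ?K" and x: "x \<in> ?K" for f g x
  proof -
    have fe: "f \<in> embeddings ?K" "g \<in> embeddings ?K"
      and im: "\<And>x. x \<in> ?K \<Longrightarrow> f x \<in> ?K" "\<And>x. x \<in> ?K \<Longrightarrow> g x \<in> ?K"
      using f g by (auto simp: Gal_over_Q_def dest: bij_betwE)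
    note hf = embeddings_hom(1-6)[OF subfield_field_closure fe(1)]
      and hg = embeddings_hom(1-6)[OF subfield_field_closure fe(2)]
    show ?thesis using x
      by induction (use hf hg im comm[OF f g] in \<open>auto\<close>)
  qed
  ultimately show ?thesis
    unfolding abelian_extension_of_Q_def using subfield_field_closure by blast
qed

text \<open>Every embedding of the compositum restricts to an automorphism of each factor, so all
  conditions can be checked on the union of the two factors. This is what makes the union
  \<open>Q_ab\<close> a field.\<close>

lemma abelian_compositum:
  assumes F: "abelian_extension_of_Q F" and F': "abelian_extension_of_Q F'"
  shows "abelian_extension_of_Q (field_closure (F \<union> F'))"
proof (rule abelian_field_closure)
  let ?K = "field_closure (F \<union> F')"
  have sub: "F \<subseteq> ?K" "F' \<subseteq> ?K" by (auto intro: field_closure.base)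
  have onto: "f ` G = G" if f: "f \<in> embeddings ?K" and G: "abelian_extension_of_Q G" "G \<subseteq> ?K" for f G
  proof -
    have "restrict f G \<in> embeddings G"
      by (rule embeddings_restrict[OF f G(2)]) (use G(1) in \<open>auto simp: abelian_extension_of_Q_def\<close>)
    then have "restrict f G ` G = G" using G(1) unfolding abelian_extension_of_Q_def by blast
    then show ?thesis by simp
  qed
  have comm: "f (g x) = g (f x)"
    if f: "f \<in> Gal_over_Q ?K" and g: "g \<in> Gal_over_Q ?K" and G: "abelian_extension_of_Q G" "G \<subseteq> ?K" and x: "x \<in> G" for f g x G
  proof -
    have fe: "f \<in> embeddings ?K" "g \<in> embeddings ?K" using f g by (auto simp: Gal_over_Q_def)
    have "restrict h G \<in> Gal_over_Q G" if h: "h \<in> embeddings ?K" for h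
    proof -
      have "restrict h G \<in> embeddings G"
        by (rule embeddings_restrict[OF h G(2)]) (use G(1) in \<open>auto simp: abelian_extension_of_Q_def\<close>)
      moreover have "inj_on (restrict h G) G"
        using embeddings_hom(9)[OF subfield_field_closure h] G(2) by (auto simp: inj_on_def)
      ultimately show ?thesis
        using onto[OF h G] by (simp add: Gal_over_Q_def bij_betw_def)
    qed
    then have "restrict f G (restrict g G x) = restrict g G (restrict f G x)"
      using G(1) x fe unfolding abelian_extension_of_Q_def by blast
    moreover have "f x \<in> G" "g x \<in> G" using onto[OF fe(1) G] onto[OF fe(2) G] x by auto
    ultimately show ?thesis using x by simp
  qed
  show "algebraic x" if "x \<in> F \<union> F'" for x
    using that F F' by (auto simp: abelian_extension_of_Q_def)
  show "f ` (F \<union> F') = F \<union> F'" if "f \<in> embeddings ?K" for f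
    using onto[OF that F sub(1)] onto[OF that F' sub(2)] by (simp add: image_Un)
  show "f (g x) = g (f x)" if "f \<in> Gal_over_Q ?K" "g \<in> Gal_over_Q ?K" "x \<in> F \<union> F'" for f g x
    using comm[OF that(1,2) F sub(1)] comm[OF that(1,2) F' sub(2)] that(3) by blast
qed

section \<open>Roots of unity generate an abelian extension\<close>

definition root1 :: "nat \<Rightarrow> complex" where
  "root1 n = cis (2 * pi / real n)"

lemma root1_power_self: "0 < n \<Longrightarrow> root1 n ^ n = 1"
  by (simp add: root1_def Complex.DeMoivre)

lemma root_of_unity_is_power_root1:
  assumes "0 < n" "z ^ n = 1" obtains k where "k < n" "z = root1 n ^ k"
proof -
  have "z \<in> (\<lambda>k. cis (2 * pi * real k / real n)) ` {..<n}"
    using Complex.bij_betw_roots_unity[OF assms(1)] assms(2) by (auto simp: bij_betw_def)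
  then obtain k where "k < n" "z = cis (2 * pi * real k / real n)" by auto
  then show ?thesis
    using that by (auto simp: root1_def Complex.DeMoivre mult_ac)
qed

lemma power_mod_root:
  fixes z :: "'a::monoid_mult"
  assumes "z ^ n = 1" shows "z ^ (k mod n) = z ^ k"
proof -
  have "z ^ k = z ^ (n * (k div n) + k mod n)" by simp
  also have "\<dots> = z ^ (k mod n)"
    unfolding power_add power_mult assms by simp
  finally show ?thesis by simp
qed

lemma root1_power_eq_iff:
  assumes n: "0 < n" shows "root1 n ^ a = root1 n ^ b \<longleftrightarrow> a mod n = b mod n"
proof -
  have inj: "inj_on (\<lambda>k. cis (2 * pi * real k / real n)) {..<n}"
    using Complex.bij_betw_roots_unity[OF n] by (simp add: bij_betw_def)
  have r: "root1 n ^ k = cis (2 * pi * real k / real n)" for k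
    by (simp add: root1_def Complex.DeMoivre mult_ac)
  have "root1 n ^ a = root1 n ^ b \<longleftrightarrow> root1 n ^ (a mod n) = root1 n ^ (b mod n)"
    using power_mod_root[OF root1_power_self[OF n]] by simp
  also have "\<dots> \<longleftrightarrow> a mod n = b mod n"
    unfolding r using inj n by (auto simp: inj_on_def)
  finally show ?thesis .
qed

lemma root1_mult: "0 < m \<Longrightarrow> 0 < n \<Longrightarrow> root1 (m * n) ^ n = root1 m"
  by (simp add: root1_def Complex.DeMoivre)

definition roots_of_unity :: "complex set" where
  "roots_of_unity = {z. \<exists>n>0. z ^ n = 1}"

text \<open>An embedding sends \<open>root1 n\<close> to one of its powers, and raising to two
  powers in either order gives the same result. Surjectivity on the roots comes from injectivity on
  the finite set of \<open>n\<close>-th roots.\<close>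

lemma abelian_roots_of_unity: "abelian_extension_of_Q (field_closure roots_of_unity)"
proof (rule abelian_field_closure)
  let ?K = "field_closure roots_of_unity"
  have inK: "z \<in> ?K" if "0 < n" "z ^ n = 1" for z n
    using that by (auto simp: roots_of_unity_def intro: field_closure.base)
  show "algebraic x" if x: "x \<in> roots_of_unity" for x
  proof -
    obtain n where n: "0 < n" "x ^ n = 1" using x by (auto simp: roots_of_unity_def)
    define P where "P = monom 1 n - (1 :: complex poly)"
    have "coeff P n = 1" using n by (simp add: P_def)
    then have "P \<noteq> 0" by auto
    moreover have "coeff P i \<in> \<int>" for i by (simp add: P_def)
    moreover have "poly P x = 0" using n by (simp add: P_def poly_monom)
    ultimately show ?thesis by (intro algebraicI[of P])
  qed
  have im: "f z ^ n = 1" if "f \<in> embeddings ?K" "0 < n" "z ^ n = 1" for f z n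
    using embeddings_hom(2,7)[OF subfield_field_closure that(1)] inK[OF that(2,3)] that(3) by metis
  show "f ` roots_of_unity = roots_of_unity" if f: "f \<in> embeddings ?K" for f
  proof
    show "f ` roots_of_unity \<subseteq> roots_of_unity"
      using im[OF f] by (auto simp: roots_of_unity_def)
    show "roots_of_unity \<subseteq> f ` roots_of_unity"
    proof
      fix z assume "z \<in> roots_of_unity"
      then obtain n where n: "0 < n" "z ^ n = 1" by (auto simp: roots_of_unity_def)
      have "f ` {z. z ^ n = 1} = {z. z ^ n = 1}"
      proof (rule endo_inj_surj)
        show "finite {z :: complex. z ^ n = 1}" using n(1) by (rule finite_nth_roots)
        show "f ` {z. z ^ n = 1} \<subseteq> {z. z ^ n = 1}" using im[OF f n(1)] by auto
        show "inj_on f {z. z ^ n = 1}"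
          by (rule inj_on_subset[OF embeddings_hom(9)[OF subfield_field_closure f]]) (use inK[OF n(1)] in auto)
      qed
      then have "z \<in> f ` {z. z ^ n = 1}" using n(2) by simp
      then show "z \<in> f ` roots_of_unity" using n(1) by (auto simp: roots_of_unity_def)
    qed
  qed
  show "f (g x) = g (f x)" if fg: "f \<in> Gal_over_Q ?K" "g \<in> Gal_over_Q ?K" and x: "x \<in> roots_of_unity" for f g x
  proof -
    obtain n where n: "0 < n" "x ^ n = 1" using x by (auto simp: roots_of_unity_def)
    have fe: "f \<in> embeddings ?K" "g \<in> embeddings ?K" using fg by (auto simp: Gal_over_Q_def)
    obtain k where k: "x = root1 n ^ k" by (rule root_of_unity_is_power_root1[OF n])
    note r = root1_power_self[OF n(1)]
    obtain i where i: "f (root1 n) = root1 n ^ i" by (rule root_of_unity_is_power_root1[OF n(1) im[OF fe(1) n(1) r]])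
    obtain j where j: "g (root1 n) = root1 n ^ j" by (rule root_of_unity_is_power_root1[OF n(1) im[OF fe(2) n(1) r]])
    have K: "root1 n \<in> ?K" by (rule inK[OF n(1) r])
    have f: "f (root1 n ^ a) = (root1 n ^ i) ^ a" for a
      using embeddings_hom(7)[OF subfield_field_closure fe(1) K] i by simp
    have g: "g (root1 n ^ a) = (root1 n ^ j) ^ a" for a
      using embeddings_hom(7)[OF subfield_field_closure fe(2) K] j by simp
    show ?thesis unfolding k
      by (simp add: f g power_mult[symmetric] mult_ac)
  qed
qed

text \<open>Two elements from different abelian extensions lie together in the compositum.\<close>

lemma subfield_Q_ab: "subfield_C Q_ab"
proof -
  have two: "\<exists>K. abelian_extension_of_Q K \<and> x \<in> K \<and> y \<in> K" if xy: "x \<in> Q_ab" "y \<in> Q_ab" for x y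
  proof -
    obtain F F' where F: "abelian_extension_of_Q F" "x \<in> F" "abelian_extension_of_Q F'" "y \<in> F'"
      using xy unfolding Q_ab_def by blast
    then show ?thesis
      using abelian_compositum[OF F(1,3)] field_closure.base[of x "F \<union> F'"] field_closure.base[of y "F \<union> F'"]
      by blast
  qed
  have sub: "subfield_C K" "K \<subseteq> Q_ab" if "abelian_extension_of_Q K" for K
    using that by (auto simp: Q_ab_def abelian_extension_of_Q_def)
  have "0 \<in> Q_ab" "1 \<in> Q_ab"
    using sub[OF abelian_roots_of_unity] by (auto simp: subfield_C_def)
  moreover have "x + y \<in> Q_ab" "x * y \<in> Q_ab" "- x \<in> Q_ab" "inverse x \<in> Q_ab" if xy: "x \<in> Q_ab" "y \<in> Q_ab" for x y
  proof -
    obtain K where K: "abelian_extension_of_Q K" "x \<in> K" "y \<in> K" using two[OF xy] by blast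
    have "x + y \<in> K" "x * y \<in> K" "- x \<in> K" "inverse x \<in> K"
      using sub(1)[OF K(1)] K by (auto simp: subfield_C_def)
    then show "x + y \<in> Q_ab" "x * y \<in> Q_ab" "- x \<in> Q_ab" "inverse x \<in> Q_ab"
      using sub(2)[OF K(1)] by auto
  qed
  ultimately show ?thesis by (simp add: subfield_C_def)
qed

lemma root_of_unity_in_Q_ab: "0 < n \<Longrightarrow> z ^ n = 1 \<Longrightarrow> z \<in> Q_ab"
  using abelian_roots_of_unity field_closure.base[of z roots_of_unity]
  unfolding Q_ab_def roots_of_unity_def by blast

section \<open>Automorphisms of the complex field and their restriction to
  \<open>Q_ab\<close>\<close>

lemma Aut_CD:
  assumes "\<sigma> \<in> Aut_C"
  shows "bij \<sigma>" "\<sigma> (x + y) = \<sigma> x + \<sigma> y" "\<sigma> (x * y) = \<sigma> x * \<sigma> y" "\<sigma> 0 = 0" "\<sigma> 1 = 1"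
    "\<sigma> (x ^ k) = \<sigma> x ^ k" "\<sigma> (x - y) = \<sigma> x - \<sigma> y" "\<sigma> (x / y) = \<sigma> x / \<sigma> y" "\<sigma> x = 0 \<longleftrightarrow> x = 0"
    "\<sigma> (prod f I) = (\<Prod>i\<in>I. \<sigma> (f i))"
proof -
  show bij: "bij \<sigma>" and add: "\<sigma> (x + y) = \<sigma> x + \<sigma> y" and mult: "\<sigma> (x * y) = \<sigma> x * \<sigma> y" for x y
    using assms by (auto simp: Aut_C_def)
  show zero: "\<sigma> 0 = 0" using add[of 0 0] by simp
  have inj: "\<sigma> x = \<sigma> y \<longleftrightarrow> x = y" for x y using bij by (simp add: bij_def inj_eq)
  show z: "\<sigma> x = 0 \<longleftrightarrow> x = 0" for x using inj[of x 0] zero by simp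
  show one: "\<sigma> 1 = 1" using mult[of 1 1] z[of 1] by simp
  show "\<sigma> (x ^ k) = \<sigma> x ^ k" by (induction k) (simp_all add: one mult)
  show "\<sigma> (x - y) = \<sigma> x - \<sigma> y" for x y using add[of "x - y" y] by simp
  show "\<sigma> (x / y) = \<sigma> x / \<sigma> y"
    using mult[of "x / y" y] z[of y] zero by (cases "y = 0") (auto simp: field_simps)
  show "\<sigma> (prod f I) = (\<Prod>i\<in>I. \<sigma> (f i))"
    by (induction I rule: infinite_finite_induct) (simp_all add: one mult)
qed

lemma Aut_C_inv: "\<sigma> \<in> Aut_C \<Longrightarrow> inv \<sigma> \<in> Aut_C"
proof -
  assume s: "\<sigma> \<in> Aut_C"
  note b = Aut_CD(1)[OF s]
  have r: "\<sigma> (inv \<sigma> x) = x" "inv \<sigma> (\<sigma> x) = x" for x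
    using b by (simp_all add: bij_def surj_f_inv_f)
  have "inv \<sigma> (x + y) = inv \<sigma> x + inv \<sigma> y" "inv \<sigma> (x * y) = inv \<sigma> x * inv \<sigma> y" for x y
    using Aut_CD(2,3)[OF s] r by metis+
  then show ?thesis using b by (simp add: Aut_C_def bij_imp_bij_inv)
qed

lemma restrict_Aut_C_in_Gal_Q_ab:
  assumes s: "\<sigma> \<in> Aut_C"
  shows "restrict \<sigma> Q_ab \<in> Gal_over_Q Q_ab"
proof -
  have emb: "restrict \<sigma> F \<in> embeddings F" if "subfield_C F" for F
    using that Aut_CD[OF s] by (auto simp: embeddings_def subfield_C_def)
  have "\<sigma> ` F = F" if F: "abelian_extension_of_Q F" for F
  proof -
    have "restrict \<sigma> F ` F = F" using F emb[of F] unfolding abelian_extension_of_Q_def by blast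
    then show ?thesis by simp
  qed
  then have "\<sigma> ` Q_ab = Q_ab" unfolding Q_ab_def by (auto simp: image_Union)
  moreover have "inj_on \<sigma> Q_ab" using Aut_CD(1)[OF s] by (meson bij_is_inj inj_on_subset subset_UNIV)
  ultimately have "bij_betw (restrict \<sigma> Q_ab) Q_ab Q_ab" by (simp add: bij_betw_def)
  then show ?thesis using emb[OF subfield_Q_ab] by (simp add: Gal_over_Q_def)
qed

section \<open>The cyclotomic character\<close>

lemma residue_bounds: "0 < n \<Longrightarrow> 0 \<le> residue x n" "0 < n \<Longrightarrow> residue x n < int n"
  using residue_mod[of x n] by (metis of_nat_0_less_iff pos_mod_sign pos_mod_bound)+

text \<open>The condition of \<open>cyclotomic\<close> on roots of unity, stated for an automorphism
  of all complex numbers.\<close>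

definition raises_roots :: "(complex \<Rightarrow> complex) \<Rightarrow> zhat \<Rightarrow> bool" where
  "raises_roots \<sigma> \<mu> \<longleftrightarrow> (\<forall>n \<zeta>. 0 < n \<longrightarrow> \<zeta> ^ n = 1 \<longrightarrow> \<sigma> \<zeta> = \<zeta> ^ nat (residue \<mu> n))"

lemma raises_roots_root1: "raises_roots \<sigma> \<mu> \<Longrightarrow> 0 < n \<Longrightarrow> \<sigma> (root1 n) = root1 n ^ nat (residue \<mu> n)"
  by (simp add: raises_roots_def root1_power_self)

lemma cyclotomic_iff:
  assumes "\<sigma> \<in> Aut_C"
  shows "cyclotomic (restrict \<sigma> Q_ab) \<mu> \<longleftrightarrow> \<mu> \<in> zhat_units \<and> raises_roots \<sigma> \<mu>"
  using restrict_Aut_C_in_Gal_Q_ab[OF assms] root_of_unity_in_Q_ab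
  by (auto simp: cyclotomic_def raises_roots_def)

lemma raises_roots_unique:
  assumes "raises_roots \<sigma> \<mu>" "raises_roots \<sigma> \<nu>" shows "\<mu> = \<nu>"
proof (rule zhat_eqI)
  fix n :: nat assume n: "0 < n"
  have "root1 n ^ nat (residue \<mu> n) = root1 n ^ nat (residue \<nu> n)"
    using raises_roots_root1[OF assms(1) n] raises_roots_root1[OF assms(2) n] by simp
  then have "nat (residue \<mu> n) mod n = nat (residue \<nu> n) mod n"
    using root1_power_eq_iff[OF n] by simp
  then show "residue \<mu> n = residue \<nu> n"
    using residue_bounds[OF n, of \<mu>] residue_bounds[OF n, of \<nu>] by simp
qed

lemma nat_residue_mult_mod:
  assumes n: "0 < n" shows "nat (residue (\<mu> * \<nu>) n) = (nat (residue \<mu> n) * nat (residue \<nu> n)) mod n"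
  using residue_bounds[OF n, of \<mu>] residue_bounds[OF n, of \<nu>]
  by (simp add: times_zhat.rep_eq nat_mod_distrib nat_mult_distrib)

lemma raises_roots_comp:
  assumes s: "raises_roots \<sigma> \<mu>" and r: "raises_roots \<rho> \<nu>" and "\<sigma> \<in> Aut_C"
  shows "raises_roots (\<sigma> \<circ> \<rho>) (\<mu> * \<nu>)"
  unfolding raises_roots_def
proof (intro allI impI)
  fix n :: nat and z :: complex assume n: "0 < n" and z: "z ^ n = 1"
  have "(\<sigma> \<circ> \<rho>) z = (z ^ nat (residue \<mu> n)) ^ nat (residue \<nu> n)"
    using r s n z Aut_CD(6)[OF assms(3)] by (simp add: raises_roots_def)
  also have "\<dots> = z ^ nat (residue (\<mu> * \<nu>) n)"
    by (simp add: nat_residue_mult_mod[OF n] power_mod_root[OF z] power_mult)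
  finally show "(\<sigma> \<circ> \<rho>) z = z ^ nat (residue (\<mu> * \<nu>) n)" .
qed

text \<open>The exponents on the chosen generators \<open>root1 n\<close> are compatible because
  \<open>root1 n\<close> raised to \<open>n / m\<close> is \<open>root1 m\<close>; they therefore
  form a profinite integer.\<close>

lemma ex_raises_roots:
  assumes s: "\<sigma> \<in> Aut_C" shows "\<exists>\<mu>. raises_roots \<sigma> \<mu>"
proof -
  have "\<exists>k. k < n \<and> \<sigma> (root1 n) = root1 n ^ k" if n: "0 < n" for n
  proof -
    have "\<sigma> (root1 n) ^ n = 1"
      using Aut_CD(5,6)[OF s] root1_power_self[OF n] by metis
    then show ?thesis using root_of_unity_is_power_root1[OF n] by metis
  qed
  then obtain k where k: "\<And>n. 0 < n \<Longrightarrow> k n < n" "\<And>n. 0 < n \<Longrightarrow> \<sigma> (root1 n) = root1 n ^ k n"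
    by metis
  have comp: "k m = k n mod m" if n: "0 < n" and mn: "m dvd n" for m n
  proof -
    obtain l where l: "n = m * l" using mn by blast
    then have pos: "0 < m" "0 < l" using n by auto
    have "root1 m ^ k m = \<sigma> (root1 n ^ l)"
      using k(2)[OF pos(1)] root1_mult[OF pos] l by simp
    also have "\<dots> = (root1 n ^ l) ^ k n"
      using k(2)[OF n] Aut_CD(6)[OF s] by (simp add: power_mult[symmetric] mult.commute)
    also have "\<dots> = root1 m ^ k n" using root1_mult[OF pos] l by simp
    finally show ?thesis using root1_power_eq_iff[OF pos(1)] k(1)[OF pos(1)] by simp
  qed
  define \<mu> where "\<mu> = Abs_zhat (\<lambda>n. if n = 0 then 0 else int (k n))"
  have "residue \<mu> = (\<lambda>n. if n = 0 then 0 else int (k n))"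
    unfolding \<mu>_def
  proof (rule Abs_zhat_inverse, intro CollectI conjI allI impI)
    fix m n :: nat assume mn: "0 < n" "m dvd n"
    then have "m \<noteq> 0" by auto
    then show "(if m = 0 then 0 else int (k m)) = (if n = 0 then 0 else int (k n)) mod int m"
      using mn comp[OF mn] zmod_int[of "k n" m] by simp
  qed simp
  then have res: "0 < n \<Longrightarrow> residue \<mu> n = int (k n)" for n by simp
  have "raises_roots \<sigma> \<mu>"
    unfolding raises_roots_def
  proof (intro allI impI)
    fix n :: nat and z :: complex assume n: "0 < n" and z: "z ^ n = 1"
    obtain a where "z = root1 n ^ a" by (rule root_of_unity_is_power_root1[OF n z])
    then show "\<sigma> z = z ^ nat (residue \<mu> n)"
      using Aut_CD(6)[OF s] k(2)[OF n] by (simp add: res[OF n] power_mult[symmetric] mult.commute)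
  qed
  then show ?thesis by blast
qed

lemma raises_roots_id: "raises_roots id 1"
  unfolding raises_roots_def
proof (intro allI impI)
  fix n :: nat and z :: complex assume n: "0 < n" "z ^ n = 1"
  have "z ^ nat (residue 1 n) = z ^ (1 mod n)"
    using n by (simp add: one_zhat.rep_eq nat_mod_as_int)
  then show "id z = z ^ nat (residue 1 n)"
    by (simp only: id_apply power_mod_root[OF n(2)] power_one_right)
qed

text \<open>The exponent is multiplicative under composition, so that of the inverse automorphism is
  the inverse. This is also the reason why every exponent is a unit.\<close>

lemma raises_roots_inverse:
  assumes s: "\<sigma> \<in> Aut_C" "raises_roots \<sigma> \<mu>"
  obtains \<nu> where "raises_roots (inv \<sigma>) \<nu>" "\<mu> * \<nu> = 1"
proof -
  obtain \<nu> where n: "raises_roots (inv \<sigma>) \<nu>" using ex_raises_roots[OF Aut_C_inv[OF s(1)]] by blast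
  have "\<sigma> \<circ> inv \<sigma> = id"
    using Aut_CD(1)[OF s(1)] by (meson bij_is_surj surj_iff)
  then have "raises_roots id (\<mu> * \<nu>)"
    using raises_roots_comp[OF s(2) n s(1)] by simp
  then show ?thesis using that[OF n] raises_roots_unique[OF _ raises_roots_id] by blast
qed

lemma ex1_cyclotomic:
  assumes s: "\<sigma> \<in> Aut_C" shows "\<exists>!\<mu>. cyclotomic (restrict \<sigma> Q_ab) \<mu>"
proof -
  obtain \<mu> where m: "raises_roots \<sigma> \<mu>" using ex_raises_roots[OF s] by blast
  obtain \<nu> where "\<mu> * \<nu> = 1" by (rule raises_roots_inverse[OF s m])
  then have "\<mu> \<in> zhat_units" by (auto simp: zhat_units_def dvd_def)
  then show ?thesis
    using m raises_roots_unique by (auto simp: cyclotomic_iff[OF s])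
qed

text \<open>The graph of the automorphism of the \<open>n\<close>-th cyclotomic field that raises
  \<open>root1 n\<close> to the power \<open>\<mu>\<close>, with elements written as quotients of
  integral polynomials in \<open>root1 n\<close>.\<close>

definition cyclotomic_rel :: "zhat \<Rightarrow> nat \<Rightarrow> (complex \<times> complex) set" where
  "cyclotomic_rel \<mu> n = {(int_eval P (root1 n) / int_eval Q (root1 n),
      int_eval P (root1 n ^ nat (residue \<mu> n)) / int_eval Q (root1 n ^ nat (residue \<mu> n))) | P Q.
    int_eval Q (root1 n) \<noteq> 0}"

lemma coprime_residue_unit:
  assumes "\<mu> * \<nu> = 1" "0 < n" shows "coprime (nat (residue \<mu> n)) n"
    and "(nat (residue \<mu> n) * nat (residue \<nu> n)) mod n = 1 mod n"
proof -
  show eq: "(nat (residue \<mu> n) * nat (residue \<nu> n)) mod n = 1 mod n"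
    using nat_residue_mult_mod[OF assms(2), of \<mu> \<nu>] assms by (simp add: one_zhat.rep_eq nat_mod_as_int)
  have "coprime ((nat (residue \<mu> n) * nat (residue \<nu> n)) mod n) n"
    unfolding eq using assms(2) by (simp add: coprime_mod_left_iff)
  then have "coprime (nat (residue \<mu> n) * nat (residue \<nu> n)) n"
    using assms(2) by (simp add: coprime_mod_left_iff)
  then show "coprime (nat (residue \<mu> n)) n" by simp
qed

text \<open>One direction is the irreducibility result for the exponent \<open>\<mu>\<close>; the
  other is the same result for \<open>\<nu>\<close>, which undoes that exponent.\<close>

lemma int_eval_unit_power_iff:
  assumes mn: "\<mu> * \<nu> = 1" and n: "0 < n" and z: "z ^ n = 1"
  shows "int_eval P (z ^ nat (residue \<mu> n)) = 0 \<longleftrightarrow> int_eval P z = 0"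
proof
  let ?k = "nat (residue \<mu> n)" and ?l = "nat (residue \<nu> n)"
  show "int_eval P z = 0 \<Longrightarrow> int_eval P (z ^ ?k) = 0"
    by (rule int_poly_root_of_unity_power[OF n z coprime_residue_unit(1)[OF mn n]])
  assume "int_eval P (z ^ ?k) = 0"
  moreover have "(z ^ ?k) ^ n = 1" using z by (metis power_mult mult.commute power_one)
  moreover have "coprime ?l n" using coprime_residue_unit(1)[of \<nu> \<mu>] mn n by (simp add: mult.commute)
  ultimately have "int_eval P ((z ^ ?k) ^ ?l) = 0"
    using int_poly_root_of_unity_power[OF n] by blast
  also have "(z ^ ?k) ^ ?l = z ^ ((?k * ?l) mod n)" by (simp add: power_mod_root[OF z] power_mult)
  also have "\<dots> = z" unfolding coprime_residue_unit(2)[OF mn n] power_mod_root[OF z] by simp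
  finally show "int_eval P z = 0" .
qed

lemma root1_residue_mono:
  assumes n: "0 < m" "0 < l"
  shows "(root1 (m * l) ^ nat (residue \<mu> (m * l))) ^ l = root1 m ^ nat (residue \<mu> m)"
proof -
  have "nat (residue \<mu> m) = nat (residue \<mu> (m * l)) mod m"
    using residue_dvd[of "m * l" m \<mu>] n residue_bounds[of "m * l" \<mu>]
    by (metis dvd_triv_left mult_pos_pos nat_int nat_mod_distrib of_nat_0_le_iff)
  then have "root1 m ^ nat (residue \<mu> m) = root1 m ^ nat (residue \<mu> (m * l))"
    by (simp add: power_mod_root[OF root1_power_self[OF n(1)]])
  also have "\<dots> = (root1 (m * l) ^ l) ^ nat (residue \<mu> (m * l))" by (simp add: root1_mult[OF n])
  finally show ?thesis by (simp add: power_mult[symmetric] mult.commute)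
qed

lemma cyclotomic_rel_mono:
  assumes n: "0 < m" "0 < l" shows "cyclotomic_rel \<mu> m \<subseteq> cyclotomic_rel \<mu> (m * l)"
proof
  fix p assume "p \<in> cyclotomic_rel \<mu> m"
  then obtain P Q where p: "p = (int_eval P (root1 m) / int_eval Q (root1 m),
      int_eval P (root1 m ^ nat (residue \<mu> m)) / int_eval Q (root1 m ^ nat (residue \<mu> m)))"
      "int_eval Q (root1 m) \<noteq> 0"
    unfolding cyclotomic_rel_def by blast
  have e: "int_eval (pcompose S (monom 1 l)) z = int_eval S (z ^ l)" for S z
    by (simp add: int_eval_pcompose int_eval_monom)
  show "p \<in> cyclotomic_rel \<mu> (m * l)"
    unfolding cyclotomic_rel_def
    by (intro CollectI exI[of _ "pcompose P (monom 1 l)"] exI[of _ "pcompose Q (monom 1 l)"])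
      (simp add: p e root1_mult[OF n] root1_residue_mono[OF n])
qed

text \<open>The automorphisms of the cyclotomic fields that belong to \<open>\<mu>\<close> are
  compatible, so their union is an automorphism of the field of all roots of unity, and this extends
  to the complex numbers.\<close>

lemma ex_Aut_C_raises_roots:
  assumes m: "\<mu> \<in> zhat_units" shows "\<exists>\<sigma>\<in>Aut_C. raises_roots \<sigma> \<mu>"
proof -
  obtain \<nu> where mn: "\<mu> * \<nu> = 1" using m by (auto simp: zhat_units_def dvd_def)
  let ?k = "\<lambda>n. nat (residue \<mu> n)"
  define R where "R = (\<Union>n\<in>{0<..}. cyclotomic_rel \<mu> n)"
  have RI: "(int_eval P (root1 n) / int_eval Q (root1 n), int_eval P (root1 n ^ ?k n) / int_eval Q (root1 n ^ ?k n)) \<in> R"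
    if "0 < n" "int_eval Q (root1 n) \<noteq> 0" for n P Q
    using that unfolding R_def cyclotomic_rel_def by auto
  have nz: "int_eval Q (root1 n ^ ?k n) = 0 \<longleftrightarrow> int_eval Q (root1 n) = 0" if "0 < n" for n Q
    by (rule int_eval_unit_power_iff[OF mn that root1_power_self[OF that]])
  have two: "\<exists>n>0. p \<in> cyclotomic_rel \<mu> n \<and> q \<in> cyclotomic_rel \<mu> n" if pq: "p \<in> R" "q \<in> R" for p q
  proof -
    obtain m n where mn: "0 < m" "p \<in> cyclotomic_rel \<mu> m" "0 < n" "q \<in> cyclotomic_rel \<mu> n"
      using pq unfolding R_def by auto
    then have "p \<in> cyclotomic_rel \<mu> (m * n)" "q \<in> cyclotomic_rel \<mu> (m * n)"
      using cyclotomic_rel_mono[of m n \<mu>] cyclotomic_rel_mono[of n m \<mu>] by (auto simp: mult.commute)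
    then show ?thesis using mn by (intro exI[of _ "m * n"]) auto
  qed
  have "partial_iso R"
    unfolding partial_iso_def
  proof (intro conjI allI impI)
    show "(0, 0) \<in> R" "(1, 1) \<in> R" using RI[of 1 1 0] RI[of 1 1 1] by (auto simp: int_eval_1)
  next
    fix a b c d assume "(a, b) \<in> R" "(c, d) \<in> R"
    then obtain n where n: "0 < n" "(a, b) \<in> cyclotomic_rel \<mu> n" "(c, d) \<in> cyclotomic_rel \<mu> n"
      using two[of "(a, b)" "(c, d)"] by blast
    then obtain P Q S T where *: "int_eval Q (root1 n) \<noteq> 0" "int_eval T (root1 n) \<noteq> 0"
        "a = int_eval P (root1 n) / int_eval Q (root1 n)" "b = int_eval P (root1 n ^ ?k n) / int_eval Q (root1 n ^ ?k n)"
        "c = int_eval S (root1 n) / int_eval T (root1 n)" "d = int_eval S (root1 n ^ ?k n) / int_eval T (root1 n ^ ?k n)"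
      unfolding cyclotomic_rel_def by blast
    have "int_eval (Q * T) (root1 n) \<noteq> 0" using * by (simp add: int_eval_mult)
    from RI[OF n(1) this, of "P * T + S * Q"] RI[OF n(1) this, of "P * S"]
    show "(a + c, b + d) \<in> R" "(a * c, b * d) \<in> R"
      using * nz[OF n(1)] by (simp_all add: int_eval_mult int_eval_add add_frac_eq)
  next
    fix a b assume "(a, b) \<in> R"
    then obtain n where n: "0 < n" "(a, b) \<in> cyclotomic_rel \<mu> n" unfolding R_def by auto
    then obtain P Q where *: "int_eval Q (root1 n) \<noteq> 0"
        "a = int_eval P (root1 n) / int_eval Q (root1 n)" "b = int_eval P (root1 n ^ ?k n) / int_eval Q (root1 n ^ ?k n)"
      unfolding cyclotomic_rel_def by blast
    show "a = 0 \<longleftrightarrow> b = 0" using * nz[OF n(1)] by simp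
    show "(- a, - b) \<in> R"
      using RI[OF n(1) *(1), of "0 - P"] * by (simp only: int_eval_minus) simp
    show "(inverse a, inverse b) \<in> R"
    proof (cases "int_eval P (root1 n) = 0")
      case True
      then show ?thesis using RI[of 1 1 0] * nz[OF n(1), of P] by (simp add: int_eval_1)
    next
      case False
      from RI[OF n(1) this, of Q] show ?thesis using * by simp
    qed
  qed
  \<comment> \<open>A value at the power of \<open>root1 n\<close> becomes a value at
    \<open>root1 n\<close> by substituting a power of the variable; the reverse inclusion
    substitutes the exponent of \<open>\<nu>\<close>.\<close>
  moreover have "Domain R = Range R"
  proof
    show "Range R \<subseteq> Domain R"
    proof
      fix b assume "b \<in> Range R"
      then obtain n P Q where n: "0 < n" and *: "int_eval Q (root1 n) \<noteq> 0"
          "b = int_eval P (root1 n ^ ?k n) / int_eval Q (root1 n ^ ?k n)"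
        unfolding R_def cyclotomic_rel_def by auto
      have e: "int_eval (pcompose S (monom 1 (?k n))) z = int_eval S (z ^ ?k n)" for S z
        by (simp add: int_eval_pcompose int_eval_monom)
      show "b \<in> Domain R"
        using RI[OF n, of "pcompose Q (monom 1 (?k n))" "pcompose P (monom 1 (?k n))"] * nz[OF n]
        unfolding e by blast
    qed
    show "Domain R \<subseteq> Range R"
    proof
      fix a assume "a \<in> Domain R"
      then obtain n P Q where n: "0 < n" and *: "int_eval Q (root1 n) \<noteq> 0"
          "a = int_eval P (root1 n) / int_eval Q (root1 n)"
        unfolding R_def cyclotomic_rel_def by auto
      let ?l = "nat (residue \<nu> n)"
      have e: "int_eval (pcompose S (monom 1 ?l)) z = int_eval S (z ^ ?l)" for S z
        by (simp add: int_eval_pcompose int_eval_monom)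
      have "(root1 n ^ ?k n) ^ ?l = root1 n ^ ((?k n * ?l) mod n)"
        by (simp add: power_mod_root[OF root1_power_self[OF n]] power_mult)
      also have "\<dots> = root1 n"
        unfolding coprime_residue_unit(2)[OF mn n] power_mod_root[OF root1_power_self[OF n]] by simp
      finally have r: "(root1 n ^ ?k n) ^ ?l = root1 n" .
      have "int_eval Q (root1 n ^ ?l) \<noteq> 0"
        using int_eval_unit_power_iff[of \<nu> \<mu> n "root1 n" Q] mn n * root1_power_self[OF n] by (simp add: mult.commute)
      then show "a \<in> Range R"
        using RI[OF n, of "pcompose Q (monom 1 ?l)" "pcompose P (monom 1 ?l)"] *
        unfolding e r by blast
    qed
  qed
  ultimately obtain \<sigma> where s: "\<sigma> \<in> Aut_C" "\<forall>x y. (x, y) \<in> R \<longrightarrow> \<sigma> x = y"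
    by (rule partial_iso_extend_Aut_C)
  have "raises_roots \<sigma> \<mu>"
    unfolding raises_roots_def
  proof (intro allI impI)
    fix n :: nat and z :: complex assume n: "0 < n" and z: "z ^ n = 1"
    obtain a where a: "z = root1 n ^ a" by (rule root_of_unity_is_power_root1[OF n z])
    have "(root1 n ^ a, (root1 n ^ ?k n) ^ a) \<in> R"
      using RI[OF n, of 1 "monom 1 a"] by (simp add: int_eval_1 int_eval_monom)
    from s(2)[rule_format, OF this] show "\<sigma> z = z ^ ?k n"
      by (simp add: a power_mult[symmetric] mult.commute)
  qed
  then show ?thesis using s(1) by blast
qed

section \<open>Lattices and the Weierstrass function\<close>

lemma lattice_0 [simp]: "0 \<in> lattice \<tau>"
  unfolding lattice_def by (intro CollectI exI[of _ 0]) simp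

lemma latticeI: "of_int m + of_int n * \<tau> \<in> lattice \<tau>"
  unfolding lattice_def by blast

lemma latticeE:
  assumes "w \<in> lattice \<tau>" obtains m n where "w = of_int m + of_int n * \<tau>"
  using assms unfolding lattice_def by blast

lemma lattice_add:
  assumes "v \<in> lattice \<tau>" "w \<in> lattice \<tau>" shows "v + w \<in> lattice \<tau>"
proof -
  obtain a b c d where "v = of_int a + of_int b * \<tau>" "w = of_int c + of_int d * \<tau>"
    using assms by (auto elim!: latticeE)
  then have "v + w = of_int (a + c) + of_int (b + d) * \<tau>" by (simp add: algebra_simps)
  then show ?thesis using latticeI by metis
qed

lemma lattice_of_int_mult:
  assumes "w \<in> lattice \<tau>" shows "of_int k * w \<in> lattice \<tau>"
proof -
  obtain c d where "w = of_int c + of_int d * \<tau>"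
    using assms by (auto elim!: latticeE)
  then have "of_int k * w = of_int (k * c) + of_int (k * d) * \<tau>" by (simp add: algebra_simps)
  then show ?thesis using latticeI by metis
qed

lemma lattice_uminus: "w \<in> lattice \<tau> \<Longrightarrow> - w \<in> lattice \<tau>"
  using lattice_of_int_mult[of w \<tau> "-1"] by simp

lemma lattice_diff: "v \<in> lattice \<tau> \<Longrightarrow> w \<in> lattice \<tau> \<Longrightarrow> v - w \<in> lattice \<tau>"
  using lattice_add[of v \<tau> "- w"] lattice_uminus[of w \<tau>] by simp

lemma lattice_uminus_iff [simp]: "- w \<in> lattice \<tau> \<longleftrightarrow> w \<in> lattice \<tau>"
  using lattice_uminus[of w \<tau>] lattice_uminus[of "- w" \<tau>] by auto

lemma lattice_add_iff: "v \<in> lattice \<tau> \<Longrightarrow> w + v \<in> lattice \<tau> \<longleftrightarrow> w \<in> lattice \<tau>"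
  using lattice_add[of w \<tau> v] lattice_diff[of "w + v" \<tau> v] by auto

lemma lattice_1 [simp]: "1 \<in> lattice \<tau>" and lattice_tau [simp]: "\<tau> \<in> lattice \<tau>"
  using latticeI[of 1 0 \<tau>] latticeI[of 0 1 \<tau>] by simp_all

lemma countable_lattice: "countable (lattice \<tau>)"
proof -
  have "lattice \<tau> = range (\<lambda>(m, n). of_int m + of_int n * \<tau>)"
    unfolding lattice_def by auto
  then show ?thesis by simp
qed

text \<open>The exponent is half of -3: the inverse cube of a lattice norm is bounded by a product
  of two such terms, one in each integer coordinate.\<close>

lemma summable_on_int_powr: "(\<lambda>m :: int. (1 + \<bar>real_of_int m\<bar>) powr (- 3 / 2)) summable_on UNIV"
proof -
  let ?g = "\<lambda>m :: int. (1 + \<bar>real_of_int m\<bar>) powr (- 3 / 2)"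
  have "summable (\<lambda>n. real (Suc n) powr (- 3 / 2))"
    by (subst summable_Suc_iff) (simp add: summable_real_powr_iff)
  then have nat: "(\<lambda>n. (1 + real n) powr (- 3 / 2)) summable_on UNIV"
    by (intro norm_summable_imp_summable_on) (simp add: add.commute)
  have "?g summable_on (range int)"
    by (subst summable_on_reindex) (use nat in \<open>simp_all add: o_def\<close>)
  moreover have "?g summable_on (range (\<lambda>n. - int n))"
    by (subst summable_on_reindex) (use nat in \<open>simp_all add: o_def inj_on_def\<close>)
  ultimately have "?g summable_on (range int \<union> range (\<lambda>n. - int n))"
    by (rule summable_on_union)
  also have "range int \<union> range (\<lambda>n. - int n) = UNIV"
    by (auto simp: image_iff) (metis int_cases2)
  finally show ?thesis .
qed

text \<open>The squares cancel and leave cubic decay. For \<open>norm w\<close> at least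
  \<open>2 * r\<close> one has \<open>norm (z - w)\<close> at least half of \<open>norm w\<close>
  and \<open>norm (2 * w - z)\<close> at most 5/2 of it, which gives the constant 10.\<close>

lemma wp_term_bound:
  fixes z w :: complex
  assumes "norm z \<le> r" "2 * r \<le> norm w" "0 < r"
  shows "norm (1 / (z - w) ^ 2 - 1 / w ^ 2) \<le> 10 * r * (1 / norm w ^ 3)"
proof -
  have w: "0 < norm w" using assms by linarith
  have zw: "norm w / 2 \<le> norm (z - w)"
    using norm_triangle_ineq2[of w z] assms by (simp add: norm_minus_commute)
  then have nz: "z - w \<noteq> 0" "w \<noteq> 0" using w by auto
  have "1 / (z - w) ^ 2 - 1 / w ^ 2 = z * (2 * w - z) / ((z - w) ^ 2 * w ^ 2)"
    using nz by (simp add: divide_simps) (simp add: power2_eq_square algebra_simps)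
  then have "norm (1 / (z - w) ^ 2 - 1 / w ^ 2) = norm z * norm (2 * w - z) / (norm (z - w) ^ 2 * norm w ^ 2)"
    by (simp add: norm_divide norm_mult norm_power)
  also have "\<dots> \<le> (r * (5 / 2 * norm w)) / ((norm w / 2) ^ 2 * norm w ^ 2)"
  proof (rule frac_le)
    have "norm (2 * w - z) \<le> 2 * norm w + norm z"
      by (rule order.trans[OF norm_triangle_ineq4]) (simp add: norm_mult)
    then have "norm (2 * w - z) \<le> 5 / 2 * norm w" using assms by linarith
    then show "norm z * norm (2 * w - z) \<le> r * (5 / 2 * norm w)"
      using assms by (intro mult_mono) auto
    show "(norm w / 2) ^ 2 * norm w ^ 2 \<le> norm (z - w) ^ 2 * norm w ^ 2"
      using zw by (intro mult_right_mono power_mono) auto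
  qed (use w assms in auto)
  also have "\<dots> = 10 * r * (1 / norm w ^ 3)"
    using w by (simp add: field_simps power2_eq_square power3_eq_cube)
  finally show ?thesis .
qed

lemma inverse_square_deriv:
  fixes y w c :: complex
  assumes "y - w \<noteq> 0"
  shows "((\<lambda>y. 1 / (y - w) ^ 2 - c) has_field_derivative - 2 / (y - w) ^ 3) (at y)"
proof -
  have "((\<lambda>y. (y - w) ^ 2) has_field_derivative 2 * (y - w)) (at y)"
    by (auto intro!: derivative_eq_intros)
  from DERIV_diff[OF DERIV_inverse_fun[OF this] DERIV_const, of c] assms
  have "((\<lambda>y. inverse ((y - w) ^ 2) - c) has_field_derivative
      - (2 * (y - w) * inverse (((y - w) ^ 2) ^ Suc (Suc 0))) - 0) (at y)" by simp
  moreover have "x \<noteq> 0 \<Longrightarrow> - (2 * x * inverse ((x ^ 2) ^ Suc (Suc 0))) - 0 = - 2 / x ^ 3" for x :: complex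
    by (simp add: field_simps eval_nat_numeral)
  ultimately have "((\<lambda>y. inverse ((y - w) ^ 2) - c) has_field_derivative - 2 / (y - w) ^ 3) (at y)"
    using assms by metis
  then show ?thesis by (simp only: divide_inverse mult_1_left)
qed

section \<open>Lattice sums, discreteness of the lattice and the Weierstrass function\<close>

context
  fixes \<tau> :: complex assumes tau: "0 < Im \<tau>"
begin

lemma lattice_eq_iff:
  "of_int m + of_int n * \<tau> = of_int k + of_int l * \<tau> \<longleftrightarrow> m = k \<and> n = l"
proof
  assume eq: "of_int m + of_int n * \<tau> = of_int k + of_int l * \<tau>"
  then have "Im (of_int m + of_int n * \<tau>) = Im (of_int k + of_int l * \<tau>)" by simp
  then have "n = l" using tau by simp
  then show "m = k \<and> n = l" using eq by simp
qed auto

lemma lattice_norm_bound: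
  obtains C where "0 < C" "\<forall>m n. \<bar>real_of_int m\<bar> \<le> C * norm (of_int m + of_int n * \<tau>)"
    "\<forall>m n. \<bar>real_of_int n\<bar> \<le> C * norm (of_int m + of_int n * \<tau>)"
proof -
  define C where "C = 1 + (1 + norm \<tau>) / Im \<tau>"
  have "0 < C" using tau by (simp add: C_def add_pos_nonneg)
  moreover have "\<bar>real_of_int m\<bar> \<le> C * norm (of_int m + of_int n * \<tau>) \<and>
    \<bar>real_of_int n\<bar> \<le> C * norm (of_int m + of_int n * \<tau>)" for m n
  proof -
  let ?w = "of_int m + of_int n * \<tau>"
  have "\<bar>real_of_int n\<bar> * Im \<tau> = \<bar>Im ?w\<bar>" using tau by (simp add: abs_mult)
  also have "\<dots> \<le> norm ?w" by (rule abs_Im_le_cmod)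
  finally have n: "\<bar>real_of_int n\<bar> \<le> norm ?w / Im \<tau>" using tau by (simp add: field_simps)
  have "norm (of_int m :: complex) = norm (?w - of_int n * \<tau>)" by simp
  also have "\<dots> \<le> norm ?w + \<bar>real_of_int n\<bar> * norm \<tau>"
    by (rule order.trans[OF norm_triangle_ineq4]) (simp add: norm_mult)
  also have "\<dots> \<le> norm ?w + norm ?w / Im \<tau> * norm \<tau>"
    using n by (intro add_left_mono mult_right_mono) auto
  finally have m: "\<bar>real_of_int m\<bar> \<le> norm ?w + norm ?w / Im \<tau> * norm \<tau>" by simp
  have C: "C * norm ?w = norm ?w + norm ?w / Im \<tau> + norm ?w / Im \<tau> * norm \<tau>"
    using tau by (simp add: C_def field_simps)
    have "0 \<le> norm ?w / Im \<tau>" "0 \<le> norm ?w / Im \<tau> * norm \<tau>" using tau by auto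
    then show ?thesis unfolding C using m n norm_ge_zero[of ?w] by linarith
  qed
  ultimately show ?thesis using that[of C] by blast
qed

lemma summable_lattice_cube: "(\<lambda>w. 1 / norm w ^ 3) summable_on (lattice \<tau> - {0})"
proof -
  obtain C where C: "0 < C" "\<forall>m n. \<bar>real_of_int m\<bar> \<le> C * norm (of_int m + of_int n * \<tau>)"
    "\<forall>m n. \<bar>real_of_int n\<bar> \<le> C * norm (of_int m + of_int n * \<tau>)"
    by (rule lattice_norm_bound)
  define g where "g m = (1 + \<bar>real_of_int m\<bar>) powr (- 3 / 2)" for m
  define S where "S = infsum g UNIV"
  have g: "(g has_sum S) UNIV" unfolding S_def g_def using summable_on_int_powr by (rule has_sum_infsum)
  have "(\<lambda>p. g (fst p) * g (snd p)) summable_on (UNIV \<times> UNIV)"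
  proof (rule summable_on_SigmaI[where g = "\<lambda>m. g m * S"])
    show "((\<lambda>y. g (fst (x, y)) * g (snd (x, y))) has_sum g x * S) UNIV" for x
      using has_sum_cmult_right[OF g, of "g x"] by simp
    show "(\<lambda>m. g m * S) summable_on UNIV"
      using g by (intro summable_on_cmult_left) (auto simp: summable_on_def)
  qed (simp add: g_def)
  then have "(\<lambda>p. (2 * C) ^ 3 * (g (fst p) * g (snd p))) summable_on (UNIV - {(0, 0)})"
    by (intro summable_on_cmult_right) (erule summable_on_subset_banach, simp)
  then have "(\<lambda>p. 1 / norm (of_int (fst p) + of_int (snd p) * \<tau>) ^ 3) summable_on (UNIV - {(0, 0)})"
  proof (rule summable_on_comparison_test)
    fix p :: "int \<times> int" assume p: "p \<in> UNIV - {(0, 0)}"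
    obtain m n where mn: "p = (m, n)" by (cases p)
    let ?w = "of_int m + of_int n * \<tau>"
    \<comment> \<open>Off the origin \<open>C * norm ?w\<close> is at least 1 and bounds both
      coordinates, so doubling it bounds 1 plus either coordinate.\<close>
    define x where "x = 2 * C * norm ?w"
    have "1 \<le> \<bar>real_of_int m\<bar> \<or> 1 \<le> \<bar>real_of_int n\<bar>" using p mn by auto
    then have one: "1 \<le> C * norm ?w" using C(2)[rule_format, of m n] C(3)[rule_format, of n m] by linarith
    then have x: "0 < x" "1 + \<bar>real_of_int m\<bar> \<le> x" "1 + \<bar>real_of_int n\<bar> \<le> x"
      using C(2)[rule_format, of m n] C(3)[rule_format, of n m] by (auto simp: x_def)
    have "x powr (- 3 / 2) \<le> g m" "x powr (- 3 / 2) \<le> g n"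
      unfolding g_def using x by (auto intro!: powr_mono2')
    then have "x powr (- 3 / 2) * x powr (- 3 / 2) \<le> g m * g n"
      by (intro mult_mono) (auto simp: g_def)
    also have "x powr (- 3 / 2) * x powr (- 3 / 2) = 1 / x ^ 3"
    proof -
      have "x powr (- 3 / 2) * x powr (- 3 / 2) = x powr (- 3)" by (simp add: powr_add[symmetric])
      also have "\<dots> = 1 / x ^ 3" using x(1) by (simp add: powr_minus powr_numeral divide_inverse)
      finally show ?thesis .
    qed
    finally have "(2 * C) ^ 3 * (1 / x ^ 3) \<le> (2 * C) ^ 3 * (g m * g n)"
      using C(1) by (intro mult_left_mono) auto
    moreover have "(2 * C) ^ 3 * (1 / x ^ 3) = 1 / norm ?w ^ 3"
      using C(1) one by (simp add: x_def power_mult_distrib)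
    ultimately show "1 / norm (of_int (fst p) + of_int (snd p) * \<tau>) ^ 3 \<le> (2 * C) ^ 3 * (g (fst p) * g (snd p))"
      by (simp add: mn)
  qed simp
  also have "?this \<longleftrightarrow> ?thesis"
  proof (rule summable_on_reindex_bij_betw)
    have inj: "inj (\<lambda>p. of_int (fst p) + of_int (snd p) * \<tau>)"
      by (auto simp: inj_on_def lattice_eq_iff)
    have "(\<lambda>p. of_int (fst p) + of_int (snd p) * \<tau>) ` (UNIV - {(0, 0)}) =
       (\<lambda>p. of_int (fst p) + of_int (snd p) * \<tau>) ` UNIV - (\<lambda>p. of_int (fst p) + of_int (snd p) * \<tau>) ` {(0, 0)}"
      by (rule image_set_diff[OF inj])
    also have "(\<lambda>p. of_int (fst p) + of_int (snd p) * \<tau>) ` UNIV = lattice \<tau>"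
      by (force simp: lattice_def image_iff)
    also have "(\<lambda>p. of_int (fst p) + of_int (snd p) * \<tau>) ` {(0 :: int, 0 :: int)} = {0}" by simp
    finally show "bij_betw (\<lambda>p. of_int (fst p) + of_int (snd p) * \<tau>) (UNIV - {(0, 0)}) (lattice \<tau> - {0})"
      using inj_on_subset[OF inj] by (simp add: bij_betw_def)
  qed
  finally show ?thesis .
qed

lemma finite_lattice_cball: "finite {w \<in> lattice \<tau>. norm w \<le> r}"
proof -
  obtain C where C: "0 < C" "\<forall>m n. \<bar>real_of_int m\<bar> \<le> C * norm (of_int m + of_int n * \<tau>)"
    "\<forall>m n. \<bar>real_of_int n\<bar> \<le> C * norm (of_int m + of_int n * \<tau>)"
    by (rule lattice_norm_bound)
  define N where "N = \<lceil>C * r\<rceil>"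
  have "{w \<in> lattice \<tau>. norm w \<le> r} \<subseteq> (\<lambda>(m, n). of_int m + of_int n * \<tau>) ` ({-N..N} \<times> {-N..N})"
  proof
    fix w assume "w \<in> {w \<in> lattice \<tau>. norm w \<le> r}"
    then obtain m n where w: "w = of_int m + of_int n * \<tau>" "norm w \<le> r" by (auto elim: latticeE)
    have "C * norm w \<le> C * r" using w C(1) by simp
    then have "\<bar>real_of_int m\<bar> \<le> C * r" "\<bar>real_of_int n\<bar> \<le> C * r"
      using C(2)[rule_format, of m n] C(3)[rule_format, of n m] w(1) by auto
    then have "m \<in> {-N..N}" "n \<in> {-N..N}" unfolding N_def by (auto simp: abs_le_iff; linarith)+
    then show "w \<in> (\<lambda>(m, n). of_int m + of_int n * \<tau>) ` ({-N..N} \<times> {-N..N})"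
      using w(1) by auto
  qed
  then show ?thesis by (rule finite_subset) simp
qed

lemma lattice_discrete: "\<exists>e>0. \<forall>w\<in>lattice \<tau>. w \<noteq> z \<longrightarrow> e \<le> dist z w"
proof -
  have "finite {w \<in> lattice \<tau>. norm w \<le> norm z + 1}" by (rule finite_lattice_cball)
  from finite_set_avoid[OF this, of z] obtain d where
    d: "0 < d" "\<And>w. w \<in> lattice \<tau> \<Longrightarrow> norm w \<le> norm z + 1 \<Longrightarrow> w \<noteq> z \<Longrightarrow> d \<le> dist z w"
    by auto
  have "min d 1 \<le> dist z w" if "w \<in> lattice \<tau>" "w \<noteq> z" for w
  proof (cases "norm w \<le> norm z + 1")
    case False
    then have "1 \<le> dist z w" using norm_triangle_ineq2[of w z] by (simp add: dist_norm norm_minus_commute)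
    then show ?thesis by simp
  qed (use d(2) that in force)
  then show ?thesis using d(1) by (intro exI[of _ "min d 1"]) auto
qed

lemma closed_sublattice: "A \<subseteq> lattice \<tau> \<Longrightarrow> closed A"
proof -
  assume A: "A \<subseteq> lattice \<tau>"
  have "\<exists>e>0. ball z e \<subseteq> - A" if z: "z \<in> - A" for z
  proof -
    obtain e where e: "e > 0" "\<forall>w\<in>lattice \<tau>. w \<noteq> z \<longrightarrow> e \<le> dist z w"
      using lattice_discrete[of z] by blast
    have "ball z e \<subseteq> - A"
    proof
      fix w assume "w \<in> ball z e"
      then have "\<not> e \<le> dist z w" by simp
      then show "w \<in> - A" using e(2) A z by (cases "w = z") auto
    qed
    then show ?thesis using e(1) by blast
  qed
  then have "open (- A)" by (simp add: open_contains_ball)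
  then show ?thesis by (simp add: closed_def)
qed

text \<open>The Weierstrass function without its pole at 0, which makes the neighbourhood of 0
  accessible to the same differentiation argument.\<close>

definition wp_remainder :: "complex \<Rightarrow> complex" where
  "wp_remainder z = (\<Sum>\<^sub>\<infinity>w\<in>lattice \<tau> - {0}. 1 / (z - w) ^ 2 - 1 / w ^ 2)"

lemma wp_eq: "wp \<tau> z = 1 / z ^ 2 + wp_remainder z"
  by (simp add: wp_def wp_remainder_def)

text \<open>Finitely many lattice points lie within \<open>2 * r\<close> of the origin; the terms of
  the others are dominated by a convergent cubic sum on the disc of radius \<open>r\<close>. Their
  uniform limit may be differentiated term by term.\<close>

lemma wp_remainder_deriv:
  assumes z: "z \<notin> lattice \<tau> - {0}"
  obtains d where "(wp_remainder has_field_derivative d) (at z)"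
    "((\<lambda>w. - 2 / (z - w) ^ 3) has_sum d) (lattice \<tau> - {0})"
proof -
  define r where "r = norm z + 1"
  have r: "0 < r" by (simp add: r_def add_nonneg_pos)
  define S1 where "S1 = {w \<in> lattice \<tau> - {0}. norm w \<le> 2 * r}"
  define S2 where "S2 = (lattice \<tau> - {0}) - S1"
  have S: "lattice \<tau> - {0} = S1 \<union> S2" "S1 \<inter> S2 = {}" by (auto simp: S1_def S2_def)
  have fin: "finite S1" by (rule finite_subset[OF _ finite_lattice_cball[of "2 * r"]]) (auto simp: S1_def)
  have big: "2 * r < norm w" if "w \<in> S2" for w using that by (auto simp: S1_def S2_def)
  let ?t = "\<lambda>w z :: complex. 1 / (z - w) ^ 2 - 1 / w ^ 2"
  have bound: "norm (?t w y) \<le> 10 * r * (1 / norm w ^ 3)" if "w \<in> S2" "y \<in> cball 0 r" for w y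
    using wp_term_bound[of y r w] big[OF that(1)] that(2) r by auto
  have sumM: "(\<lambda>w. 10 * r * (1 / norm w ^ 3)) summable_on S2"
    by (intro summable_on_cmult_right summable_on_subset_banach[OF summable_lattice_cube]) (auto simp: S2_def)
  define g where "g y = (\<Sum>\<^sub>\<infinity>w\<in>S2. ?t w y)" for y
  have ulim: "uniform_limit (cball 0 r) (\<lambda>X y. \<Sum>w\<in>X. ?t w y) g (finite_subsets_at_top S2)"
    unfolding g_def using bound sumM by (rule Weierstrass_m_test_general)
  have summ: "(\<lambda>w. ?t w y) summable_on S2" if "y \<in> cball 0 r" for y
    by (rule abs_summable_summable, rule Infinite_Sum.abs_summable_on_comparison_test'[OF sumM]) (use bound that in auto)
  have ev: "eventually (\<lambda>X. continuous_on (cball 0 r) (\<lambda>y. \<Sum>w\<in>X. ?t w y) \<and>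
      (\<forall>y\<in>ball 0 r. ((\<lambda>y. \<Sum>w\<in>X. ?t w y) has_field_derivative (\<Sum>w\<in>X. - 2 / (y - w) ^ 3)) (at y)))
      (finite_subsets_at_top S2)"
  proof (rule eventually_finite_subsets_at_top_weakI)
    fix X assume X: "finite X" "X \<subseteq> S2"
    have ne: "y \<noteq> w" if "y \<in> cball 0 r" "w \<in> X" for y w
      using big[of w] X that r by auto
    have "continuous_on (cball 0 r) (\<lambda>y. \<Sum>w\<in>X. ?t w y)"
      using ne by (intro continuous_intros) auto
    moreover have "((\<lambda>y. \<Sum>w\<in>X. ?t w y) has_field_derivative (\<Sum>w\<in>X. - 2 / (y - w) ^ 3)) (at y)"
      if y: "y \<in> ball 0 r" for y
    proof (rule DERIV_sum)
      fix w assume "w \<in> X"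
      then have "y - w \<noteq> 0" using ne[of y w] y by auto
      then show "((\<lambda>y. ?t w y) has_field_derivative - 2 / (y - w) ^ 3) (at y)"
        by (rule inverse_square_deriv)
    qed
    ultimately show "continuous_on (cball 0 r) (\<lambda>y. \<Sum>w\<in>X. ?t w y) \<and>
      (\<forall>y\<in>ball 0 r. ((\<lambda>y. \<Sum>w\<in>X. ?t w y) has_field_derivative (\<Sum>w\<in>X. - 2 / (y - w) ^ 3)) (at y))"
      by blast
  qed
  obtain g' where g': "\<And>y. y \<in> ball 0 r \<Longrightarrow> (g has_field_derivative g' y) (at y) \<and>
      ((\<lambda>X. \<Sum>w\<in>X. - 2 / (y - w) ^ 3) \<longlongrightarrow> g' y) (finite_subsets_at_top S2)"
    by (rule has_complex_derivative_uniform_limit[OF ev ulim finite_subsets_at_top_neq_bot r]) blast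
  have zr: "z \<in> ball 0 r" by (simp add: r_def)
  have zS1: "z - w \<noteq> 0" if "w \<in> S1" for w using z that by (auto simp: S1_def)
  have D1: "((\<lambda>y. \<Sum>w\<in>S1. ?t w y) has_field_derivative (\<Sum>w\<in>S1. - 2 / (z - w) ^ 3)) (at z)"
  proof (rule DERIV_sum)
    fix w assume "w \<in> S1"
    then have "z - w \<noteq> 0" by (rule zS1)
    then show "((\<lambda>y. ?t w y) has_field_derivative - 2 / (z - w) ^ 3) (at z)"
      by (rule inverse_square_deriv)
  qed
  have eq: "(\<Sum>w\<in>S1. ?t w y) + g y = wp_remainder y" if "y \<in> ball 0 r" for y
  proof -
    have "wp_remainder y = infsum (\<lambda>w. ?t w y) S1 + infsum (\<lambda>w. ?t w y) S2"
      unfolding wp_remainder_def S(1) using fin summ[of y] that S(2)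
      by (intro infsum_Un_disjoint) auto
    then show ?thesis using fin by (simp add: g_def)
  qed
  have "((\<lambda>y. (\<Sum>w\<in>S1. ?t w y) + g y) has_field_derivative (\<Sum>w\<in>S1. - 2 / (z - w) ^ 3) + g' z) (at z)"
    using DERIV_add[OF D1] g'[OF zr] by blast
  then have 1: "(wp_remainder has_field_derivative (\<Sum>w\<in>S1. - 2 / (z - w) ^ 3) + g' z) (at z)"
    by (rule has_field_derivative_transform_within_open[OF _ open_ball zr eq])
  have "((\<lambda>w. - 2 / (z - w) ^ 3) has_sum g' z) S2"
    using g'[OF zr] by (simp add: has_sum_def)
  then have 2: "((\<lambda>w. - 2 / (z - w) ^ 3) has_sum ((\<Sum>w\<in>S1. - 2 / (z - w) ^ 3) + g' z)) (lattice \<tau> - {0})"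
    unfolding S(1) using fin S(2) by (intro has_sum_Un_disjoint) auto
  show ?thesis by (rule that[OF 1 2])
qed

text \<open>The derivative of the pole is the missing term at 0, so the derivative is a sum over the
  whole lattice. In this form a translation by a period is a mere reindexing.\<close>

lemma wp_deriv:
  assumes z: "z \<notin> lattice \<tau>"
  obtains d where "(wp \<tau> has_field_derivative d) (at z)"
    "((\<lambda>w. - 2 / (z - w) ^ 3) has_sum d) (lattice \<tau>)"
proof -
  have z0: "z \<noteq> 0" using z by auto
  obtain d where d: "(wp_remainder has_field_derivative d) (at z)"
    "((\<lambda>w. - 2 / (z - w) ^ 3) has_sum d) (lattice \<tau> - {0})"
    by (rule wp_remainder_deriv[of z]) (use z in auto)
  have "((\<lambda>z. 1 / z ^ 2) has_field_derivative - 2 / z ^ 3) (at z)"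
    using inverse_square_deriv[of z 0 0] z0 by simp
  from DERIV_add[OF this d(1)] have 1: "(wp \<tau> has_field_derivative - 2 / z ^ 3 + d) (at z)"
    by (simp add: wp_eq[abs_def])
  have "((\<lambda>w. - 2 / (z - w) ^ 3) has_sum - 2 / z ^ 3) {0}"
    using has_sum_finite[of "{0}" "\<lambda>w. - 2 / (z - w) ^ 3"] by simp
  from has_sum_Un_disjoint[OF this d(2)]
  have 2: "((\<lambda>w. - 2 / (z - w) ^ 3) has_sum - 2 / z ^ 3 + d) ({0} \<union> (lattice \<tau> - {0}))" by simp
  have "{0} \<union> (lattice \<tau> - {0}) = lattice \<tau>" by auto
  then show ?thesis using that[OF 1] 2 by simp
qed

lemma wp_holomorphic: "wp \<tau> holomorphic_on - lattice \<tau>"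
proof -
  have "open (- lattice \<tau>)" using closed_sublattice[of "lattice \<tau>"] by (simp add: open_Compl)
  then show ?thesis
    unfolding holomorphic_on_open[OF \<open>open (- lattice \<tau>)\<close>] by (auto elim: wp_deriv)
qed

lemma wp_even: "wp \<tau> (- z) = wp \<tau> z"
proof -
  have "wp_remainder (- z) = wp_remainder z"
    unfolding wp_remainder_def
    by (rule infsum_reindex_bij_witness[of _ uminus uminus])
      (auto simp: power2_commute power2_eq_square algebra_simps)
  then show ?thesis by (simp add: wp_eq)
qed

text \<open>The derivative is periodic, so \<open>wp \<tau> (z + p) - wp \<tau> z\<close> is
  constant on the connected complement of the lattice. Evenness shows that it vanishes at
  \<open>- (p / 2)\<close>, a point where the function is regular by assumption.\<close>

lemma wp_periodic_half:
  assumes p: "p \<in> lattice \<tau>" "p / 2 \<notin> lattice \<tau>" and z: "z \<notin> lattice \<tau>"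
  shows "wp \<tau> (z + p) = wp \<tau> z"
proof -
  have op: "open (- lattice \<tau>)" using closed_sublattice[of "lattice \<tau>"] by (simp add: open_Compl)
  have con: "connected (- lattice \<tau>)"
    by (rule path_connected_imp_connected, rule path_connected_complement_countable)
      (simp_all add: countable_lattice)
  have D: "((\<lambda>z. wp \<tau> (z + p) - wp \<tau> z) has_field_derivative 0) (at y)" if y: "y \<notin> lattice \<tau>" for y
  proof -
    have yp: "y + p \<notin> lattice \<tau>" using y lattice_add_iff[OF p(1)] by simp
    obtain d where d: "(wp \<tau> has_field_derivative d) (at y)" "((\<lambda>w. - 2 / (y - w) ^ 3) has_sum d) (lattice \<tau>)"
      by (rule wp_deriv[OF y])
    obtain d' where d': "(wp \<tau> has_field_derivative d') (at (y + p))"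
        "((\<lambda>w. - 2 / (y + p - w) ^ 3) has_sum d') (lattice \<tau>)"
      by (rule wp_deriv[OF yp])
    have "((\<lambda>w. - 2 / (y - w) ^ 3) has_sum d) (lattice \<tau>) \<longleftrightarrow> ((\<lambda>w. - 2 / (y + p - w) ^ 3) has_sum d) (lattice \<tau>)"
      by (rule has_sum_reindex_bij_witness[of _ "\<lambda>w. w - p" "\<lambda>w. w + p"])
        (use p(1) in \<open>auto intro: lattice_add lattice_diff\<close>)
    then have "d = d'" using d(2) d'(2) has_sum_unique by blast
    have "((\<lambda>z. wp \<tau> (z + p)) has_field_derivative d') (at y)"
      using d'(1) by (simp add: DERIV_shift)
    from DERIV_diff[OF this d(1)] show ?thesis using \<open>d = d'\<close> by simp
  qed
  have "continuous_on (- lattice \<tau>) (\<lambda>z. wp \<tau> (z + p) - wp \<tau> z)"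
    by (rule DERIV_continuous_on, rule has_field_derivative_at_within, rule D) simp
  from DERIV_zero_connected_constant[OF con op finite.emptyI this] D
  obtain c where c: "\<And>y. y \<in> - lattice \<tau> \<Longrightarrow> wp \<tau> (y + p) - wp \<tau> y = c" by auto
  have "wp \<tau> (- (p / 2) + p) - wp \<tau> (- (p / 2)) = c" using p(2) by (intro c) simp
  moreover have "- (p / 2) + p = p / 2" by simp
  ultimately have "c = 0" using wp_even[of "p / 2"] by simp
  then show ?thesis using c[of z] z by simp
qed

text \<open>The generators 1 and \<open>\<tau>\<close> satisfy the condition on halves, and every
  period is reached from them step by step.\<close>

lemma wp_periodic:
  assumes p: "p \<in> lattice \<tau>" and z: "z \<notin> lattice \<tau>"
  shows "wp \<tau> (z + p) = wp \<tau> z"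
proof -
  have half: "1 / 2 \<notin> lattice \<tau>" "\<tau> / 2 \<notin> lattice \<tau>"
  proof -
    show "1 / 2 \<notin> lattice \<tau>"
    proof
      assume "1 / 2 \<in> lattice \<tau>"
      then obtain m n where "1 / 2 = of_int m + of_int n * \<tau>" by (rule latticeE)
      then have "of_int 1 + of_int 0 * \<tau> = of_int (2 * m) + of_int (2 * n) * \<tau>" by (simp add: field_simps)
      then have "1 = 2 * m" unfolding lattice_eq_iff by simp
      then show False by presburger
    qed
    show "\<tau> / 2 \<notin> lattice \<tau>"
    proof
      assume "\<tau> / 2 \<in> lattice \<tau>"
      then obtain m n where "\<tau> / 2 = of_int m + of_int n * \<tau>" by (rule latticeE)
      then have "of_int 0 + of_int 1 * \<tau> = of_int (2 * m) + of_int (2 * n) * \<tau>" by (simp add: field_simps)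
      then have "1 = 2 * n" unfolding lattice_eq_iff by simp
      then show False by presburger
    qed
  qed
  have step: "wp \<tau> (z + of_int k * q) = wp \<tau> z" if q: "q \<in> lattice \<tau>" "q / 2 \<notin> lattice \<tau>" and z: "z \<notin> lattice \<tau>" for k q z
  proof (induction k rule: int_induct[where k = 0])
    case (step1 k)
    have "of_int k * q \<in> lattice \<tau>"
      by (rule lattice_of_int_mult[OF q(1)])
    then have "z + of_int k * q \<notin> lattice \<tau>" using z lattice_add_iff by blast
    from wp_periodic_half[OF q this] step1 show ?case by (simp add: algebra_simps)
  next
    case (step2 k)
    have "of_int (k - 1) * q \<in> lattice \<tau>"
      by (rule lattice_of_int_mult[OF q(1)])
    then have "z + of_int (k - 1) * q \<notin> lattice \<tau>" using z lattice_add_iff by blast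
    from wp_periodic_half[OF q this] step2 show ?case by (simp add: algebra_simps)
  qed simp
  obtain m n where mn: "p = of_int m + of_int n * \<tau>" using p by (rule latticeE)
  have "z + of_int m * 1 \<notin> lattice \<tau>" using z lattice_add_iff[of "of_int m" \<tau> z] latticeI[of m 0 \<tau>] by simp
  from step[OF _ half(2) this, of n] step[OF _ half(1) z, of m] show ?thesis
    by (simp add: mn algebra_simps)
qed

lemma wp_pole_0: "((\<lambda>z. z ^ 2 * wp \<tau> z) \<longlongrightarrow> 1) (at 0)"
proof -
  obtain d where "(wp_remainder has_field_derivative d) (at 0)"
    by (rule wp_remainder_deriv[of 0]) auto
  then have "isCont wp_remainder 0" by (rule DERIV_isCont)
  then have "((\<lambda>z. 1 + z ^ 2 * wp_remainder z) \<longlongrightarrow> 1 + 0 ^ 2 * wp_remainder 0) (at 0)"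
    unfolding isCont_def by (intro tendsto_intros)
  then have "((\<lambda>z. 1 + z ^ 2 * wp_remainder z) \<longlongrightarrow> 1) (at 0)" by simp
  then show ?thesis
    by (rule tendsto_cong[THEN iffD1, rotated])
      (auto simp: eventually_at_filter wp_eq field_simps intro!: always_eventually)
qed

end

section \<open>The theta function\<close>

definition expi :: "complex \<Rightarrow> complex" where
  "expi z = exp (2 * of_real pi * \<i> * z)"

lemma expi_add: "expi (x + y) = expi x * expi y"
  by (simp add: expi_def distrib_left exp_add)

lemma expi_nonzero [simp]: "expi x \<noteq> 0"
  by (simp add: expi_def)

lemma expi_minus: "expi (- x) = inverse (expi x)"
  by (simp add: expi_def exp_minus)

lemma expi_diff: "expi (x - y) = expi x * inverse (expi y)"
  using expi_add[of x "- y"] by (simp add: expi_minus)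

lemma expi_of_int [simp]: "expi (of_int k) = 1"
proof -
  have "exp (2 * of_real pi * \<i> * of_int k) = 1"
    unfolding exp_eq_1 by (auto intro!: exI[of _ k])
  then show ?thesis by (simp add: expi_def)
qed

lemma expi_1 [simp]: "expi 1 = 1" and expi_0 [simp]: "expi 0 = 1"
  using expi_of_int[of 1] expi_of_int[of 0] by simp_all

lemma expi_eq_1_iff: "expi x = 1 \<longleftrightarrow> (\<exists>k. x = of_int k)"
proof
  assume "expi x = 1"
  then obtain n :: int where n: "Im x = 0" "2 * pi * Re x = of_int (2 * n) * pi"
    unfolding expi_def exp_eq_1 by auto
  then have "x = of_int n" by (simp add: complex_eq_iff)
  then show "\<exists>k. x = of_int k" by blast
qed auto

lemma expi_power: "expi x ^ k = expi (of_nat k * x)"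
  by (induction k) (simp_all add: expi_add distrib_right)

lemma norm_expi: "norm (expi z) = exp (- 2 * pi * Im z)"
  by (simp add: expi_def)

context
  fixes \<tau> :: complex assumes tau: "0 < Im \<tau>"
begin

definition theta_factor :: "nat \<Rightarrow> complex \<Rightarrow> complex" where
  "theta_factor n z = (1 - expi \<tau> ^ Suc n * expi z) * (1 - expi \<tau> ^ Suc n * expi (- z))"

definition theta_prod :: "complex \<Rightarrow> complex" where
  "theta_prod z = (\<Prod>n. theta_factor n z)"

text \<open>Up to a factor independent of \<open>z\<close> this is the first Jacobi theta function
  in product form, with squared nome \<open>expi \<tau>\<close>; the two leading factors amount to a
  multiple of the sine of \<open>pi * z\<close>. The product exhibits the zeros.\<close>

definition theta :: "complex \<Rightarrow> complex" where
  "theta z = expi (- z / 2) * (1 - expi z) * theta_prod z"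

lemma norm_expi_tau: "norm (expi \<tau>) < 1"
  using tau by (simp add: norm_expi)

lemma theta_factor_bound:
  assumes "norm z \<le> R"
  shows "norm (theta_factor n z - 1) \<le> (2 * exp (2 * pi * R) + 1) * norm (expi \<tau>) ^ n"
proof -
  let ?M = "exp (2 * pi * R)" and ?q = "norm (expi \<tau>)"
  have b: "norm (expi y) \<le> ?M" if "norm y \<le> R" for y
  proof -
    have "- Im y \<le> R" using that abs_Im_le_cmod[of y] by linarith
    then have "pi * - Im y \<le> pi * R" by (intro mult_left_mono) auto
    then show ?thesis by (simp add: norm_expi mult.commute)
  qed
  have q: "0 \<le> ?q" "?q \<le> 1" using norm_expi_tau by auto
  have qs: "?q ^ Suc n \<le> ?q ^ n" "?q ^ Suc n * ?q ^ Suc n \<le> ?q ^ n"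
  proof -
    show 1: "?q ^ Suc n \<le> ?q ^ n" using q by (intro power_decreasing) auto
    have "?q ^ Suc n * ?q ^ Suc n \<le> ?q ^ n * 1"
      using 1 q by (intro mult_mono power_le_one) auto
    then show "?q ^ Suc n * ?q ^ Suc n \<le> ?q ^ n" by simp
  qed
  have "theta_factor n z - 1 = - (expi \<tau> ^ Suc n * expi z) - expi \<tau> ^ Suc n * expi (- z)
      + expi \<tau> ^ Suc n * expi \<tau> ^ Suc n"
    unfolding theta_factor_def by (simp add: algebra_simps expi_minus)
  also have "norm \<dots> \<le> norm (expi \<tau> ^ Suc n * expi z) + norm (expi \<tau> ^ Suc n * expi (- z))
      + norm (expi \<tau> ^ Suc n * expi \<tau> ^ Suc n)"
    by (intro norm_triangle_le add_right_mono norm_triangle_le_diff) simp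
  also have "\<dots> = ?q ^ Suc n * norm (expi z) + ?q ^ Suc n * norm (expi (- z)) + ?q ^ Suc n * ?q ^ Suc n"
    by (simp add: norm_mult norm_power)
  also have "\<dots> \<le> ?q ^ n * ?M + ?q ^ n * ?M + ?q ^ n"
    using b[of z] b[of "- z"] assms qs q by (intro add_mono mult_mono) auto
  also have "\<dots> = (2 * ?M + 1) * ?q ^ n" by (simp add: algebra_simps)
  finally show ?thesis .
qed

lemma summable_theta_bound: "summable (\<lambda>n. c * norm (expi \<tau>) ^ n)"
  using norm_expi_tau by (intro summable_mult summable_geometric) simp

lemma convergent_theta: "convergent_prod (\<lambda>n. theta_factor n z)"
proof (rule abs_convergent_prod_imp_convergent_prod)
  have "summable (\<lambda>n. norm (theta_factor n z - 1))"
    by (rule summable_comparison_test'[OF summable_theta_bound[of "2 * exp (2 * pi * norm z) + 1"]])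
      (use theta_factor_bound[of z "norm z"] in auto)
  then show "abs_convergent_prod (\<lambda>n. theta_factor n z)"
    by (simp add: abs_convergent_prod_conv_summable)
qed

lemma theta_prod_LIMSEQ: "(\<lambda>N. \<Prod>n<N. theta_factor n z) \<longlonglongrightarrow> theta_prod z"
proof -
  have "(\<lambda>N. \<Prod>n<Suc N. theta_factor n z) \<longlonglongrightarrow> theta_prod z"
    using convergent_prod_LIMSEQ[OF convergent_theta[of z]]
    by (simp add: theta_prod_def lessThan_Suc_atMost)
  then show ?thesis by (rule filterlim_sequentially_Suc[THEN iffD1])
qed

lemma theta_factor_holomorphic: "theta_factor n holomorphic_on A"
  unfolding theta_factor_def expi_def by (intro holomorphic_intros)

lemma theta_prod_holomorphic: "theta_prod holomorphic_on UNIV"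
proof (rule holomorphic_uniform_sequence[OF open_UNIV])
  show "(\<lambda>z. \<Prod>n<N. theta_factor n z) holomorphic_on UNIV" for N
    by (intro holomorphic_intros theta_factor_holomorphic)
  fix x :: complex
  have "uniformly_convergent_on (cball x 1) (\<lambda>N z. \<Prod>n<N. theta_factor n z)"
  proof (rule uniformly_convergent_on_prod')
    show "continuous_on (cball x 1) (theta_factor n)" for n
      using theta_factor_holomorphic by (rule holomorphic_on_imp_continuous_on)
    show "uniformly_convergent_on (cball x 1) (\<lambda>N z. \<Sum>n<N. norm (theta_factor n z - 1))"
    proof (rule Weierstrass_m_test'[OF _ summable_theta_bound])
      fix n z assume "z \<in> cball x 1"
      then have "norm z \<le> norm x + 1"
        using norm_triangle_ineq2[of z x] by (simp add: dist_norm norm_minus_commute)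
      from theta_factor_bound[OF this, of n]
      show "norm (norm (theta_factor n z - 1)) \<le> (2 * exp (2 * pi * (norm x + 1)) + 1) * norm (expi \<tau>) ^ n"
        by simp
    qed
  qed simp
  then have "uniform_limit (cball x 1) (\<lambda>N z. \<Prod>n<N. theta_factor n z) (\<lambda>z. lim (\<lambda>N. \<Prod>n<N. theta_factor n z)) sequentially"
    by (simp add: uniformly_convergent_uniform_limit_iff)
  moreover have "lim (\<lambda>N. \<Prod>n<N. theta_factor n z) = theta_prod z" for z
    using theta_prod_LIMSEQ by (rule limI)
  ultimately show "\<exists>d. 0 < d \<and> cball x d \<subseteq> UNIV \<and> uniform_limit (cball x d) (\<lambda>N z. \<Prod>n<N. theta_factor n z) theta_prod sequentially"
    by (intro exI[of _ 1]) simp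
qed

lemma theta_holomorphic: "theta holomorphic_on A"
proof -
  have "theta holomorphic_on UNIV"
    unfolding theta_def[abs_def] expi_def by (intro holomorphic_intros theta_prod_holomorphic) auto
  then show ?thesis by (rule holomorphic_on_subset) simp
qed

lemma theta_prod_zero:
  assumes "theta_prod z = 0" obtains n where "theta_factor n z = 0"
  using prodinf_nonzero[OF convergent_theta[of z]] assms unfolding theta_prod_def by blast

lemma theta_zero_imp:
  assumes "theta z = 0" shows "z \<in> lattice \<tau>"
proof -
  consider "expi z = 1" | "theta_prod z = 0" using assms by (auto simp: theta_def)
  then show ?thesis
  proof cases
    case 1
    then obtain k where "z = of_int k" unfolding expi_eq_1_iff by blast
    then show ?thesis using latticeI[of k 0 \<tau>] by simp
  next
    case 2
    then obtain n where "theta_factor n z = 0" by (rule theta_prod_zero)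
    then have "expi \<tau> ^ Suc n * expi z = 1 \<or> expi \<tau> ^ Suc n * expi (- z) = 1"
      by (auto simp: theta_factor_def)
    then have "expi (of_nat (Suc n) * \<tau> + z) = 1 \<or> expi (of_nat (Suc n) * \<tau> - z) = 1"
      unfolding expi_power expi_add[symmetric] by simp
    then obtain k where "of_nat (Suc n) * \<tau> + z = of_int k \<or> of_nat (Suc n) * \<tau> - z = of_int k"
      unfolding expi_eq_1_iff by blast
    then have "z = of_int k + of_int (- int (Suc n)) * \<tau> \<or> z = of_int (- k) + of_int (int (Suc n)) * \<tau>"
      by (auto simp: algebra_simps)
    then show ?thesis using latticeI by metis
  qed
qed

lemma theta_0 [simp]: "theta 0 = 0"
  by (simp add: theta_def)

lemma theta_odd: "theta (- z) = - theta z"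
proof -
  have "theta_prod (- z) = theta_prod z"
    unfolding theta_prod_def theta_factor_def by (simp add: mult.commute)
  moreover have "expi (z / 2) * expi (- z) = expi (- z / 2)"
    by (simp add: expi_add[symmetric])
  moreover have "expi (- z / 2) * expi z = expi (z / 2)"
    by (simp add: expi_add[symmetric])
  ultimately show ?thesis
    by (simp add: theta_def algebra_simps)
qed

lemma theta_add_1: "theta (z + 1) = - theta z"
proof -
  have "expi (- (z + 1) / 2) = - expi (- z / 2)"
  proof -
    have "expi (- (1 / 2)) = - 1"
      using exp_pi_i by (simp add: expi_def exp_minus)
    moreover have "- (z + 1) / 2 = - z / 2 + - (1 / 2)" by (simp add: field_simps)
    ultimately show ?thesis by (simp only: expi_add) simp
  qed
  moreover have "expi (z + 1) = expi z" by (simp add: expi_add)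
  moreover have "theta_prod (z + 1) = theta_prod z"
    unfolding theta_prod_def theta_factor_def by (simp add: expi_add expi_minus expi_diff)
  ultimately show ?thesis by (simp add: theta_def)
qed

text \<open>Translation by \<open>\<tau>\<close> moves each half of a factor to a neighbouring
  index. For finite products only the boundary terms change, and these tend to 1. Multiplication by
  \<open>expi z\<close> avoids a quotient that would be undefined at integers.\<close>

lemma theta_prod_add_tau:
  "(1 - expi (z + \<tau>)) * theta_prod (z + \<tau>) * expi z = - ((1 - expi z) * theta_prod z)"
proof -
  let ?q = "expi \<tau>" and ?w = "expi z"
  have fin: "(1 - expi (z + \<tau>)) * (\<Prod>n<N. theta_factor n (z + \<tau>)) * (1 - ?q ^ N * expi (- z)) * ?w
     = - ((1 - ?w) * (\<Prod>n<N. theta_factor n z) * (1 - ?q ^ Suc N * ?w))" for N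
  proof (induction N)
    case 0
    show ?case by (simp add: expi_add expi_minus algebra_simps)
  next
    case (Suc N)
    have f: "theta_factor N (z + \<tau>) = (1 - ?q ^ Suc (Suc N) * ?w) * (1 - ?q ^ N * expi (- z))"
      by (simp add: theta_factor_def expi_add expi_minus expi_diff mult_ac)
    have g: "theta_factor N z = (1 - ?q ^ Suc N * ?w) * (1 - ?q ^ Suc N * expi (- z))"
      by (simp add: theta_factor_def)
    have "(1 - expi (z + \<tau>)) * (\<Prod>n<Suc N. theta_factor n (z + \<tau>)) * (1 - ?q ^ Suc N * expi (- z)) * ?w =
        ((1 - expi (z + \<tau>)) * (\<Prod>n<N. theta_factor n (z + \<tau>)) * (1 - ?q ^ N * expi (- z)) * ?w) *
        ((1 - ?q ^ Suc (Suc N) * ?w) * (1 - ?q ^ Suc N * expi (- z)))"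
      by (simp only: prod.lessThan_Suc f mult_ac)
    also have "\<dots> = - ((1 - ?w) * (\<Prod>n<N. theta_factor n z) * (1 - ?q ^ Suc N * ?w)) *
        ((1 - ?q ^ Suc (Suc N) * ?w) * (1 - ?q ^ Suc N * expi (- z)))"
      by (simp only: Suc.IH)
    also have "\<dots> = - ((1 - ?w) * (\<Prod>n<Suc N. theta_factor n z) * (1 - ?q ^ Suc (Suc N) * ?w))"
      by (simp only: prod.lessThan_Suc g mult_ac mult_minus_left mult_minus_right)
    finally show ?case .
  qed
  have q0: "(\<lambda>N. ?q ^ N) \<longlonglongrightarrow> 0" by (rule LIMSEQ_power_zero[OF norm_expi_tau])
  have q1: "(\<lambda>N. ?q ^ Suc N) \<longlonglongrightarrow> 0" using q0 by (rule LIMSEQ_Suc)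
  have "(\<lambda>N. (1 - expi (z + \<tau>)) * (\<Prod>n<N. theta_factor n (z + \<tau>)) * (1 - ?q ^ N * expi (- z)) * ?w)
      \<longlonglongrightarrow> (1 - expi (z + \<tau>)) * theta_prod (z + \<tau>) * (1 - 0 * expi (- z)) * ?w"
    by (intro tendsto_intros theta_prod_LIMSEQ q0)
  moreover have "(\<lambda>N. - ((1 - ?w) * (\<Prod>n<N. theta_factor n z) * (1 - ?q ^ Suc N * ?w)))
      \<longlonglongrightarrow> - ((1 - ?w) * theta_prod z * (1 - 0 * ?w))"
    by (intro tendsto_intros theta_prod_LIMSEQ q1)
  ultimately show ?thesis
    unfolding fin using LIMSEQ_unique by fastforce
qed

lemma theta_add_tau: "theta (z + \<tau>) = - expi (- \<tau> / 2) * expi (- z) * theta z"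
proof -
  have "theta (z + \<tau>) = expi (- z / 2) * expi (- \<tau> / 2) * expi (- z) * ((1 - expi (z + \<tau>)) * theta_prod (z + \<tau>) * expi z)"
  proof -
    have "- (z + \<tau>) / 2 = - z / 2 + - \<tau> / 2" by (simp add: field_simps)
    then have "expi (- (z + \<tau>) / 2) = expi (- z / 2) * expi (- \<tau> / 2)" by (simp only: expi_add)
    moreover have "expi (- z) * expi z = 1" by (simp add: expi_minus)
    ultimately show ?thesis by (simp add: theta_def mult_ac)
  qed
  also have "\<dots> = - expi (- \<tau> / 2) * expi (- z) * theta z"
    unfolding theta_prod_add_tau by (simp add: theta_def mult_ac)
  finally show ?thesis .
qed

text \<open>Only the dependence on \<open>z\<close> matters later: \<open>c\<close> is the same for
  \<open>Q\<close> and \<open>- Q\<close> and cancels from their quotient, while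
  \<open>expi (- of_int b * z)\<close> produces the root of unity.\<close>

lemma theta_quasi_period:
  obtains c where "c \<noteq> 0" "\<forall>z. theta (z + (of_int a + of_int b * \<tau>)) = c * expi (- of_int b * z) * theta z"
proof -
  have tau_step: "\<exists>c. c \<noteq> 0 \<and> (\<forall>z. theta (z + of_int b * \<tau>) = c * expi (- of_int b * z) * theta z)" for b
  proof (induction b rule: int_induct[where k = 0])
    case base
    show ?case by (intro exI[of _ 1]) simp
  next
    case (step1 b)
    then obtain c where c: "c \<noteq> 0" "\<And>z. theta (z + of_int b * \<tau>) = c * expi (- of_int b * z) * theta z" by blast
    have "theta (z + of_int (b + 1) * \<tau>) = (c * (- expi (- \<tau> / 2)) * expi (- of_int b * \<tau>)) * expi (- of_int (b + 1) * z) * theta z" for z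
    proof -
      have "theta (z + of_int (b + 1) * \<tau>) = theta ((z + \<tau>) + of_int b * \<tau>)" by (simp add: algebra_simps)
      also have "\<dots> = c * expi (- of_int b * (z + \<tau>)) * (- expi (- \<tau> / 2) * expi (- z) * theta z)"
        by (simp only: c(2) theta_add_tau)
      also have "expi (- of_int b * (z + \<tau>)) = expi (- of_int b * z) * expi (- of_int b * \<tau>)"
        by (simp add: expi_add[symmetric] algebra_simps)
      also have "c * (expi (- of_int b * z) * expi (- of_int b * \<tau>)) * (- expi (- \<tau> / 2) * expi (- z) * theta z) =
          (c * (- expi (- \<tau> / 2)) * expi (- of_int b * \<tau>)) * (expi (- of_int b * z) * expi (- z)) * theta z"
        by (simp only: mult_ac)
      also have "expi (- of_int b * z) * expi (- z) = expi (- of_int (b + 1) * z)"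
        by (simp add: expi_add[symmetric] algebra_simps)
      finally show ?thesis .
    qed
    then show ?case using c(1) by (intro exI[of _ "c * (- expi (- \<tau> / 2)) * expi (- of_int b * \<tau>)"]) auto
  next
    case (step2 b)
    then obtain c where c: "c \<noteq> 0" "\<And>z. theta (z + of_int b * \<tau>) = c * expi (- of_int b * z) * theta z" by blast
    let ?k = "c * (- expi (\<tau> / 2)) * inverse (expi \<tau>) * expi (of_int b * \<tau>)"
    have "theta (z + of_int (b - 1) * \<tau>) = ?k * expi (- of_int (b - 1) * z) * theta z" for z
    proof -
      have A: "theta z = - expi (- \<tau> / 2) * expi (- (z - \<tau>)) * theta (z - \<tau>)"
        using theta_add_tau[of "z - \<tau>"] by simp
      have "- expi (\<tau> / 2) * expi (z - \<tau>) * theta z =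
          (expi (\<tau> / 2) * expi (- \<tau> / 2)) * (expi (z - \<tau>) * expi (- (z - \<tau>))) * theta (z - \<tau>)"
        unfolding A by (simp only: mult_ac mult_minus_left mult_minus_right minus_minus)
      also have "\<dots> = theta (z - \<tau>)"
        unfolding expi_add[symmetric] by simp
      finally have prev: "theta (z - \<tau>) = - expi (\<tau> / 2) * expi (z - \<tau>) * theta z" by simp
      have "theta (z + of_int (b - 1) * \<tau>) = theta ((z - \<tau>) + of_int b * \<tau>)" by (simp add: algebra_simps)
      also have "\<dots> = c * expi (- of_int b * (z - \<tau>)) * (- expi (\<tau> / 2) * expi (z - \<tau>) * theta z)"
        by (simp only: c(2) prev)
      also have "expi (- of_int b * (z - \<tau>)) = expi (- of_int b * z) * expi (of_int b * \<tau>)"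
        by (simp add: expi_add[symmetric] algebra_simps)
      also have "expi (z - \<tau>) = expi z * inverse (expi \<tau>)"
        by (simp add: expi_add[symmetric] expi_minus[symmetric])
      also have "c * (expi (- of_int b * z) * expi (of_int b * \<tau>)) * (- expi (\<tau> / 2) * (expi z * inverse (expi \<tau>)) * theta z) =
          ?k * (expi (- of_int b * z) * expi z) * theta z"
        by (simp only: mult_ac)
      also have "expi (- of_int b * z) * expi z = expi (- of_int (b - 1) * z)"
        by (simp add: expi_add[symmetric] algebra_simps)
      finally show ?thesis .
    qed
    then show ?case using c(1) by (intro exI[of _ ?k]) auto
  qed
  have one_step: "\<exists>s. s \<noteq> 0 \<and> (\<forall>z. theta (z + of_int a) = s * theta z)" for a
  proof (induction a rule: int_induct[where k = 0])
    case base
    show ?case by (intro exI[of _ 1]) simp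
  next
    case (step1 a)
    then obtain s where s: "s \<noteq> 0" "\<And>z. theta (z + of_int a) = s * theta z" by blast
    have "theta (z + of_int (a + 1)) = - s * theta z" for z
      using theta_add_1[of "z + of_int a"] s(2)[of z] by (simp add: algebra_simps)
    then show ?case using s(1) by (intro exI[of _ "- s"]) auto
  next
    case (step2 a)
    then obtain s where s: "s \<noteq> 0" "\<And>z. theta (z + of_int a) = s * theta z" by blast
    have "theta (z + of_int (a - 1)) = - s * theta z" for z
      using theta_add_1[of "z + of_int (a - 1)"] s(2)[of z] by (simp add: algebra_simps)
    then show ?case using s(1) by (intro exI[of _ "- s"]) auto
  qed
  obtain c where c: "c \<noteq> 0" "\<And>z. theta (z + of_int b * \<tau>) = c * expi (- of_int b * z) * theta z"
    using tau_step[of b] by blast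
  obtain s where s: "s \<noteq> 0" "\<And>z. theta (z + of_int a) = s * theta z"
    using one_step[of a] by blast
  have "theta (z + (of_int a + of_int b * \<tau>)) = (s * c) * expi (- of_int b * z) * theta z" for z
    using s(2)[of "z + of_int b * \<tau>"] c(2)[of z] by (simp add: algebra_simps)
  then show ?thesis using that[of "s * c"] c(1) s(1) by auto
qed

lemma theta_zero_iff: "theta z = 0 \<longleftrightarrow> z \<in> lattice \<tau>"
proof
  assume "z \<in> lattice \<tau>"
  then obtain a b where z: "z = of_int a + of_int b * \<tau>" by (rule latticeE)
  obtain c where "\<forall>y. theta (y + (of_int a + of_int b * \<tau>)) = c * expi (- of_int b * y) * theta y"
    by (rule theta_quasi_period)
  then have "theta (0 + z) = 0" unfolding z using theta_0 by (metis mult_zero_right)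
  then show "theta z = 0" by simp
qed (rule theta_zero_imp)

text \<open>The zero at the origin is simple, because the infinite product does not vanish
  there.\<close>

lemma theta_deriv_0:
  obtains D where "D \<noteq> 0" "((\<lambda>z. theta z / z) \<longlongrightarrow> D) (at 0)"
proof -
  have "theta_prod field_differentiable (at 0)"
    using theta_prod_holomorphic by (simp add: holomorphic_on_def)
  then obtain P' where P': "(theta_prod has_field_derivative P') (at 0)"
    by (auto simp: field_differentiable_def)
  have "((\<lambda>z. expi (- z / 2) * (1 - expi z)) has_field_derivative - (2 * of_real pi * \<i>)) (at 0)"
    unfolding expi_def by (auto intro!: derivative_eq_intros)
  from DERIV_mult[OF this P'] have "(theta has_field_derivative - (2 * of_real pi * \<i>) * theta_prod 0) (at 0)"
    by (simp add: theta_def[abs_def])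
  then have lim: "((\<lambda>z. theta z / z) \<longlongrightarrow> - (2 * of_real pi * \<i>) * theta_prod 0) (at 0)"
    by (simp add: has_field_derivative_iff)
  have "theta_prod 0 \<noteq> 0"
  proof
    assume "theta_prod 0 = 0"
    then obtain n where "theta_factor n 0 = 0" by (rule theta_prod_zero)
    then have "expi \<tau> ^ Suc n = 1" by (simp add: theta_factor_def)
    then have "norm (expi \<tau>) ^ Suc n = 1" by (metis norm_one norm_power)
    moreover have "norm (expi \<tau>) ^ Suc n < 1" using norm_expi_tau by (intro power_less_one_iff[THEN iffD2]) auto
    ultimately show False by simp
  qed
  then show ?thesis using that[OF _ lim] by simp
qed

end

section \<open>Elliptic functions without poles and the factorization of differences of
  \<open>wp\<close>\<close>

lemma Lim_shift: "((\<lambda>z. f (z - p)) \<longlongrightarrow> l) (at (a + p)) \<longleftrightarrow> (f \<longlongrightarrow> l) (at (a :: complex))"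
proof -
  have "((\<lambda>z. f (z - p)) \<longlongrightarrow> l) (at (a + p)) \<longleftrightarrow> ((\<lambda>z. f (z + p - p)) \<longlongrightarrow> l) (at a)"
    using LIM_offset_zero_iff[of "a + p" "\<lambda>z. f (z - p)" l] LIM_offset_zero_iff[of a f l]
    by (simp add: algebra_simps)
  then show ?thesis by simp
qed

context
  fixes \<tau> :: complex assumes tau: "0 < Im \<tau>"
begin

lemma lattice_reduce: "\<exists>p\<in>lattice \<tau>. norm (z - p) \<le> 1 + norm \<tau>"
proof -
  define y where "y = Im z / Im \<tau>"
  define x where "x = Re (z - of_real y * \<tau>)"
  have z: "z = of_real x + of_real y * \<tau>"
    using tau by (simp add: complex_eq_iff x_def y_def)
  let ?p = "of_int \<lfloor>x\<rfloor> + of_int \<lfloor>y\<rfloor> * \<tau>"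
  have "z - ?p = of_real (x - of_int \<lfloor>x\<rfloor>) + of_real (y - of_int \<lfloor>y\<rfloor>) * \<tau>"
    by (subst z) (simp add: algebra_simps)
  also have "norm \<dots> \<le> norm (of_real (x - of_int \<lfloor>x\<rfloor>) :: complex) + norm (of_real (y - of_int \<lfloor>y\<rfloor>) * \<tau>)"
    by (rule norm_triangle_ineq)
  also have "\<dots> = \<bar>x - of_int \<lfloor>x\<rfloor>\<bar> + \<bar>y - of_int \<lfloor>y\<rfloor>\<bar> * norm \<tau>"
    by (simp only: norm_mult norm_of_real)
  also have "\<dots> \<le> 1 + 1 * norm \<tau>"
    by (intro add_mono mult_right_mono) (auto; linarith)+
  finally show ?thesis using latticeI[of "\<lfloor>x\<rfloor>" "\<lfloor>y\<rfloor>" \<tau>] by auto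
qed

text \<open>After removal of the singularities the function is entire, bounded on a compact set that
  meets every class of the lattice, and so bounded everywhere; Liouville applies. Periodicity
  reduces the existence of limits to one representative of each singular class.\<close>

lemma elliptic_constant:
  assumes disc: "\<And>z. \<exists>e>0. \<forall>s\<in>S. s \<noteq> z \<longrightarrow> e \<le> dist z s"
    and S: "\<And>s p. s \<in> S \<Longrightarrow> p \<in> lattice \<tau> \<Longrightarrow> s + p \<in> S"
    and hol: "h holomorphic_on - S"
    and per: "\<And>z p. z \<notin> S \<Longrightarrow> p \<in> lattice \<tau> \<Longrightarrow> h (z + p) = h z"
    and lim: "\<And>s. s \<in> S \<Longrightarrow> \<exists>p\<in>lattice \<tau>. \<exists>L. (h \<longlongrightarrow> L) (at (s + p))"
  shows "\<exists>c. \<forall>z. z \<notin> S \<longrightarrow> h z = c"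
proof -
  have evS: "eventually (\<lambda>w. w \<notin> S) (at z)" for z
  proof -
    obtain e where e: "e > 0" "\<forall>s\<in>S. s \<noteq> z \<longrightarrow> e \<le> dist z s" using disc[of z] by blast
    show ?thesis unfolding eventually_at using e by (intro exI[of _ e]) (auto simp: dist_commute)
  qed
  have openS: "open (- S)"
  proof -
    have "\<exists>e>0. ball z e \<subseteq> - S" if z: "z \<in> - S" for z
    proof -
      obtain e where e: "e > 0" "\<forall>s\<in>S. s \<noteq> z \<longrightarrow> e \<le> dist z s" using disc[of z] by blast
      have "ball z e \<subseteq> - S" using e z by force
      then show ?thesis using e(1) by blast
    qed
    then show ?thesis by (simp add: open_contains_ball)
  qed
  have S': "s - p \<in> S" if "s \<in> S" "p \<in> lattice \<tau>" for s p
    using S[OF that(1), of "- p"] that(2) by simp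
  have lim': "\<exists>L. (h \<longlongrightarrow> L) (at s)" if s: "s \<in> S" for s
  proof -
    obtain p L where p: "p \<in> lattice \<tau>" and L: "(h \<longlongrightarrow> L) (at (s + p))" using lim[OF s] by blast
    have "((\<lambda>z. h (z - - p)) \<longlongrightarrow> L) (at ((s + p) + - p))"
      unfolding Lim_shift using L .
    then have "((\<lambda>z. h (z + p)) \<longlongrightarrow> L) (at s)" by simp
    moreover have "eventually (\<lambda>z. h (z + p) = h z) (at s)"
      using evS[of s] by eventually_elim (use per p in auto)
    ultimately have "(h \<longlongrightarrow> L) (at s)" by (rule Lim_transform_eventually)
    then show ?thesis by blast
  qed
  \<comment> \<open>The filled-in value is the limit, whose existence at every singular point has
    just been derived.\<close>
  define H where "H z = (if z \<in> S then Lim (at z) h else h z)" for z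
  have evH: "eventually (\<lambda>w. h w = H w) (at z)" for z
    using evS[of z] by eventually_elim (simp add: H_def)
  have H_lim: "(H \<longlongrightarrow> H z) (at z)" for z
  proof (cases "z \<in> S")
    case True
    obtain L where L: "(h \<longlongrightarrow> L) (at z)" using lim'[OF True] by blast
    then have "H z = L" using True by (simp add: H_def tendsto_Lim)
    then show ?thesis using Lim_transform_eventually[OF L evH] by simp
  next
    case False
    have "isCont h z"
      using hol openS False by (metis ComplI continuous_on_eq_continuous_at holomorphic_on_imp_continuous_on)
    then have "(h \<longlongrightarrow> H z) (at z)" using False by (simp add: isCont_def H_def)
    then show ?thesis using evH by (rule Lim_transform_eventually)
  qed
  have H_diff: "H field_differentiable (at z)" for z
  proof -
    obtain e where e: "e > 0" "\<forall>s\<in>S. s \<noteq> z \<longrightarrow> e \<le> dist z s" using disc[of z] by blast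
    have "H holomorphic_on ball z e"
    proof (rule no_isolated_singularity'[of "{z}"])
      show "w \<in> {z} \<Longrightarrow> (H \<longlongrightarrow> H w) (at w within ball z e)" for w
        using H_lim by (rule tendsto_within_subset) simp
      have "h holomorphic_on (ball z e - {z})"
        by (rule holomorphic_on_subset[OF hol]) (use e in force)
      then show "H holomorphic_on (ball z e - {z})"
        by (rule holomorphic_transform) (use e in \<open>force simp: H_def\<close>)
    qed auto
    then show ?thesis
      using e(1) by (metis centre_in_ball holomorphic_on_imp_differentiable_at open_ball)
  qed
  then have Hhol: "H holomorphic_on UNIV" by (simp add: holomorphic_on_def)
  have "compact (H ` cball 0 (1 + norm \<tau>))"
    using Hhol by (intro compact_continuous_image holomorphic_on_imp_continuous_on compact_cball)
      (auto intro: holomorphic_on_subset)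
  then obtain B where B: "\<And>z. z \<in> cball 0 (1 + norm \<tau>) \<Longrightarrow> norm (H z) \<le> B"
    using compact_imp_bounded[of "H ` cball 0 (1 + norm \<tau>)"] unfolding bounded_iff by blast
  have bnd: "norm (h z) \<le> B" if z: "z \<notin> S" for z
  proof -
    obtain p where p: "p \<in> lattice \<tau>" "norm (z - p) \<le> 1 + norm \<tau>" using lattice_reduce by blast
    have zp: "z - p \<notin> S" using S[of "z - p" p] p(1) z by auto
    have "h z = H (z - p)" using per[OF zp p(1)] zp by (simp add: H_def)
    then show ?thesis using B[of "z - p"] p(2) by simp
  qed
  have "norm (H z) \<le> B" for z
  proof (rule Lim_norm_ubound[OF _ H_lim])
    show "eventually (\<lambda>w. norm (H w) \<le> B) (at z)"
      using evS[of z] by eventually_elim (simp add: H_def bnd)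
  qed simp
  then have "bounded (range H)" unfolding bounded_iff by blast
  then have "H constant_on UNIV" by (rule Liouville_theorem[OF Hhol])
  then obtain c where "\<And>z. H z = c" unfolding constant_on_def by blast
  then show ?thesis by (metis H_def)
qed

lemma theta_continuous: "isCont (theta \<tau>) z"
  using holomorphic_on_imp_continuous_on[OF theta_holomorphic[OF tau, of UNIV]]
  by (simp add: continuous_on_eq_continuous_at)

text \<open>The quotient \<open>h\<close> of the two sides is elliptic, and at 0 and at
  \<open>v\<close>, \<open>- v\<close> its zeros and poles cancel. The assumption on
  \<open>2 * v\<close> keeps \<open>v\<close> and \<open>- v\<close> in different classes, so that
  the zeros of the two theta factors are separate and simple.\<close>

lemma wp_diff_theta:
  assumes v: "2 * v \<notin> lattice \<tau>"
  obtains K where "K \<noteq> 0" "\<forall>z. z \<notin> lattice \<tau> \<longrightarrow> z + v \<notin> lattice \<tau> \<longrightarrow> z - v \<notin> lattice \<tau> \<longrightarrow>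
     wp \<tau> z - wp \<tau> v = K * (theta \<tau> (z + v) * theta \<tau> (z - v) / theta \<tau> z ^ 2)"
proof -
  let ?L = "lattice \<tau>" and ?th = "theta \<tau>"
  have v0: "v \<notin> ?L" using v lattice_of_int_mult[of v \<tau> 2] by auto
  note zero = theta_zero_iff[OF tau]
  have thv: "?th v \<noteq> 0" "?th (- v) \<noteq> 0" "?th (2 * v) \<noteq> 0" "?th (- (2 * v)) \<noteq> 0" using v v0 zero by simp_all
  define S where "S = {z. z \<in> ?L \<or> z + v \<in> ?L \<or> z - v \<in> ?L}"
  define h where "h z = (wp \<tau> z - wp \<tau> v) * ?th z ^ 2 / (?th (z + v) * ?th (z - v))" for z
  obtain D where D: "D \<noteq> 0" "((\<lambda>z. ?th z / z) \<longlongrightarrow> D) (at 0)" by (rule theta_deriv_0[OF tau])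
  have "\<exists>c. \<forall>z. z \<notin> S \<longrightarrow> h z = c"
  proof (rule elliptic_constant)
    fix z
    obtain e1 where e1: "e1 > 0" "\<forall>w\<in>?L. w \<noteq> z \<longrightarrow> e1 \<le> dist z w" using lattice_discrete[OF tau, of z] by blast
    obtain e2 where e2: "e2 > 0" "\<forall>w\<in>?L. w \<noteq> z + v \<longrightarrow> e2 \<le> dist (z + v) w" using lattice_discrete[OF tau, of "z + v"] by blast
    obtain e3 where e3: "e3 > 0" "\<forall>w\<in>?L. w \<noteq> z - v \<longrightarrow> e3 \<le> dist (z - v) w" using lattice_discrete[OF tau, of "z - v"] by blast
    have "min e1 (min e2 e3) \<le> dist z s" if s: "s \<in> S" "s \<noteq> z" for s
    proof -
      consider "s \<in> ?L" | "s + v \<in> ?L" | "s - v \<in> ?L" using s(1) unfolding S_def by blast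
      then show ?thesis
      proof cases
        case 1
        then have "e1 \<le> dist z s" using e1(2) s by auto
        then show ?thesis by simp
      next
        case 2
        then have "e2 \<le> dist (z + v) (s + v)" using e2(2)[rule_format, of "s + v"] s by auto
        then show ?thesis by (simp add: dist_norm)
      next
        case 3
        then have "e3 \<le> dist (z - v) (s - v)" using e3(2)[rule_format, of "s - v"] s by auto
        then show ?thesis by (simp add: dist_norm)
      qed
    qed
    then show "\<exists>e>0. \<forall>s\<in>S. s \<noteq> z \<longrightarrow> e \<le> dist z s"
      using e1 e2 e3 by (intro exI[of _ "min e1 (min e2 e3)"]) auto
  next
    fix s p assume sp: "s \<in> S" "p \<in> ?L"
    have "s + p + v = (s + v) + p" "s + p - v = (s - v) + p" by simp_all
    then show "s + p \<in> S"
      using sp lattice_add_iff[OF sp(2)] unfolding S_def by (metis mem_Collect_eq)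
  next
    show "h holomorphic_on - S"
      unfolding h_def
    proof (intro holomorphic_intros)
      show "wp \<tau> holomorphic_on - S"
        using wp_holomorphic[OF tau] by (rule holomorphic_on_subset) (auto simp: S_def)
      have t: "?th holomorphic_on UNIV" by (rule theta_holomorphic[OF tau])
      show "?th holomorphic_on - S" by (rule theta_holomorphic[OF tau])
      show "(\<lambda>z. ?th (z + v)) holomorphic_on - S"
        by (rule holomorphic_on_compose_gen[OF _ t, of "\<lambda>z. z + v" "- S", unfolded o_def])
          (auto intro!: holomorphic_intros)
      show "(\<lambda>z. ?th (z - v)) holomorphic_on - S"
        by (rule holomorphic_on_compose_gen[OF _ t, of "\<lambda>z. z - v" "- S", unfolded o_def])
          (auto intro!: holomorphic_intros)
    qed (auto simp: zero S_def)
  next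
    fix z p assume z: "z \<notin> S" and p: "p \<in> ?L"
    obtain a b where pab: "p = of_int a + of_int b * \<tau>" using p by (rule latticeE)
    obtain c where c: "c \<noteq> 0" "\<forall>z. ?th (z + p) = c * expi (- of_int b * z) * ?th z"
      unfolding pab by (rule theta_quasi_period[OF tau])
    have wp: "wp \<tau> (z + p) = wp \<tau> z" using z by (intro wp_periodic[OF tau p]) (simp add: S_def)
    have "z + p + v = (z + v) + p" "z + p - v = (z - v) + p" by simp_all
    then have t: "?th (z + p + v) = c * expi (- of_int b * (z + v)) * ?th (z + v)"
      "?th (z + p - v) = c * expi (- of_int b * (z - v)) * ?th (z - v)"
      using c(2) by metis+
    have e: "expi (- of_int b * (z + v)) * expi (- of_int b * (z - v)) = expi (- of_int b * z) ^ 2"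
      unfolding power2_eq_square expi_add[symmetric] by (simp add: algebra_simps)
    have "?th (z + p + v) * ?th (z + p - v) = (c * expi (- of_int b * z)) ^ 2 * (?th (z + v) * ?th (z - v))"
      unfolding t power_mult_distrib e[symmetric] by (simp add: power2_eq_square mult_ac)
    then show "h (z + p) = h z"
      using c(1) by (simp add: h_def wp c(2) power_mult_distrib)
  next
    \<comment> \<open>At 0 the double pole of \<open>wp\<close> meets the double zero of the squared
      theta function.\<close>
    have lim0: "\<exists>L. (h \<longlongrightarrow> L) (at 0)"
    proof -
      have "((\<lambda>z. (z ^ 2 * wp \<tau> z * (?th z / z) ^ 2 - wp \<tau> v * ?th z ^ 2) / (?th (z + v) * ?th (z - v)))
         \<longlongrightarrow> (1 * D ^ 2 - wp \<tau> v * ?th 0 ^ 2) / (?th (0 + v) * ?th (0 - v))) (at 0)"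
        using thv by (intro tendsto_intros wp_pole_0[OF tau] D isContD[OF theta_continuous]
            isCont_tendsto_compose[OF theta_continuous]) auto
      moreover have "eventually (\<lambda>z. (z ^ 2 * wp \<tau> z * (?th z / z) ^ 2 - wp \<tau> v * ?th z ^ 2) / (?th (z + v) * ?th (z - v)) = h z) (at 0)"
        unfolding eventually_at_filter h_def by (auto simp: field_simps intro!: always_eventually)
      ultimately have "(h \<longlongrightarrow> (1 * D ^ 2 - wp \<tau> v * ?th 0 ^ 2) / (?th (0 + v) * ?th (0 - v))) (at 0)"
        by (rule Lim_transform_eventually)
      then show ?thesis by blast
    qed
    \<comment> \<open>At \<open>u\<close> the simple zero of one theta factor is matched by the zero
      of \<open>wp \<tau> z - wp \<tau> u\<close>; the other factor takes the nonzero value at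
      \<open>2 * u\<close>.\<close>
    have limu: "\<exists>L. (h \<longlongrightarrow> L) (at u)" if u: "u = v \<or> u = - v" for u
    proof -
      have uL: "u \<notin> ?L" "2 * u \<notin> ?L" using u v v0 by auto
      have wpu: "wp \<tau> v = wp \<tau> u" using u wp_even[OF tau] by auto
      obtain d where "(wp \<tau> has_field_derivative d) (at u)" by (rule wp_deriv[OF tau uL(1)])
      then have d: "((\<lambda>z. (wp \<tau> z - wp \<tau> u) / (z - u)) \<longlongrightarrow> d) (at u)"
        by (simp add: has_field_derivative_iff[of _ _ u] has_field_derivative_iff LIM_offset_zero_iff[of u])
      have Du: "((\<lambda>z. ?th (z - u) / (z - u)) \<longlongrightarrow> D) (at u)"
        using Lim_shift[of "\<lambda>z. ?th z / z" u D 0] D(2) by simp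
      have "((\<lambda>z. ((wp \<tau> z - wp \<tau> u) / (z - u)) * ?th z ^ 2 / (?th (z + u) * (?th (z - u) / (z - u))))
          \<longlongrightarrow> d * ?th u ^ 2 / (?th (u + u) * D)) (at u)"
        using D(1) uL(2) zero[of "2 * u"] by (intro tendsto_intros d Du isContD[OF theta_continuous]
            isCont_tendsto_compose[OF theta_continuous]) auto
      moreover have "eventually (\<lambda>z. ((wp \<tau> z - wp \<tau> u) / (z - u)) * ?th z ^ 2 / (?th (z + u) * (?th (z - u) / (z - u))) = h z) (at u)"
      proof -
        have "?th (z + u) * ?th (z - u) = ?th (z + v) * ?th (z - v)" for z
          using u by (auto simp: mult.commute)
        then have hz: "h z = (wp \<tau> z - wp \<tau> u) * ?th z ^ 2 / (?th (z + u) * ?th (z - u))" for z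
          by (simp add: h_def wpu)
        have "(A / e) * T / (R * (R' / e)) = A * T / (R * R')" if "e \<noteq> 0" for A e T R R' :: complex
          using that by (simp add: field_simps)
        then show ?thesis unfolding eventually_at_filter hz by (intro always_eventually) simp
      qed
      ultimately have "(h \<longlongrightarrow> d * ?th u ^ 2 / (?th (u + u) * D)) (at u)"
        by (rule Lim_transform_eventually)
      then show ?thesis by blast
    qed
    fix s assume "s \<in> S"
    then consider "- s \<in> ?L" | "- (s + v) \<in> ?L" | "- (s - v) \<in> ?L" unfolding S_def lattice_uminus_iff by blast
    then show "\<exists>p\<in>?L. \<exists>L. (h \<longlongrightarrow> L) (at (s + p))"
    proof cases
      case 1
      then show ?thesis using lim0 by (intro bexI[of _ "- s"]) auto
    next
      case 2
      then show ?thesis using limu[of "- v"] by (intro bexI[of _ "- (s + v)"]) auto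
    next
      case 3
      then show ?thesis using limu[of v] by (intro bexI[of _ "- (s - v)"]) auto
    qed
  qed
  then obtain c where c: "\<And>z. z \<notin> S \<Longrightarrow> h z = c" by blast
  have main: "wp \<tau> z - wp \<tau> v = c * (?th (z + v) * ?th (z - v) / ?th z ^ 2)"
    if "z \<notin> ?L" "z + v \<notin> ?L" "z - v \<notin> ?L" for z
  proof -
    have "z \<notin> S" using that by (simp add: S_def)
    then have "h z = c" by (rule c)
    moreover have "?th z \<noteq> 0" "?th (z + v) \<noteq> 0" "?th (z - v) \<noteq> 0" using that zero by auto
    ultimately show ?thesis by (simp add: h_def field_simps)
  qed
  have "c \<noteq> 0"
  proof
    assume "c = 0"
    text \<open>Otherwise \<open>wp\<close> would be constant near its pole.\<close>
    obtain e1 where e1: "e1 > 0" "\<forall>w\<in>?L. w \<noteq> 0 \<longrightarrow> e1 \<le> dist 0 w" using lattice_discrete[OF tau, of 0] by blast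
    obtain e2 where e2: "e2 > 0" "\<forall>w\<in>?L. w \<noteq> v \<longrightarrow> e2 \<le> dist v w" using lattice_discrete[OF tau, of v] by blast
    obtain e3 where e3: "e3 > 0" "\<forall>w\<in>?L. w \<noteq> - v \<longrightarrow> e3 \<le> dist (- v) w" using lattice_discrete[OF tau, of "- v"] by blast
    have ev: "eventually (\<lambda>z. z ^ 2 * wp \<tau> v = z ^ 2 * wp \<tau> z) (at 0)"
      unfolding eventually_at
    proof (intro exI[of _ "min e1 (min e2 e3)"] conjI ballI impI)
      fix z :: complex assume "z \<in> UNIV" and z: "z \<noteq> 0 \<and> dist z 0 < min e1 (min e2 e3)"
      have "z \<notin> ?L" using e1(2) z by force
      moreover have "z + v \<notin> ?L"
      proof
        assume "z + v \<in> ?L"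
        then have "e2 \<le> dist v (z + v)" using e2(2) z by auto
        then show False using z by (simp add: dist_norm)
      qed
      moreover have "z - v \<notin> ?L"
      proof
        assume "z - v \<in> ?L"
        then have "e3 \<le> dist (- v) (z - v)" using e3(2) z by auto
        then show False using z by (simp add: dist_norm)
      qed
      ultimately show "z ^ 2 * wp \<tau> v = z ^ 2 * wp \<tau> z" using main \<open>c = 0\<close> by simp
    qed (use e1 e2 e3 in auto)
    have "((\<lambda>z. z ^ 2 * wp \<tau> v) \<longlongrightarrow> 0 ^ 2 * wp \<tau> v) (at 0)" by (intro tendsto_intros)
    then have "((\<lambda>z. z ^ 2 * wp \<tau> v) \<longlongrightarrow> 0) (at 0)" by simp
    from Lim_transform_eventually[OF this ev] have "((\<lambda>z. z ^ 2 * wp \<tau> z) \<longlongrightarrow> 0) (at 0)" .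
    then show False using wp_pole_0[OF tau] LIM_unique by fastforce
  qed
  then show ?thesis using that[of c] main by blast
qed

end

section \<open>The Weil pairing in terms of \<open>x\<close>-coordinates\<close>

text \<open>Here \<open>t\<close> is the multiplicative second difference of \<open>B\<close>.
  Telescoping once gives the ratios of consecutive values, telescoping again gives the exponents
  \<open>N - k\<close>.\<close>

lemma second_difference_product:
  fixes B t :: "nat \<Rightarrow> 'a::field"
  assumes B: "\<And>k. B k \<noteq> 0" and t: "\<And>k. t (Suc k) = B (Suc (Suc k)) * B k / B (Suc k) ^ 2"
  shows "B N / B 0 = (B 1 / B 0) ^ N * (\<Prod>k=1..<N. t k ^ (N - k))"
proof -
  have ratio: "B (Suc N) / B N = (B 1 / B 0) * (\<Prod>k=1..<Suc N. t k)" for N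
  proof (induction N)
    case (Suc N)
    have "B (Suc (Suc N)) / B (Suc N) = (B (Suc N) / B N) * t (Suc N)"
      using B by (simp add: t field_simps power2_eq_square)
    then show ?case unfolding Suc.IH by (simp add: mult.assoc)
  qed simp
  show ?thesis
  proof (induction N)
    case (Suc N)
    have "B (Suc N) / B 0 = (B N / B 0) * (B (Suc N) / B N)" using B by simp
    also have "\<dots> = (B 1 / B 0) ^ Suc N * ((\<Prod>k=1..<N. t k ^ (N - k)) * (\<Prod>k=1..<Suc N. t k))"
      unfolding Suc.IH ratio by (simp add: mult_ac)
    also have "(\<Prod>k=1..<N. t k ^ (N - k)) = (\<Prod>k=1..<Suc N. t k ^ (N - k))"
      by (cases N) (simp_all add: prod.atLeastLessThan_Suc)
    also have "\<dots> * (\<Prod>k=1..<Suc N. t k) = (\<Prod>k=1..<Suc N. t k ^ (Suc N - k))"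
      unfolding prod.distrib[symmetric] by (rule prod.cong) (auto simp: Suc_diff_le)
    finally show ?case .
  qed (use B in simp)
qed

text \<open>The constant \<open>K\<close> of \<open>wp_diff_theta\<close> cancels in this quotient,
  which becomes the multiplicative second difference of
  \<open>theta \<tau> (k P + Q) / theta \<tau> (k P - Q)\<close>. It is also insensitive to scaling
  all x-coordinates.\<close>

definition wp_ratio :: "complex \<Rightarrow> complex \<Rightarrow> complex \<Rightarrow> nat \<Rightarrow> complex" where
  "wp_ratio \<tau> P Q k = (wp \<tau> (of_nat k * P + Q) - wp \<tau> P) / (wp \<tau> (of_nat k * P - Q) - wp \<tau> P)"

context
  fixes \<tau> :: complex assumes tau: "0 < Im \<tau>"
begin

text \<open>The quotient \<open>B N / B 0\<close> is computed twice. Since \<open>N P\<close> is a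
  period, the quasi-period of theta gives the exponential; the double telescoping gives the product.
  Oddness of theta gives \<open>B 0 = - 1\<close>.\<close>

lemma theta_ratio_product:
  assumes N: "of_nat N * P = of_int a + of_int b * \<tau>"
    and P: "2 * P \<notin> lattice \<tau>"
    and nz: "\<And>k. of_nat k * P + Q \<notin> lattice \<tau>" "\<And>k. of_nat k * P - Q \<notin> lattice \<tau>"
  shows "expi (- 2 * of_int b * Q) = (- theta \<tau> (P + Q) / theta \<tau> (P - Q)) ^ N * (\<Prod>k=1..<N. wp_ratio \<tau> P Q k ^ (N - k))"
    and "theta \<tau> (P + Q) \<noteq> 0" "theta \<tau> (P - Q) \<noteq> 0" and "wp_ratio \<tau> P Q (Suc k) \<noteq> 0"
proof -
  let ?th = "theta \<tau>"
  define B where "B k = ?th (of_nat k * P + Q) / ?th (of_nat k * P - Q)" for k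
  note zero = theta_zero_iff[OF tau]
  have t0: "?th (of_nat k * P + Q) \<noteq> 0" "?th (of_nat k * P - Q) \<noteq> 0" for k using nz zero by auto
  have B: "B k \<noteq> 0" for k using t0 by (simp add: B_def)
  show "?th (P + Q) \<noteq> 0" "?th (P - Q) \<noteq> 0" using t0[of 1] by simp_all
  obtain K where K: "K \<noteq> 0" "\<forall>z. z \<notin> lattice \<tau> \<longrightarrow> z + P \<notin> lattice \<tau> \<longrightarrow> z - P \<notin> lattice \<tau> \<longrightarrow>
     wp \<tau> z - wp \<tau> P = K * (?th (z + P) * ?th (z - P) / ?th z ^ 2)"
    by (rule wp_diff_theta[OF tau P])
  have ratio: "wp_ratio \<tau> P Q (Suc k) = B (Suc (Suc k)) * B k / B (Suc k) ^ 2" for k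
  proof -
    have s: "of_nat (Suc k) * P + R + P = of_nat (Suc (Suc k)) * P + R"
      "of_nat (Suc k) * P + R - P = of_nat k * P + R" for R
      by (simp_all add: algebra_simps)
    have d: "wp \<tau> (of_nat (Suc k) * P + R) - wp \<tau> P =
        K * (?th (of_nat (Suc (Suc k)) * P + R) * ?th (of_nat k * P + R) / ?th (of_nat (Suc k) * P + R) ^ 2)"
      if "R = Q \<or> R = - Q" for R
    proof -
      have "of_nat j * P + R \<notin> lattice \<tau>" for j using that nz[of j] by auto
      then show ?thesis using K(2)[rule_format, of "of_nat (Suc k) * P + R"] unfolding s by blast
    qed
    have m: "of_nat j * P + - Q = of_nat j * P - Q" for j :: nat by simp
    have "wp_ratio \<tau> P Q (Suc k) =
       (K * (?th (of_nat (Suc (Suc k)) * P + Q) * ?th (of_nat k * P + Q) / ?th (of_nat (Suc k) * P + Q) ^ 2)) /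
       (K * (?th (of_nat (Suc (Suc k)) * P - Q) * ?th (of_nat k * P - Q) / ?th (of_nat (Suc k) * P - Q) ^ 2))"
      unfolding wp_ratio_def using d[of Q] d[of "- Q"] unfolding m by simp
    also have "\<dots> = B (Suc (Suc k)) * B k / B (Suc k) ^ 2"
      unfolding B_def using K(1) t0[of "Suc (Suc k)"] t0[of k] t0[of "Suc k"] by (simp add: field_simps)
    finally show ?thesis .
  qed
  show "wp_ratio \<tau> P Q (Suc k) \<noteq> 0" unfolding ratio using B by simp
  have odd: "?th (- Q) = - ?th Q" by (rule theta_odd[OF tau])
  have B0: "B 0 = - 1" using t0[of 0] by (simp add: B_def odd)
  have B1: "B 1 / B 0 = - ?th (P + Q) / ?th (P - Q)" unfolding B0 by (simp add: B_def)
  obtain c where c: "c \<noteq> 0" "\<forall>z. ?th (z + (of_int a + of_int b * \<tau>)) = c * expi (- of_int b * z) * ?th z"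
    by (rule theta_quasi_period[OF tau])
  have "?th (of_nat N * P + R) = c * expi (- of_int b * R) * ?th R" for R
    unfolding N using c(2) by (metis add.commute)
  from this[of Q] this[of "- Q"]
  have BN: "B N = (c * expi (- of_int b * Q) * ?th Q) / (c * expi (of_int b * Q) * ?th (- Q))"
    by (simp add: B_def)
  have "B N / B 0 = expi (- of_int b * Q) / expi (of_int b * Q)"
    unfolding BN B0 odd using c(1) t0(1)[of 0] by simp
  also have "\<dots> = expi (- of_int b * Q) * expi (- of_int b * Q)"
    using expi_minus[of "of_int b * Q"] by (simp add: divide_inverse)
  also have "\<dots> = expi (- 2 * of_int b * Q)" unfolding expi_add[symmetric] by (simp add: algebra_simps)
  finally have "expi (- 2 * of_int b * Q) = B N / B 0" by simp
  also have "\<dots> = (B 1 / B 0) ^ N * (\<Prod>k=1..<N. wp_ratio \<tau> P Q k ^ (N - k))"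
    by (rule second_difference_product) (use B ratio in auto)
  finally show "expi (- 2 * of_int b * Q) = (- ?th (P + Q) / ?th (P - Q)) ^ N * (\<Prod>k=1..<N. wp_ratio \<tau> P Q k ^ (N - k))"
    unfolding B1 .
qed

text \<open>The theta quotients raised to the power \<open>N\<close> differ, after the exchange of
  \<open>P\<close> and \<open>Q\<close>, only by a sign that an even exponent removes. Division
  leaves \<open>expi (2 * (d P - b Q))\<close>, the square of the Weil pairing up to the choice of
  sign, and \<open>d P - b Q\<close> is \<open>(a d - b c) / N\<close>.\<close>

lemma weil_pairing_product:
  assumes N: "even N" "of_nat N * P = of_int a + of_int b * \<tau>" "of_nat N * Q = of_int c + of_int d * \<tau>" "0 < N"
    and PQ: "2 * P \<notin> lattice \<tau>" "2 * Q \<notin> lattice \<tau>"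
    and nz: "\<And>k. of_nat k * P + Q \<notin> lattice \<tau>" "\<And>k. of_nat k * P - Q \<notin> lattice \<tau>"
      "\<And>k. of_nat k * Q + P \<notin> lattice \<tau>" "\<And>k. of_nat k * Q - P \<notin> lattice \<tau>"
  shows "expi (of_int (2 * (a * d - b * c)) / of_nat N) =
     (\<Prod>k=1..<N. wp_ratio \<tau> P Q k ^ (N - k)) / (\<Prod>k=1..<N. wp_ratio \<tau> Q P k ^ (N - k))"
proof -
  let ?th = "theta \<tau>"
  note 1 = theta_ratio_product[OF N(2) PQ(1) nz(1,2)]
  note 2 = theta_ratio_product[OF N(3) PQ(2) nz(3,4)]
  let ?X = "\<Prod>k=1..<N. wp_ratio \<tau> P Q k ^ (N - k)" and ?Y = "\<Prod>k=1..<N. wp_ratio \<tau> Q P k ^ (N - k)"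
  have Y0: "?Y \<noteq> 0"
  proof -
    have "wp_ratio \<tau> Q P k \<noteq> 0" if "k \<in> {1..<N}" for k using 2(4)[of "k - 1"] that by simp
    then show ?thesis by simp
  qed
  have "Q - P = - (P - Q)" by simp
  then have "?th (Q - P) = - ?th (P - Q)" using theta_odd[OF tau] by metis
  then have "- ?th (Q + P) / ?th (Q - P) = - (- ?th (P + Q) / ?th (P - Q))" by (simp add: add.commute)
  then have sg: "(- ?th (Q + P) / ?th (Q - P)) ^ N = (- ?th (P + Q) / ?th (P - Q)) ^ N"
    using N(1) by (metis power_minus_even)
  have nz': "(- ?th (P + Q) / ?th (P - Q)) ^ N \<noteq> 0" using 1(2,3) by simp
  have "expi (- 2 * of_int b * Q) / expi (- 2 * of_int d * P) = ?X / ?Y"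
    unfolding 1(1) 2(1) sg by (rule mult_divide_mult_cancel_left[OF nz'])
  moreover have "expi (- 2 * of_int b * Q) / expi (- 2 * of_int d * P) = expi (2 * (of_int d * P - of_int b * Q))"
    unfolding divide_inverse expi_diff[symmetric] by (simp add: algebra_simps)
  moreover have "2 * (of_int d * P - of_int b * Q) = of_int (2 * (a * d - b * c)) / of_nat N"
  proof -
    have "of_nat N * (2 * (of_int d * P - of_int b * Q)) = 2 * (of_int d * (of_nat N * P) - of_int b * (of_nat N * Q))"
      by (simp add: algebra_simps)
    also have "\<dots> = of_int (2 * (a * d - b * c))" unfolding N(2,3) by (simp add: algebra_simps)
    finally show ?thesis using N(4) by (simp add: field_simps)
  qed
  ultimately show ?thesis by simp
qed

end

section \<open>Two by two matrices\<close>

lemma mat2_nth [simp]: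
  "mat2 a b c d $ 1 $ 1 = a" "mat2 a b c d $ 1 $ 2 = b" "mat2 a b c d $ 2 $ 1 = c" "mat2 a b c d $ 2 $ 2 = d"
  by simp_all

lemma mat2_eq_iff:
  "(A :: 'a^2^2) = B \<longleftrightarrow> A$1$1 = B$1$1 \<and> A$1$2 = B$1$2 \<and> A$2$1 = B$2$1 \<and> A$2$2 = B$2$2"
  by (simp only: vec_eq_iff forall_2 conj_assoc)

lemma mat2_mult_nth:
  fixes A B :: "'a::semiring_1^2^2"
  shows "(A ** B) $ i $ j = A$i$1 * B$1$j + A$i$2 * B$2$j"
  by (simp add: matrix_matrix_mult_def sum_2)

lemma mat_1_nth_2 [simp]:
  "(mat 1 :: 'a::{zero,one}^2^2) $ 1 $ 1 = 1" "(mat 1 :: 'a^2^2) $ 1 $ 2 = 0"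
  "(mat 1 :: 'a^2^2) $ 2 $ 1 = 0" "(mat 1 :: 'a^2^2) $ 2 $ 2 = 1"
  by (simp_all add: mat_def)

lemma invertible_2_iff:
  fixes A :: "'a::comm_ring_1^2^2"
  shows "invertible A \<longleftrightarrow> det A dvd 1"
proof
  assume "invertible A"
  then obtain B where "A ** B = mat 1" unfolding invertible_def by blast
  then have "det A * det B = 1" by (metis det_I det_mul)
  then show "det A dvd 1" by (metis dvd_triv_left)
next
  assume "det A dvd 1"
  then obtain e where e: "det A * e = 1" by (auto elim!: dvdE)
  then have e': "(A$1$1 * A$2$2 - A$1$2 * A$2$1) * e = 1" by (simp add: det_2)
  define B where "B = mat2 (A$2$2 * e) (- (A$1$2 * e)) (- (A$2$1 * e)) (A$1$1 * e)"
  have "A ** B = mat 1" "B ** A = mat 1"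
    using e' by (simp_all add: mat2_eq_iff mat2_mult_nth B_def algebra_simps)
  then show "invertible A" unfolding invertible_def by blast
qed

lemma matrix_inv_comm_ring:
  fixes A :: "'a::comm_ring_1^2^2"
  assumes "invertible A"
  shows "A ** matrix_inv A = mat 1" "matrix_inv A ** A = mat 1"
  using assms unfolding invertible_def matrix_inv_def by (metis (mono_tags, lifting) someI_ex)+

lemma matrix_inv_eqI:
  fixes A :: "'a::comm_ring_1^2^2"
  assumes "A ** B = mat 1" "B ** A = mat 1"
  shows "matrix_inv A = B"
proof -
  have A: "invertible A" using assms unfolding invertible_def by blast
  have "matrix_inv A = matrix_inv A ** (A ** B)" by (simp add: assms(1))
  also have "\<dots> = B" by (simp only: matrix_mul_assoc matrix_inv_comm_ring(2)[OF A] matrix_mul_lid)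
  finally show ?thesis .
qed

lemma invertible_matrix_inv:
  fixes A :: "'a::comm_ring_1^2^2"
  assumes "invertible A" shows "invertible (matrix_inv A)" "matrix_inv (matrix_inv A) = A"
  using matrix_inv_comm_ring[OF assms] by (auto simp: invertible_def intro: matrix_inv_eqI)

lemma invertible_matrix_mult:
  fixes A B :: "'a::comm_ring_1^2^2"
  assumes "invertible A" "invertible B"
  shows "invertible (A ** B)" "matrix_inv (A ** B) = matrix_inv B ** matrix_inv A"
proof -
  have 1: "(A ** B) ** (matrix_inv B ** matrix_inv A) = mat 1"
    by (metis assms matrix_inv_comm_ring(1) matrix_mul_assoc matrix_mul_rid)
  have 2: "(matrix_inv B ** matrix_inv A) ** (A ** B) = mat 1"
    by (metis assms matrix_inv_comm_ring(2) matrix_mul_assoc matrix_mul_rid)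
  show "invertible (A ** B)" using 1 2 unfolding invertible_def by blast
  show "matrix_inv (A ** B) = matrix_inv B ** matrix_inv A" by (rule matrix_inv_eqI[OF 1 2])
qed

text \<open>Shared by the three maps along which matrices are carried: profinite integers and
  rationals into the adeles, and integers into the profinite integers.\<close>

locale comm_ring_hom =
  fixes f :: "'a::comm_ring_1 \<Rightarrow> 'b::comm_ring_1"
  assumes add: "f (x + y) = f x + f y" and mult: "f (x * y) = f x * f y" and one: "f 1 = 1"
begin


lemma zero: "f 0 = 0" using add[of 0 0] by simp

lemma uminus: "f (- x) = - f x"
  using add[of x "- x"] zero by (simp add: eq_neg_iff_add_eq_0 add.commute)

lemma diff: "f (x - y) = f x - f y" using add[of x "- y"] uminus by simp

lemma of_nat: "f (of_nat n) = of_nat n" by (induction n) (simp_all add: zero one add)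

lemma of_int: "f (of_int n) = of_int n" by (cases n rule: int_cases2) (simp_all add: of_nat uminus)

lemma map_matrix_mult: "map_matrix f (A ** B :: 'a^2^2) = map_matrix f A ** (map_matrix f B :: 'b^2^2)"
  by (simp add: mat2_eq_iff mat2_mult_nth add mult)

lemma map_matrix_1: "map_matrix f (mat 1 :: 'a^2^2) = (mat 1 :: 'b^2^2)"
  by (simp add: mat2_eq_iff zero one)

lemma det_map_matrix: "det (map_matrix f A) = f (det (A :: 'a^2^2))"
  by (simp add: det_2 diff mult)

lemma invertible_map_matrix: "invertible (A :: 'a^2^2) \<Longrightarrow> invertible (map_matrix f A :: 'b^2^2)"
  unfolding invertible_def by (metis map_matrix_1 map_matrix_mult)

end

section \<open>Arithmetic of the finite adeles\<close>

lemma residue_of_int: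
  assumes "0 < n" shows "residue (of_int k) n = k mod int n"
  using assms by (cases k rule: int_cases2) (simp_all add: residue_of_nat uminus_zhat.rep_eq mod_minus_eq)

lemma residue_plus: "residue (x + y) n = (residue x n + residue y n) mod int n"
  and residue_mult: "residue (x * y) n = (residue x n * residue y n) mod int n"
  by (simp_all add: plus_zhat.rep_eq times_zhat.rep_eq)

lemma residue_minus: "residue (x - y) n = (residue x n - residue y n) mod int n"
  unfolding minus_zhat_def residue_plus uminus_zhat.rep_eq
  by (simp only: mod_add_right_eq diff_conv_add_uminus)

text \<open>The quotient modulo \<open>k\<close> is the residue modulo \<open>n * k\<close> divided
  by \<open>n\<close>; these quotients are again compatible.\<close>

lemma zhat_dvd_of_residue_0:
  assumes n: "0 < n" and y: "residue y n = 0"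
  obtains z where "y = z * of_nat n"
proof -
  define f where "f k = residue y (n * k) div int n" for k
  have nf: "residue y (n * k) = int n * f k" if "0 < k" for k
  proof -
    have "residue y (n * k) mod int n = 0" using residue_dvd[of "n * k" n y] n that y by simp
    then show ?thesis
      using mult_div_mod_eq[of "int n" "residue y (n * k)"] by (simp add: f_def)
  qed
  have "f \<in> {x. x 0 = 0 \<and> (\<forall>m n. 0 < n \<longrightarrow> m dvd n \<longrightarrow> x m = x n mod int m)}"
  proof (intro CollectI conjI allI impI)
    show "f 0 = 0" by (simp add: f_def)
    fix m k :: nat assume k: "0 < k" "m dvd k"
    then have m: "0 < m" by (auto intro: dvd_pos_nat)
    have "int n * f m = residue y (n * k) mod int (n * m)"
      using residue_dvd[of "n * k" "n * m" y] n k nf[OF m] by simp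
    also have "\<dots> = int n * (f k mod int m)" unfolding nf[OF k(1)] by (simp only: mult_mod_right of_nat_mult)
    finally show "f m = f k mod int m" using n by simp
  qed
  then have res: "residue (Abs_zhat f) = f" by (rule Abs_zhat_inverse)
  have "y = Abs_zhat f * of_nat n"
  proof (rule zhat_eqI)
    fix k :: nat assume k: "0 < k"
    have "residue (Abs_zhat f * of_nat n) k = (f k * int n) mod int k"
      using k by (simp add: residue_mult residue_of_nat res mod_mult_right_eq)
    also have "\<dots> = residue y (n * k) mod int k" using nf[OF k] by (simp add: mult.commute)
    also have "\<dots> = residue y k" using residue_dvd[of "n * k" k y] n k by simp
    finally show "residue y k = residue (Abs_zhat f * of_nat n) k" by simp
  qed
  then show ?thesis by (rule that)
qed

lemma zhat_decompose:
  assumes "0 < n" obtains z where "x = of_int (residue x n) + z * of_nat n"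
proof -
  have "residue (x - of_int (residue x n)) n = 0"
    using assms by (simp add: residue_minus residue_of_int)
  then obtain z where "x - of_int (residue x n) = z * of_nat n" by (rule zhat_dvd_of_residue_0[OF assms])
  then have "x = of_int (residue x n) + z * of_nat n" by (simp add: algebra_simps)
  then show ?thesis by (rule that)
qed

section \<open>Adeles as fractions\<close>

abbreviation adele_frac :: "zhat \<Rightarrow> nat \<Rightarrow> fin_adele" where
  "adele_frac x m \<equiv> abs_fin_adele (x, m)"

lemma adele_rel_refl: "0 < m \<Longrightarrow> adele_rel (x, m) (x, m)"
  by (simp add: adele_rel_def)

lemma adele_frac_eq_iff:
  assumes "0 < m" "0 < n"
  shows "adele_frac x m = adele_frac y n \<longleftrightarrow> x * of_nat n = y * of_nat m"
  using Quotient_rel[OF Quotient_fin_adele, of "(x, m)" "(y, n)"] assms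
  by (auto simp: adele_rel_def)

lemma adele_frac_add:
  "0 < m \<Longrightarrow> 0 < n \<Longrightarrow> adele_frac x m + adele_frac y n = adele_frac (x * of_nat n + y * of_nat m) (m * n)"
  using plus_fin_adele.abs_eq[OF adele_rel_refl adele_rel_refl] by simp

lemma adele_frac_mult:
  "0 < m \<Longrightarrow> 0 < n \<Longrightarrow> adele_frac x m * adele_frac y n = adele_frac (x * y) (m * n)"
  using times_fin_adele.abs_eq[OF adele_rel_refl adele_rel_refl] by simp

lemma adele_frac_cases:
  obtains x m where "0 < m" "a = adele_frac x m"
proof -
  obtain p where p: "adele_rel p p" "abs_fin_adele p = a"
    using Quotient_abs_rep[OF Quotient_fin_adele, of a] Quotient_rep_reflp[OF Quotient_fin_adele, of a] by blast
  then show ?thesis using that[of "snd p" "fst p"] by (simp add: adele_rel_def)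
qed

interpretation of_zhat: comm_ring_hom adele_of_zhat
proof
  show "adele_of_zhat (x + y) = adele_of_zhat x + adele_of_zhat y"
    "adele_of_zhat (x * y) = adele_of_zhat x * adele_of_zhat y" for x y
    by (simp_all add: adele_of_zhat_def adele_frac_add adele_frac_mult)
  show "adele_of_zhat 1 = 1" by (simp add: adele_of_zhat_def one_fin_adele_def)
qed

text \<open>The embedding of the rationals is defined through the reduced fraction; with this rule
  any positive denominator may be used.\<close>

lemma adele_of_rat_frac:
  assumes "0 < n" shows "adele_of_rat (of_int m / of_nat n) = adele_frac (of_int m) n"
proof -
  obtain a b where ab: "quotient_of (of_int m / of_nat n) = (a, b)" by fastforce
  have b: "0 < b" using ab by (rule quotient_of_denom_pos)
  have "(of_int m / of_nat n :: rat) = of_int a / of_int b" using ab by (rule quotient_of_div)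
  then have "(of_int m * of_int b :: rat) = of_int a * of_nat n" using assms b by (simp add: field_simps)
  then have "(of_int (m * b) :: rat) = of_int (a * int n)" by simp
  then have mb: "m * b = a * int n" by (simp only: of_int_eq_iff)
  have "(of_int a * of_nat n :: zhat) = of_int m * of_nat (nat b)"
  proof -
    have "(of_nat (nat b) :: zhat) = of_int b" using b by simp
    then show ?thesis using arg_cong[OF mb, of "of_int :: int \<Rightarrow> zhat"] by simp
  qed
  then show ?thesis using assms b by (simp add: adele_of_rat_def ab adele_frac_eq_iff)
qed

lemma rat_frac_cases: obtains m n where "0 < n" "(r :: rat) = of_int m / of_nat n"
proof -
  obtain a b where ab: "quotient_of r = (a, b)" by fastforce
  have "0 < b" "r = of_int a / of_int b" using ab quotient_of_denom_pos quotient_of_div by blast+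
  then show ?thesis using that[of "nat b" a] by simp
qed

interpretation of_ratA: comm_ring_hom adele_of_rat
proof
  fix x y :: rat
  obtain a m where x: "0 < m" "x = of_int a / of_nat m" by (rule rat_frac_cases)
  obtain b n where y: "0 < n" "y = of_int b / of_nat n" by (rule rat_frac_cases)
  have s: "x + y = of_int (a * int n + b * int m) / of_nat (m * n)"
    and p: "x * y = of_int (a * b) / of_nat (m * n)"
    using x y by (simp_all add: add_frac_eq)
  have mn: "0 < m * n" using x y by simp
  show "adele_of_rat (x + y) = adele_of_rat x + adele_of_rat y"
    unfolding s adele_of_rat_frac[OF mn] unfolding x(2) y(2) adele_of_rat_frac[OF x(1)] adele_of_rat_frac[OF y(1)]
    using x y by (simp add: adele_frac_add)
  show "adele_of_rat (x * y) = adele_of_rat x * adele_of_rat y"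
    unfolding p adele_of_rat_frac[OF mn] unfolding x(2) y(2) adele_of_rat_frac[OF x(1)] adele_of_rat_frac[OF y(1)]
    using x y by (simp add: adele_frac_mult)
next
  show "adele_of_rat 1 = 1" using adele_of_rat_frac[of 1 1] by (simp add: one_fin_adele_def)
qed

lemma adele_of_rat_of_int: "adele_of_rat (of_int k) = adele_of_zhat (of_int k)"
  using adele_of_rat_frac[of 1 k] by (simp add: adele_of_zhat_def)

text \<open>If \<open>m / n\<close> is integral as an adele, comparing residues modulo
  \<open>n\<close> shows that \<open>n\<close> divides \<open>m\<close>.\<close>

lemma adele_of_rat_integral_iff: "adele_of_rat r \<in> range adele_of_zhat \<longleftrightarrow> r \<in> \<int>"
proof
  obtain m n where r: "0 < n" "r = of_int m / of_nat n" by (rule rat_frac_cases)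
  assume "adele_of_rat r \<in> range adele_of_zhat"
  then obtain z where "adele_of_rat r = adele_of_zhat z" by blast
  then have "adele_frac (of_int m) n = adele_frac z 1" unfolding r(2) adele_of_rat_frac[OF r(1)] by (simp add: adele_of_zhat_def)
  then have "of_int m = z * of_nat n" using r(1) by (simp add: adele_frac_eq_iff)
  then have "residue (of_int m) n = residue (z * of_nat n) n" by simp
  then have "m mod int n = 0" using r(1) by (simp add: residue_of_int residue_mult residue_of_nat)
  then have "int n dvd m" by presburger
  then obtain k where "m = int n * k" by blast
  then have "r = of_int k" using r by simp
  then show "r \<in> \<int>" by simp
qed (auto elim!: Ints_cases simp: adele_of_rat_of_int)

lemma adele_of_rat_inverse: "r \<noteq> 0 \<Longrightarrow> adele_of_rat r * adele_of_rat (inverse r) = 1"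
  by (simp add: of_ratA.mult[symmetric] of_ratA.one)

text \<open>Writing the adele as \<open>y / m\<close> and splitting off the residue of
  \<open>y\<close> modulo \<open>m\<close> leaves a profinite integer. This justifies the choice in
  \<open>rat_part\<close>.\<close>

lemma rat_part_mod_integers: "x - adele_of_rat (rat_part x) \<in> range adele_of_zhat"
  unfolding rat_part_def
proof (rule someI_ex)
  obtain y m where x: "0 < m" "x = adele_frac y m" by (rule adele_frac_cases)
  obtain z where z: "y = of_int (residue y m) + z * of_nat m" by (rule zhat_decompose[OF x(1)])
  have "x = adele_of_zhat z + adele_of_rat (of_int (residue y m) / of_nat m)"
    unfolding adele_of_rat_frac[OF x(1)] x(2) adele_of_zhat_def
    using x(1) by (subst z) (simp add: adele_frac_add add.commute)
  then show "\<exists>r. x - adele_of_rat r \<in> range adele_of_zhat" by (intro exI[of _ "of_int (residue y m) / of_nat m"]) simp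
qed

lemma rat_part_diff_Ints:
  assumes "x - adele_of_rat r \<in> range adele_of_zhat"
  obtains k where "rat_part x = r + of_int k"
proof -
  obtain y z where yz: "x - adele_of_rat r = adele_of_zhat y" "x - adele_of_rat (rat_part x) = adele_of_zhat z"
    using assms rat_part_mod_integers[of x] by auto
  have "adele_of_rat (rat_part x - r) = (x - adele_of_rat r) - (x - adele_of_rat (rat_part x))"
    by (simp add: of_ratA.diff)
  also have "\<dots> = adele_of_zhat (y - z)" unfolding yz of_zhat.diff ..
  finally have "rat_part x - r \<in> \<int>" unfolding adele_of_rat_integral_iff[symmetric] by blast
  then obtain k where "rat_part x - r = of_int k" by (auto elim: Ints_cases)
  then have "rat_part x = r + of_int k" by (simp add: algebra_simps)
  then show ?thesis by (rule that)
qed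

section \<open>Class number one\<close>

lemma zhat_prime_dvd_mult:
  assumes p: "prime p" and "residue (x * y) p = 0"
  shows "residue x p = 0 \<or> residue y p = 0"
proof -
  have p0: "0 < p" using p prime_gt_0_nat by blast
  have "int p dvd residue x p * residue y p" using assms(2) by (simp add: residue_mult mod_eq_0_iff_dvd)
  then have "int p dvd residue x p \<or> int p dvd residue y p"
    using p by (simp add: prime_dvd_mult_iff)
  then show ?thesis using residue_mod[of x p] residue_mod[of y p] by (metis mod_eq_0_iff_dvd)
qed

lemma prime_inverse_mod:
  assumes p: "prime p" and r: "\<not> int p dvd r"
  obtains s where "int p dvd r * s - 1"
proof -
  have "coprime r (int p)" using p r by (metis coprime_commute prime_imp_coprime prime_nat_int_transfer)
  then obtain s t where "s * r + t * int p = 1" using bezout_int[of r "int p"] by auto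
  then have "r * s - 1 = int p * (- t)" by (simp add: algebra_simps)
  then show ?thesis using that[of s] by (metis dvd_triv_left)
qed

lemma GL2Q_det: "q \<in> GL2Q \<longleftrightarrow> det q \<noteq> 0"
  by (simp add: GL2Q_def invertible_det_nz)

text \<open>Modulo \<open>p\<close> the rows are dependent. Either the second row vanishes, or the
  first becomes zero after adding a multiple of the second; a rational matrix then divides that row
  by \<open>p\<close> and removes one factor \<open>p\<close> from the determinant.\<close>

lemma integral_matrix_descent:
  fixes A :: "zhat^2^2"
  assumes p: "prime p" and d: "residue (det A) p = 0"
  obtains q B where "q \<in> GL2Q" "map_matrix adele_of_rat q ** map_matrix adele_of_zhat A = map_matrix adele_of_zhat B"
    "det B * of_nat p = det A"
proof -
  have p0: "0 < p" using p prime_gt_0_nat by blast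
  let ?r = "\<lambda>i j. residue (A$i$j) p"
  have det: "int p dvd ?r 1 1 * ?r 2 2 - ?r 1 2 * ?r 2 1"
    using d by (simp add: det_2 residue_minus residue_mult mod_eq_0_iff_dvd mod_diff_eq)
  have pin: "adele_of_rat (1 / of_nat p) * adele_of_zhat (z * of_nat p) = adele_of_zhat z" for z
  proof -
    have "adele_of_rat (1 / of_nat p) = adele_frac 1 p" using adele_of_rat_frac[OF p0, of 1] by simp
    then show ?thesis using p0 by (simp add: adele_of_zhat_def adele_frac_mult adele_frac_eq_iff)
  qed
  have res0: "residue x p = 0" if "int p dvd residue x p" for x
    using that residue_mod[of x p] by (metis mod_eq_0_iff_dvd)
  show ?thesis
  proof (cases "int p dvd ?r 2 1 \<and> int p dvd ?r 2 2")
    case True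
    then have "?r 2 1 = 0" "?r 2 2 = 0" using res0 by auto
    then obtain y z where yz: "A$2$1 = y * of_nat p" "A$2$2 = z * of_nat p"
      by (metis zhat_dvd_of_residue_0[OF p0])
    define q where "q = mat2 1 0 0 (1 / of_nat p :: rat)"
    define B where "B = mat2 (A$1$1) (A$1$2) y z"
    have "q \<in> GL2Q" using p0 by (simp add: GL2Q_det q_def det_2)
    moreover have "map_matrix adele_of_rat q ** map_matrix adele_of_zhat A = map_matrix adele_of_zhat B"
      using pin by (simp add: mat2_eq_iff mat2_mult_nth q_def B_def of_ratA.zero of_ratA.one yz)
    moreover have "det B * of_nat p = det A" by (simp add: det_2 B_def yz algebra_simps)
    ultimately show ?thesis by (rule that)
  next
    case False
    \<comment> \<open>Whichever entry of the second row is invertible modulo \<open>p\<close>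
      determines \<open>t\<close>; the other congruence follows from the determinant.\<close>
    have "\<exists>t. int p dvd ?r 1 1 + t * ?r 2 1 \<and> int p dvd ?r 1 2 + t * ?r 2 2"
    proof (cases "int p dvd ?r 2 1")
      case True
      with False have n: "\<not> int p dvd ?r 2 2" by simp
      obtain s where s: "int p dvd ?r 2 2 * s - 1" by (rule prime_inverse_mod[OF p n])
      have "int p dvd ?r 1 1 * ?r 2 2"
        using dvd_add[OF det dvd_mult[OF True, of "?r 1 2"]] by simp
      then have "int p dvd ?r 1 1" using n p by (simp add: prime_dvd_mult_iff)
      moreover have "?r 1 2 + - (?r 1 2 * s) * ?r 2 2 = - ?r 1 2 * (?r 2 2 * s - 1)" by (simp add: algebra_simps)
      then have "int p dvd ?r 1 2 + - (?r 1 2 * s) * ?r 2 2" using s by (metis dvd_mult)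
      ultimately show ?thesis using True by (intro exI[of _ "- (?r 1 2 * s)"]) auto
    next
      case n: False
      obtain s where s: "int p dvd ?r 2 1 * s - 1" by (rule prime_inverse_mod[OF p n])
      have "?r 1 1 + - (?r 1 1 * s) * ?r 2 1 = - ?r 1 1 * (?r 2 1 * s - 1)" by (simp add: algebra_simps)
      then have 1: "int p dvd ?r 1 1 + - (?r 1 1 * s) * ?r 2 1" using s by (metis dvd_mult)
      have "?r 1 2 + - (?r 1 1 * s) * ?r 2 2 = - s * (?r 1 1 * ?r 2 2 - ?r 1 2 * ?r 2 1) - ?r 1 2 * (?r 2 1 * s - 1)"
        by (simp add: algebra_simps)
      then have "int p dvd ?r 1 2 + - (?r 1 1 * s) * ?r 2 2"
        using det s by (metis dvd_diff dvd_mult)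
      then show ?thesis using 1 by blast
    qed
    then obtain t where t: "int p dvd ?r 1 1 + t * ?r 2 1" "int p dvd ?r 1 2 + t * ?r 2 2" by blast
    have z: "residue (A$1$j + of_int t * A$2$j) p = 0" if "int p dvd ?r 1 j + t * ?r 2 j" for j
    proof -
      have "residue (A$1$j + of_int t * A$2$j) p = (?r 1 j + t * ?r 2 j) mod int p"
        using p0 by (simp add: residue_plus residue_mult residue_of_int mod_mult_left_eq mod_add_right_eq)
      then show ?thesis using that by (simp add: mod_eq_0_iff_dvd)
    qed
    obtain y where y: "A$1$1 + of_int t * A$2$1 = y * of_nat p" by (rule zhat_dvd_of_residue_0[OF p0 z[OF t(1)]])
    obtain w where w: "A$1$2 + of_int t * A$2$2 = w * of_nat p" by (rule zhat_dvd_of_residue_0[OF p0 z[OF t(2)]])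
    define q where "q = mat2 (1 / of_nat p :: rat) (of_int t / of_nat p) 0 1"
    define B where "B = mat2 y w (A$2$1) (A$2$2)"
    have "q \<in> GL2Q" using p0 by (simp add: GL2Q_det q_def det_2)
    moreover have "adele_of_rat (1 / of_nat p) * adele_of_zhat u + adele_of_rat (of_int t / of_nat p) * adele_of_zhat v = adele_of_zhat x"
      if "u + of_int t * v = x * of_nat p" for u v x
    proof -
      have "adele_of_rat (of_int t / of_nat p) = adele_of_rat (1 / of_nat p) * adele_of_zhat (of_int t)"
        unfolding adele_of_rat_of_int[symmetric] of_ratA.mult[symmetric] by simp
      then have "adele_of_rat (1 / of_nat p) * adele_of_zhat u + adele_of_rat (of_int t / of_nat p) * adele_of_zhat v =
        adele_of_rat (1 / of_nat p) * adele_of_zhat (u + of_int t * v)"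
        by (simp add: of_zhat.add of_zhat.mult algebra_simps)
      then show ?thesis unfolding that pin .
    qed
    from this[OF y] this[OF w]
    have "map_matrix adele_of_rat q ** map_matrix adele_of_zhat A = map_matrix adele_of_zhat B"
      by (simp add: mat2_eq_iff mat2_mult_nth q_def B_def of_ratA.zero of_ratA.one)
    moreover have "det B * of_nat p = det A"
    proof -
      have "det B * of_nat p = (y * of_nat p) * A$2$2 - (w * of_nat p) * A$2$1"
        by (simp add: det_2 B_def algebra_simps)
      also have "\<dots> = det A" unfolding y[symmetric] w[symmetric] by (simp add: det_2 algebra_simps)
      finally show ?thesis .
    qed
    ultimately show ?thesis by (rule that)
  qed
qed

lemma GL2Q_mult: "q \<in> GL2Q \<Longrightarrow> r \<in> GL2Q \<Longrightarrow> q ** r \<in> GL2Q"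
  by (simp add: GL2Q_det det_mul)

text \<open>The cofactor \<open>y\<close> makes the determinant a divisor of a positive integer, on
  which the induction runs. Each prime of \<open>d\<close> divides either \<open>det A\<close>,
  where the descent applies, or \<open>y\<close>, where it is cancelled.\<close>

lemma GL2Q_integral_GL2Zhat:
  fixes A :: "zhat^2^2"
  assumes "0 < d" "det A * y = of_nat d"
  shows "\<exists>q\<in>GL2Q. map_matrix adele_of_rat q ** map_matrix adele_of_zhat A \<in> GL2Zhat"
  using assms
proof (induction d arbitrary: A y rule: less_induct)
  case (less d)
  show ?case
  proof (cases "d = 1")
    case True
    then have "det A dvd 1" using less.prems by (metis dvd_triv_left of_nat_1)
    then have "map_matrix adele_of_zhat A \<in> GL2Zhat" by (auto simp: GL2Zhat_def invertible_2_iff)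
    moreover have "mat 1 \<in> GL2Q" by (simp add: GL2Q_det)
    ultimately show ?thesis by (intro bexI[of _ "mat 1"]) (simp_all add: of_ratA.map_matrix_1)
  next
    case False
    then obtain p where p: "prime p" "p dvd d" using prime_factor_nat by blast
    then obtain e where e: "d = e * p" by (metis dvd_div_mult_self)
    have p0: "0 < p" using p prime_gt_0_nat by blast
    have e0: "0 < e" "e < d" using e less.prems(1) p(1) prime_gt_1_nat[of p] by auto
    have cancel: "x = of_nat e" if "x * of_nat p = (of_nat d :: zhat)" for x
    proof -
      have "(x - of_nat e) * of_nat p = 0" using that by (simp add: e algebra_simps)
      then show ?thesis using zhat_torsion_free[OF p0] by fastforce
    qed
    have "residue (det A * y) p = 0" using less.prems p p0 by (simp add: residue_of_nat)
    then consider "residue (det A) p = 0" | "residue y p = 0" using zhat_prime_dvd_mult[OF p(1)] by blast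
    then show ?thesis
    proof cases
      case 1
      obtain q B where q: "q \<in> GL2Q"
        and B: "map_matrix adele_of_rat q ** map_matrix adele_of_zhat A = map_matrix adele_of_zhat B"
        "det B * of_nat p = det A"
        by (rule integral_matrix_descent[OF p(1) 1])
      have "(det B * y) * of_nat p = of_nat d" using less.prems(2) B(2) by (metis mult.assoc mult.commute)
      then have "det B * y = of_nat e" by (rule cancel)
      from less.IH[OF e0(2,1) this] obtain r where r: "r \<in> GL2Q"
        "map_matrix adele_of_rat r ** map_matrix adele_of_zhat B \<in> GL2Zhat" by blast
      have "map_matrix adele_of_rat (r ** q) ** map_matrix adele_of_zhat A \<in> GL2Zhat"
        using r(2) by (simp add: of_ratA.map_matrix_mult matrix_mul_assoc[symmetric] B(1))
      then show ?thesis using GL2Q_mult[OF r(1) q] by blast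
    next
      case 2
      then obtain z where z: "y = z * of_nat p" by (rule zhat_dvd_of_residue_0[OF p0])
      have "(det A * z) * of_nat p = of_nat d" using less.prems(2) z by (simp add: mult.assoc)
      then have "det A * z = of_nat e" by (rule cancel)
      from less.IH[OF e0(2,1) this] show ?thesis .
    qed
  qed
qed

text \<open>A common denominator \<open>m\<close> of the entries makes the matrix integral. The
  inverse of \<open>det a\<close>, written as \<open>u / n\<close>, then shows that the new
  determinant divides the positive integer \<open>m * m * n\<close>.\<close>

lemma GL2Af_eq_GL2Q_GL2Zhat:
  assumes a: "a \<in> GL2Af"
  shows "\<exists>q\<in>GL2Q. map_matrix adele_of_rat q ** a \<in> GL2Zhat"
proof -
  obtain x11 m11 where 11: "0 < m11" "a$1$1 = adele_frac x11 m11" by (rule adele_frac_cases)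
  obtain x12 m12 where 12: "0 < m12" "a$1$2 = adele_frac x12 m12" by (rule adele_frac_cases)
  obtain x21 m21 where 21: "0 < m21" "a$2$1 = adele_frac x21 m21" by (rule adele_frac_cases)
  obtain x22 m22 where 22: "0 < m22" "a$2$2 = adele_frac x22 m22" by (rule adele_frac_cases)
  define m where "m = m11 * m12 * m21 * m22"
  have m0: "0 < m" using 11 12 21 22 by (simp add: m_def)
  have fm: "\<exists>y. adele_of_rat (of_nat m) * adele_frac x n = adele_of_zhat y" if n: "0 < n" "n dvd m" for x n
  proof -
    obtain k where k: "m = n * k" using n by blast
    have "adele_of_rat (of_nat m) = adele_frac (of_nat m) 1" using adele_of_rat_frac[of 1 "int m"] by simp
    then have "adele_of_rat (of_nat m) * adele_frac x n = adele_of_zhat (x * of_nat k)"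
      using n(1) by (simp add: adele_of_zhat_def adele_frac_mult adele_frac_eq_iff k algebra_simps)
    then show ?thesis by blast
  qed
  have "m11 dvd m" "m12 dvd m" "m21 dvd m" "m22 dvd m" by (simp_all add: m_def)
  then obtain y11 y12 y21 y22 where y:
    "adele_of_rat (of_nat m) * a$1$1 = adele_of_zhat y11" "adele_of_rat (of_nat m) * a$1$2 = adele_of_zhat y12"
    "adele_of_rat (of_nat m) * a$2$1 = adele_of_zhat y21" "adele_of_rat (of_nat m) * a$2$2 = adele_of_zhat y22"
    using fm 11 12 21 22 by metis
  define A where "A = mat2 y11 y12 y21 y22"
  define q where "q = mat2 (of_nat m) 0 0 (of_nat m :: rat)"
  have q: "q \<in> GL2Q" using m0 by (simp add: GL2Q_det q_def det_2)
  have qa: "map_matrix adele_of_rat q ** a = map_matrix adele_of_zhat A"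
    by (simp add: mat2_eq_iff mat2_mult_nth q_def A_def y of_ratA.zero)
  have "det a dvd 1" using a by (simp add: GL2Af_def invertible_2_iff)
  then obtain b where b: "1 = det a * b" by blast
  obtain u n where u: "0 < n" "b = adele_frac u n" by (rule adele_frac_cases)
  have "adele_of_zhat (det A) = adele_of_rat (det q) * det a"
    using arg_cong[OF qa, of det] by (simp only: det_mul of_ratA.det_map_matrix of_zhat.det_map_matrix)
  also have "adele_of_rat (det q) = adele_of_zhat (of_nat (m * m))"
    using adele_of_rat_of_int[of "int (m * m)"] by (simp add: q_def det_2)
  finally have "adele_of_zhat (det A) * b = adele_of_zhat (of_nat (m * m)) * (det a * b)" by (simp add: mult.assoc)
  also have "\<dots> = adele_of_zhat (of_nat (m * m))" using b by simp
  finally have "adele_frac (det A * u) n = adele_frac (of_nat (m * m)) 1"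
    using u by (simp add: adele_of_zhat_def adele_frac_mult)
  then have "det A * u = of_nat (m * m * n)" using u(1) by (simp add: adele_frac_eq_iff)
  then obtain r where r: "r \<in> GL2Q" "map_matrix adele_of_rat r ** map_matrix adele_of_zhat A \<in> GL2Zhat"
    using GL2Q_integral_GL2Zhat[of "m * m * n" A u] m0 u(1) by auto
  have "map_matrix adele_of_rat (r ** q) ** a \<in> GL2Zhat"
    using r(2) by (simp add: of_ratA.map_matrix_mult matrix_mul_assoc[symmetric] qa)
  then show ?thesis using GL2Q_mult[OF r(1) q] by blast
qed

section \<open>Moebius transformations and classes\<close>

lemma of_rat_complex: "(of_rat r :: complex) = of_real (of_rat r)"
  by (cases r) (simp add: of_rat_rat)

lemma mobius_denominator_nonzero:
  assumes "q \<in> GL2Q" "Im \<tau> \<noteq> 0"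
  shows "of_rat (q$2$1) * \<tau> + of_rat (q$2$2) \<noteq> (0 :: complex)"
proof
  assume eq: "of_rat (q$2$1) * \<tau> + of_rat (q$2$2) = (0 :: complex)"
  then have "Im (of_rat (q$2$1) * \<tau> + of_rat (q$2$2)) = 0" by simp
  then have "of_rat (q$2$1) * Im \<tau> = (0 :: real)" unfolding of_rat_complex by simp
  then have "q$2$1 = 0" using assms(2) by simp
  moreover from this have "q$2$2 = 0" using eq by simp
  ultimately show False using assms(1) by (simp add: GL2Q_det det_2)
qed

lemma Im_mobius:
  "Im (mobius q \<tau>) = of_rat (det q) * Im \<tau> / norm (of_rat (q$2$1) * \<tau> + of_rat (q$2$2)) ^ 2"
proof -
  have "Im (mobius q \<tau>) = (Im (of_rat (q$1$1) * \<tau> + of_rat (q$1$2)) * Re (of_rat (q$2$1) * \<tau> + of_rat (q$2$2)) -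
     Re (of_rat (q$1$1) * \<tau> + of_rat (q$1$2)) * Im (of_rat (q$2$1) * \<tau> + of_rat (q$2$2))) /
     norm (of_rat (q$2$1) * \<tau> + of_rat (q$2$2)) ^ 2"
    unfolding mobius_def by (simp only: Im_divide cmod_power2)
  also have "Im (of_rat (q$1$1) * \<tau> + of_rat (q$1$2)) * Re (of_rat (q$2$1) * \<tau> + of_rat (q$2$2)) -
     Re (of_rat (q$1$1) * \<tau> + of_rat (q$1$2)) * Im (of_rat (q$2$1) * \<tau> + of_rat (q$2$2)) = of_rat (det q) * Im \<tau>"
    unfolding of_rat_complex by (simp add: det_2 of_rat_diff of_rat_mult algebra_simps)
  finally show ?thesis .
qed

lemma Im_mobius_nonzero: "q \<in> GL2Q \<Longrightarrow> Im \<tau> \<noteq> 0 \<Longrightarrow> Im (mobius q \<tau>) \<noteq> 0"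
  using mobius_denominator_nonzero[of q \<tau>] by (simp add: Im_mobius GL2Q_det)

lemma mobius_mult:
  assumes "q \<in> GL2Q" "r \<in> GL2Q" "Im \<tau> \<noteq> 0"
  shows "mobius (q ** r) \<tau> = mobius q (mobius r \<tau>)"
proof -
  let ?n = "of_rat (r$1$1) * \<tau> + of_rat (r$1$2)" and ?d = "of_rat (r$2$1) * \<tau> + of_rat (r$2$2)"
  have d: "?d \<noteq> 0" by (rule mobius_denominator_nonzero[OF assms(2,3)])
  have e: "of_rat x * mobius r \<tau> + of_rat y = (of_rat x * ?n + of_rat y * ?d) / ?d" for x y
  proof -
    have "a * (n / m) + b = (a * n + b * m) / m" if "m \<noteq> 0" for a b n m :: complex
      using that by (simp add: field_simps)
    then show ?thesis unfolding mobius_def[of r] using d by blast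
  qed
  have "mobius q (mobius r \<tau>) = (of_rat (q$1$1) * ?n + of_rat (q$1$2) * ?d) / (of_rat (q$2$1) * ?n + of_rat (q$2$2) * ?d)"
    unfolding mobius_def[of q] e using d by simp
  also have "\<dots> = mobius (q ** r) \<tau>"
    by (simp add: mobius_def[of "q ** r"] mat2_mult_nth of_rat_add of_rat_mult algebra_simps)
  finally show ?thesis ..
qed

lemma GL2Q_inverse: "q \<in> GL2Q \<Longrightarrow> matrix_inv q \<in> GL2Q"
  by (simp add: GL2Q_def invertible_matrix_inv)

lemma cls_mobius:
  assumes q: "q \<in> GL2Q" and \<tau>: "Im \<tau> \<noteq> 0"
  shows "cls (mobius q \<tau>) (map_matrix adele_of_rat q ** a) = cls \<tau> a"
proof -
  have "(mobius r (mobius q \<tau>), map_matrix adele_of_rat r ** (map_matrix adele_of_rat q ** a)) =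
      (mobius (r ** q) \<tau>, map_matrix adele_of_rat (r ** q) ** a)" if "r \<in> GL2Q" for r
    using mobius_mult[OF that q \<tau>] by (simp add: of_ratA.map_matrix_mult matrix_mul_assoc)
  then have "cls (mobius q \<tau>) (map_matrix adele_of_rat q ** a) =
      (\<lambda>r. (mobius r \<tau>, map_matrix adele_of_rat r ** a)) ` (\<lambda>r. r ** q) ` GL2Q"
    unfolding cls_def image_image by (auto simp: image_iff) metis+
  also have "(\<lambda>r. r ** q) ` GL2Q = GL2Q"
  proof
    show "(\<lambda>r. r ** q) ` GL2Q \<subseteq> GL2Q" using GL2Q_mult q by auto
    show "GL2Q \<subseteq> (\<lambda>r. r ** q) ` GL2Q"
    proof
      fix r assume r: "r \<in> GL2Q"
      have "r = (r ** matrix_inv q) ** q"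
        using matrix_inv_comm_ring(2)[of q] q by (simp add: GL2Q_def matrix_mul_assoc[symmetric])
      then show "r \<in> (\<lambda>r. r ** q) ` GL2Q" using GL2Q_mult[OF r GL2Q_inverse[OF q]] by blast
    qed
  qed
  finally show ?thesis unfolding cls_def by blast
qed

lemma hecke_cls: "hecke g (cls \<tau> a) = cls \<tau> (a ** matrix_inv g)"
  unfolding hecke_def cls_def by (auto simp: matrix_mul_assoc image_iff)

lemma GL2Af_mult: "a \<in> GL2Af \<Longrightarrow> b \<in> GL2Af \<Longrightarrow> a ** b \<in> GL2Af"
  by (simp add: GL2Af_def invertible_matrix_mult)

lemma GL2Af_inverse: "a \<in> GL2Af \<Longrightarrow> matrix_inv a \<in> GL2Af"
  by (simp add: GL2Af_def invertible_matrix_inv)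

lemma hecke_inverse_cls:
  assumes "g \<in> GL2Af" shows "hecke (matrix_inv g) (cls \<tau> a) = cls \<tau> (a ** g)"
  using assms by (simp add: hecke_cls invertible_matrix_inv(2) GL2Af_def)

lemma GL2Q_GL2Af: "q \<in> GL2Q \<Longrightarrow> map_matrix adele_of_rat q \<in> GL2Af"
  by (simp add: GL2Af_def GL2Q_def of_ratA.invertible_map_matrix)

lemma GL2Zhat_GL2Af: "a \<in> GL2Zhat \<Longrightarrow> a \<in> GL2Af"
  by (auto simp: GL2Af_def GL2Zhat_def of_zhat.invertible_map_matrix)

lemma double_half_plane_iff: "\<tau> \<in> double_half_plane \<longleftrightarrow> Im \<tau> \<noteq> 0"
  by (simp add: double_half_plane_def complex_is_Real_iff)

lemma Shimura_cls: "Im \<tau> \<noteq> 0 \<Longrightarrow> a \<in> GL2Af \<Longrightarrow> cls \<tau> a \<in> Shimura"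
  unfolding Shimura_def double_half_plane_iff by blast

text \<open>An integral representative comes from class number one; a point in the lower half-plane
  is moved up without leaving the integral matrices.\<close>

lemma Shimura_representative:
  assumes "x \<in> Shimura"
  obtains \<tau> A where "0 < Im \<tau>" "invertible A" "x = cls \<tau> (map_matrix adele_of_zhat A)"
proof -
  obtain \<tau>0 a where x: "x = cls \<tau>0 a" "Im \<tau>0 \<noteq> 0" "a \<in> GL2Af"
    using assms unfolding Shimura_def double_half_plane_iff by blast
  obtain q where q: "q \<in> GL2Q" "map_matrix adele_of_rat q ** a \<in> GL2Zhat"
    using GL2Af_eq_GL2Q_GL2Zhat[OF x(3)] by blast
  obtain A where A: "invertible A" "map_matrix adele_of_rat q ** a = map_matrix adele_of_zhat A"
    using q(2) unfolding GL2Zhat_def by blast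
  let ?\<tau> = "mobius q \<tau>0"
  have Im: "Im ?\<tau> \<noteq> 0" by (rule Im_mobius_nonzero[OF q(1) x(2)])
  have x': "x = cls ?\<tau> (map_matrix adele_of_zhat A)"
    using cls_mobius[OF q(1) x(2), of a] x(1) A(2) by simp
  show ?thesis
  proof (cases "0 < Im ?\<tau>")
    case True
    then show ?thesis using that A(1) x' by blast
  next
    case False
    \<comment> \<open>The diagonal matrix with entries -1 and 1 interchanges the half-planes and is
      invertible over the integers, so it acts both as a rational and as a profinite matrix.\<close>
    define r where "r = (mat2 (- 1) 0 0 1 :: rat^2^2)"
    define R where "R = (mat2 (- 1) 0 0 1 :: zhat^2^2)"
    have r: "r \<in> GL2Q" by (simp add: GL2Q_det r_def det_2)
    have "invertible R" by (simp add: invertible_2_iff R_def det_2)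
    then have inv: "invertible (R ** A)" using A(1) by (rule invertible_matrix_mult)
    have "map_matrix adele_of_rat r = map_matrix adele_of_zhat R"
      by (simp add: mat2_eq_iff r_def R_def of_ratA.zero of_ratA.one of_ratA.uminus of_zhat.zero of_zhat.one of_zhat.uminus)
    then have "x = cls (mobius r ?\<tau>) (map_matrix adele_of_zhat (R ** A))"
      using cls_mobius[OF r Im, of "map_matrix adele_of_zhat A"] x' by (simp add: of_zhat.map_matrix_mult)
    moreover have "mobius r ?\<tau> = - ?\<tau>"
      unfolding mobius_def[of r] by (simp add: r_def of_rat_minus)
    then have "0 < Im (mobius r ?\<tau>)" using Im False by simp
    ultimately show ?thesis using that inv by blast
  qed
qed

section \<open>Nonvanishing of the Eisenstein series\<close>

lemma summable_lattice_power:
  assumes tau: "0 < Im \<tau>" and k: "3 \<le> k"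
  shows "(\<lambda>w. 1 / norm w ^ k) summable_on (lattice \<tau> - {0})"
proof -
  obtain e where e: "0 < e" "\<forall>w\<in>lattice \<tau>. w \<noteq> 0 \<longrightarrow> e \<le> dist 0 w"
    using lattice_discrete[OF tau, of 0] by blast
  have "(\<lambda>w. (1 / e) ^ (k - 3) * (1 / norm w ^ 3)) summable_on (lattice \<tau> - {0})"
    by (intro summable_on_cmult_right summable_lattice_cube[OF tau])
  then show ?thesis
  proof (rule summable_on_comparison_test)
    fix w assume "w \<in> lattice \<tau> - {0}"
    then have w: "e \<le> norm w" "0 < norm w" using e by auto
    have "(1 / norm w) ^ (k - 3) \<le> (1 / e) ^ (k - 3)"
      using w e(1) by (intro power_mono) (auto intro: divide_left_mono)
    then have "(1 / norm w) ^ (k - 3) * (1 / norm w ^ 3) \<le> (1 / e) ^ (k - 3) * (1 / norm w ^ 3)"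
      by (intro mult_right_mono) auto
    moreover have "norm w ^ k = norm w ^ (k - 3) * norm w ^ 3"
      using k by (simp add: power_add[symmetric])
    ultimately show "1 / norm w ^ k \<le> (1 / e) ^ (k - 3) * (1 / norm w ^ 3)"
      by (simp add: power_one_over)
  qed simp
qed

text \<open>When \<open>\<tau>\<close> is stretched, only the nonzero integers among the lattice
  points stay near the origin. For even \<open>k\<close> they contribute at least 1, the term of
  \<open>w = 1\<close> alone, while the others form part of a tail of the original sum and
  contribute less than 1.\<close>

lemma eisenstein_nonzero:
  assumes tau: "0 < Im \<tau>" and k: "3 \<le> k" "even k"
  obtains K where "\<forall>n\<ge>K. eisenstein k (of_nat n * \<tau>) \<noteq> 0"
proof -
  define M where "M = (\<lambda>w :: complex. 1 / norm w ^ k)"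
  define L where "L = lattice \<tau> - {0}"
  have M: "M summable_on L" unfolding M_def L_def by (rule summable_lattice_power[OF tau k(1)])
  define T where "T = infsum M L"
  have T: "(M has_sum T) L" unfolding T_def using M by (rule has_sum_infsum)
  then have "eventually (\<lambda>X. dist (sum M X) T < 1) (finite_subsets_at_top L)"
    unfolding has_sum_def tendsto_iff by auto
  then obtain F where F: "finite F" "F \<subseteq> L" "dist (sum M F) T < 1"
    unfolding eventually_finite_subsets_at_top by blast
  have tail: "infsum M (L - F) < 1"
  proof -
    have "(M has_sum (T - sum M F)) (L - F)"
      by (rule has_sum_Diff[OF T has_sum_finite[OF F(1)] F(2)])
    then show ?thesis using F(3) by (auto simp: infsumI dist_real_def)
  qed
  obtain B where B: "\<forall>w\<in>F. \<bar>Im w\<bar> \<le> B"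
    using bdd_above_finite[of "(\<lambda>w. \<bar>Im w\<bar>) ` F"] F(1) unfolding bdd_above_def by auto
  \<comment> \<open>From this bound on, every non-integral point of the stretched lattice has an
    imaginary part larger than all those occurring in \<open>F\<close>, and so lies in the
    tail.\<close>
  define K where "K = nat \<lceil>B / Im \<tau>\<rceil> + 1"
  have "eisenstein k (of_nat n * \<tau>) \<noteq> 0" if n: "K \<le> n" for n
  proof -
    have n0: "0 < n" using n by (simp add: K_def)
    have taun: "0 < Im (of_nat n * \<tau>)" using tau n0 by simp
    define Z where "Z = (of_int ` (UNIV - {0}) :: complex set)"
    define R where "R = lattice (of_nat n * \<tau>) - {0} - Z"
    have ZL: "Z \<subseteq> lattice (of_nat n * \<tau>) - {0}"
    proof
      fix w assume "w \<in> Z"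
      then obtain m where "w = of_int m" "m \<noteq> 0" by (auto simp: Z_def)
      then show "w \<in> lattice (of_nat n * \<tau>) - {0}" using latticeI[of m 0 "of_nat n * \<tau>"] by simp
    qed
    have RL: "R \<subseteq> L - F"
    proof
      fix w assume w: "w \<in> R"
      then obtain a b where ab: "w = of_int a + of_int b * (of_nat n * \<tau>)" "w \<noteq> 0" "w \<notin> Z"
        by (auto simp: R_def elim: latticeE)
      have b: "b \<noteq> 0"
      proof
        assume "b = 0"
        then show False using ab by (auto simp: Z_def)
      qed
      have "w = of_int a + of_int (b * int n) * \<tau>" using ab(1) by simp
      then have "w \<in> lattice \<tau>" using latticeI by metis
      moreover have "w \<notin> F"
      proof
        assume "w \<in> F"
        then have "\<bar>Im w\<bar> \<le> B" using B by blast
        moreover have "\<bar>Im w\<bar> = \<bar>real_of_int b\<bar> * (real n * Im \<tau>)" using tau by (simp add: ab(1) abs_mult)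
        moreover have "1 * (real n * Im \<tau>) \<le> \<bar>real_of_int b\<bar> * (real n * Im \<tau>)"
          using b tau by (intro mult_right_mono) auto
        ultimately have "real n * Im \<tau> \<le> B" by linarith
        then have "real n \<le> B / Im \<tau>" using tau by (simp add: field_simps)
        moreover have "B / Im \<tau> < real n" using n unfolding K_def by linarith
        ultimately show False by simp
      qed
      ultimately show "w \<in> L - F" using ab(2) by (simp add: L_def)
    qed
    have summ: "(\<lambda>w. 1 / w ^ k) summable_on (lattice (of_nat n * \<tau>) - {0})"
      by (rule abs_summable_summable)
        (use summable_lattice_power[OF taun k(1)] in \<open>simp add: norm_divide norm_power\<close>)
    have sZ: "(\<lambda>w. 1 / w ^ k) summable_on Z" and sR: "(\<lambda>w. 1 / w ^ k) summable_on R"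
      using ZL by (auto intro!: summable_on_subset_banach[OF summ] simp: R_def)
    have "lattice (of_nat n * \<tau>) - {0} = Z \<union> R" using ZL by (auto simp: R_def)
    then have E: "eisenstein k (of_nat n * \<tau>) = infsum (\<lambda>w. 1 / w ^ k) Z + infsum (\<lambda>w. 1 / w ^ k) R"
      unfolding eisenstein_def by (simp only:) (rule infsum_Un_disjoint[OF sZ sR], auto simp: R_def)
    have "norm (infsum (\<lambda>w. 1 / w ^ k) R) \<le> infsum M (L - F)"
    proof -
      have MR: "M summable_on R" using RL by (intro summable_on_subset_banach[OF M]) auto
      have "norm (infsum (\<lambda>w. 1 / w ^ k) R) \<le> infsum M R"
        by (rule norm_infsum_le[OF has_sum_infsum[OF sR] has_sum_infsum[OF MR]])
          (simp add: M_def norm_divide norm_power)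
      also have "\<dots> \<le> infsum M (L - F)"
      proof (rule infsum_mono2[OF MR _ RL])
        show "M summable_on (L - F)" by (rule summable_on_subset_banach[OF M]) simp
      qed (simp add: M_def)
      finally show ?thesis .
    qed
    then have small: "norm (infsum (\<lambda>w. 1 / w ^ k) R) < 1" using tail by simp
    have "1 \<le> Re (infsum (\<lambda>w. 1 / w ^ k) Z)"
    proof -
      have pos: "0 \<le> Re (1 / w ^ k)" if "w \<in> Z" for w
      proof -
        obtain m where "w = of_int m" using \<open>w \<in> Z\<close> by (auto simp: Z_def)
        then have "1 / w ^ k = of_real (1 / of_int m ^ k)" by simp
        then have "Re (1 / w ^ k) = 1 / of_int m ^ k" by (simp only: Re_complex_of_real)
        then show ?thesis using k(2) by (simp add: zero_le_even_power)
      qed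
      have "((\<lambda>w. 1 / w ^ k) has_sum infsum (\<lambda>w. 1 / w ^ k) Z) Z" using sZ by (rule has_sum_infsum)
      then have "((\<lambda>w. Re (1 / w ^ k)) has_sum Re (infsum (\<lambda>w. 1 / w ^ k) Z)) Z" by (rule has_sum_Re)
      \<comment> \<open>All terms are nonnegative as \<open>k\<close> is even, so the single term at
        1 is a lower bound.\<close>
      then have "sum (\<lambda>w. Re (1 / w ^ k)) {1} \<le> Re (infsum (\<lambda>w. 1 / w ^ k) Z)"
        by (rule finite_sum_le_has_sum) (use pos in \<open>auto simp: Z_def image_iff intro!: bexI[of _ 1]\<close>)
      then show ?thesis by simp
    qed
    moreover have "\<bar>Re (infsum (\<lambda>w. 1 / w ^ k) R)\<bar> < 1" using small abs_Re_le_cmod le_less_trans by blast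
    ultimately have "0 < Re (eisenstein k (of_nat n * \<tau>))" unfolding E by simp
    then show ?thesis by auto
  qed
  then show ?thesis using that by blast
qed

section \<open>Torsion points\<close>

text \<open>Any rational representatives \<open>r\<close>, \<open>s\<close> of the coordinates may
  replace the choice in \<open>rat_part\<close>: the two differ by a period, and \<open>wp\<close>
  is periodic.\<close>

lemma torsion_point_x:
  assumes tau: "0 < Im \<tau>" and v: "v$1 - adele_of_rat r \<in> range adele_of_zhat" "v$2 - adele_of_rat s \<in> range adele_of_zhat"
    and z: "z = of_rat r - of_rat s * \<tau>"
  shows "map_option fst (torsion_point \<tau> v) = (if z \<in> lattice \<tau> then None else Some (wp \<tau> z))"
proof -
  obtain k where k: "rat_part (v$1) = r + of_int k" by (rule rat_part_diff_Ints[OF v(1)])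
  obtain l where l: "rat_part (v$2) = s + of_int l" by (rule rat_part_diff_Ints[OF v(2)])
  define p where "p = of_int k + of_int (- l) * \<tau>"
  have p: "p \<in> lattice \<tau>" unfolding p_def by (rule latticeI)
  have e: "of_rat (rat_part (v$1)) - of_rat (rat_part (v$2)) * \<tau> = z + p"
    by (simp add: k l z p_def of_rat_add algebra_simps)
  show ?thesis
    unfolding torsion_point_def e curve_point_def using lattice_add_iff[OF p, of z] wp_periodic[OF tau p, of z] by simp
qed

lemma adele_div_mod_integers:
  assumes N: "0 < N" and x: "residue x N = k mod int N"
  shows "adele_of_rat (1 / of_nat N) * adele_of_zhat x - adele_of_rat (of_int k / of_nat N) \<in> range adele_of_zhat"
proof -
  have "residue (x - of_int k) N = 0"
    using x N by (simp add: residue_minus residue_of_int mod_diff_right_eq)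
  then obtain z where z: "x - of_int k = z * of_nat N" by (rule zhat_dvd_of_residue_0[OF N])
  have 1: "adele_of_rat (1 / of_nat N) = adele_frac 1 N" using adele_of_rat_frac[OF N, of 1] by simp
  have pin: "adele_of_rat (1 / of_nat N) * adele_of_zhat (z * of_nat N) = adele_of_zhat z"
    unfolding 1 using N by (simp add: adele_of_zhat_def adele_frac_mult adele_frac_eq_iff)
  have "adele_of_rat (of_int k / of_nat N) = adele_of_rat (1 / of_nat N) * adele_of_zhat (of_int k)"
    unfolding adele_of_rat_of_int[symmetric] of_ratA.mult[symmetric] by simp
  then have "adele_of_rat (1 / of_nat N) * adele_of_zhat x - adele_of_rat (of_int k / of_nat N) =
      adele_of_rat (1 / of_nat N) * adele_of_zhat (z * of_nat N)"
    unfolding z[symmetric] by (simp add: of_zhat.diff algebra_simps)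
  then show ?thesis unfolding pin by simp
qed

text \<open>Complex coordinates of the torsion basis that an integral matrix induces.\<close>

definition basis_point :: "nat \<Rightarrow> complex \<Rightarrow> zhat^2^2 \<Rightarrow> 2 \<Rightarrow> complex" where
  "basis_point N \<tau> A j = (of_int (residue (A$1$j) N) - of_int (residue (A$2$j) N) * \<tau>) / of_nat N"

text \<open>Right multiplication by \<open>g\<close> replaces the torsion basis by integral
  combinations of itself, so column \<open>j\<close> of \<open>g\<close> lists the coefficients of
  the new point. Congruence modulo \<open>N\<close> of the matrix entries is all that a torsion
  point sees.\<close>

lemma level_curve_x:
  fixes A :: "zhat^2^2" and g :: "int^2^2"
  assumes tau: "0 < Im \<tau>" and N: "0 < N"
    and z: "z = of_int (g$1$j) * basis_point N \<tau> A 1 + of_int (g$2$j) * basis_point N \<tau> A 2"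
  shows "map_option fst (snd (snd (level_curve_of N \<tau> (map_matrix adele_of_zhat (A ** map_matrix of_int g)))) j) =
     (if z \<in> lattice \<tau> then None else Some (wp \<tau> z))"
proof -
  let ?a = "\<lambda>i. residue (A$i$1) N * g$1$j + residue (A$i$2) N * g$2$j"
  have r: "residue ((A ** map_matrix of_int g) $ i $ j) N = ?a i mod int N" for i
    using N by (simp add: mat2_mult_nth residue_plus residue_mult residue_of_int mod_mult_right_eq mod_add_eq)
  have c: "(\<chi> i. adele_of_rat (1 / of_nat N) * map_matrix adele_of_zhat (A ** map_matrix of_int g) $ i $ j) $ i
      - adele_of_rat (of_int (?a i) / of_nat N) \<in> range adele_of_zhat" for i
    using adele_div_mod_integers[OF N r[of i]] by simp
  have "z = of_rat (of_int (?a 1) / of_nat N) - of_rat (of_int (?a 2) / of_nat N) * \<tau>"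
  proof -
    have q: "of_rat (of_int k / of_nat N) = (of_int k / of_nat N :: complex)" for k
      by (simp only: of_rat_divide of_rat_of_int_eq of_rat_of_nat_eq)
    show ?thesis
      unfolding z basis_point_def q using N by (simp add: divide_simps) (simp add: algebra_simps)
  qed
  from torsion_point_x[OF tau c c this] show ?thesis
    by (simp add: level_curve_of_def)
qed

text \<open>The residues form a matrix whose determinant is prime to \<open>N\<close>; eliminating
  one coefficient at a time shows that the basis points are independent modulo
  \<open>N\<close>.\<close>

lemma basis_point_lattice:
  fixes A :: "zhat^2^2"
  assumes tau: "0 < Im \<tau>" and N: "0 < N" and A: "invertible A"
    and z: "of_int i * basis_point N \<tau> A 1 + of_int j * basis_point N \<tau> A 2 \<in> lattice \<tau>"
  shows "int N dvd i" "int N dvd j"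
proof -
  let ?r = "\<lambda>i j. residue (A$i$j) N"
  define d where "d = ?r 1 1 * ?r 2 2 - ?r 1 2 * ?r 2 1"
  have "residue (det A) N = d mod int N"
    by (simp add: det_2 residue_minus residue_mult d_def mod_diff_eq)
  moreover obtain u where "1 = det A * u" using A unfolding invertible_2_iff by blast
  then have "residue 1 N = residue (det A * u) N" by simp
  ultimately have "(d * residue u N) mod int N = 1 mod int N"
    using N residue_of_int[OF N, of 1] by (simp add: residue_mult mod_mult_left_eq)
  then have "coprime (d * residue u N) (int N)"
    using N by (metis coprime_1_left coprime_mod_left_iff of_nat_0_eq_iff less_numeral_extra(3))
  then have cop: "coprime d (int N)" by simp
  obtain m n where mn: "of_int i * basis_point N \<tau> A 1 + of_int j * basis_point N \<tau> A 2 = of_int m + of_int n * \<tau>"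
    using z by (rule latticeE)
  have "of_nat N * (of_int i * basis_point N \<tau> A 1 + of_int j * basis_point N \<tau> A 2) = of_nat N * (of_int m + of_int n * \<tau>)"
    unfolding mn ..
  then have "of_int i * (of_nat N * basis_point N \<tau> A 1) + of_int j * (of_nat N * basis_point N \<tau> A 2) =
      of_nat N * (of_int m + of_int n * \<tau>)"
    by (simp add: algebra_simps)
  moreover have "of_nat N * basis_point N \<tau> A k = of_int (?r 1 k) - of_int (?r 2 k) * \<tau>" for k
    using N by (simp add: basis_point_def)
  ultimately have "of_int (i * ?r 1 1 + j * ?r 1 2) + of_int (- (i * ?r 2 1 + j * ?r 2 2)) * \<tau> =
      of_int (int N * m) + of_int (int N * n) * \<tau>"
    by (simp add: algebra_simps)
  then have e: "i * ?r 1 1 + j * ?r 1 2 = int N * m" "i * ?r 2 1 + j * ?r 2 2 = - (int N * n)"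
    unfolding lattice_eq_iff[OF tau] by auto
  have "i * d = ?r 2 2 * (i * ?r 1 1 + j * ?r 1 2) - ?r 1 2 * (i * ?r 2 1 + j * ?r 2 2)"
    by (simp add: d_def algebra_simps)
  then have "i * d = int N * (?r 2 2 * m + ?r 1 2 * n)" unfolding e by (simp add: algebra_simps)
  then have "int N dvd i * d" by simp
  then show "int N dvd i" using cop by (simp add: coprime_commute coprime_dvd_mult_left_iff)
  have "j * d = ?r 1 1 * (i * ?r 2 1 + j * ?r 2 2) - ?r 2 1 * (i * ?r 1 1 + j * ?r 1 2)"
    by (simp add: d_def algebra_simps)
  then have "j * d = int N * (- (?r 1 1 * n) - ?r 2 1 * m)" unfolding e by (simp add: algebra_simps)
  then have "int N dvd j * d" by simp
  then show "int N dvd j" using cop by (simp add: coprime_commute coprime_dvd_mult_left_iff)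
qed

text \<open>The right-hand side of \<open>weil_pairing_product\<close> at the two basis points. As
  it is built from values of \<open>wp\<close> alone, automorphisms can be applied to it.\<close>

definition weil_product :: "nat \<Rightarrow> complex \<Rightarrow> zhat^2^2 \<Rightarrow> complex" where
  "weil_product N \<tau> A =
     (\<Prod>k=1..<N. wp_ratio \<tau> (basis_point N \<tau> A 1) (basis_point N \<tau> A 2) k ^ (N - k)) /
     (\<Prod>k=1..<N. wp_ratio \<tau> (basis_point N \<tau> A 2) (basis_point N \<tau> A 1) k ^ (N - k))"

text \<open>The sign comes from the coordinate \<open>x - y * \<tau>\<close> of a column, which
  negates the second row. The bound \<open>2 < N\<close> keeps the doubled basis points outside the
  lattice.\<close>

lemma weil_product_eq:
  fixes A :: "zhat^2^2"
  assumes tau: "0 < Im \<tau>" and N: "even N" "2 < N" and A: "invertible A"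
  shows "weil_product N \<tau> A = expi (of_int (- 2 * residue (det A) N) / of_nat N)"
proof -
  let ?r = "\<lambda>i j. residue (A$i$j) N"
  let ?P = "basis_point N \<tau> A 1" and ?Q = "basis_point N \<tau> A 2"
  have N0: "0 < N" using N by simp
  note lat = basis_point_lattice[OF tau N0 A]
  have n1: "\<not> int N dvd 1" "\<not> int N dvd - 1" "\<not> int N dvd 2" using N by (auto dest: zdvd_imp_le)
  have "expi (of_int (2 * (?r 1 1 * (- ?r 2 2) - (- ?r 2 1) * ?r 1 2)) / of_nat N) = weil_product N \<tau> A"
    unfolding weil_product_def
  proof (rule weil_pairing_product[OF tau N(1)])
    show "of_nat N * ?P = of_int (?r 1 1) + of_int (- ?r 2 1) * \<tau>" "of_nat N * ?Q = of_int (?r 1 2) + of_int (- ?r 2 2) * \<tau>"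
      using N0 by (simp_all add: basis_point_def)
    show "2 * ?P \<notin> lattice \<tau>" using lat(1)[of 2 0] n1 by auto
    show "2 * ?Q \<notin> lattice \<tau>" using lat(2)[of 0 2] n1 by auto
    show "of_nat k * ?P + ?Q \<notin> lattice \<tau>" for k using lat(2)[of "int k" 1] n1 by auto
    show "of_nat k * ?P - ?Q \<notin> lattice \<tau>" for k using lat(2)[of "int k" "- 1"] n1 by auto
    show "of_nat k * ?Q + ?P \<notin> lattice \<tau>" for k using lat(1)[of 1 "int k"] n1 by (auto simp: add.commute)
    show "of_nat k * ?Q - ?P \<notin> lattice \<tau>" for k using lat(1)[of "- 1" "int k"] n1 by (auto simp: add.commute)
  qed (rule N0)
  moreover have "expi (of_int (2 * (?r 1 1 * (- ?r 2 2) - (- ?r 2 1) * ?r 1 2)) / of_nat N) =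
      expi (of_int (- 2 * residue (det A) N) / of_nat N)"
  proof -
    let ?d = "?r 1 1 * ?r 2 2 - ?r 1 2 * ?r 2 1"
    have "residue (det A) N = ?d mod int N" by (simp add: det_2 residue_minus residue_mult mod_diff_eq)
    then have "?d = int N * (?d div int N) + residue (det A) N" by simp
    then obtain t where t: "?d = int N * t + residue (det A) N" by blast
    have "2 * (?r 1 1 * (- ?r 2 2) - (- ?r 2 1) * ?r 1 2) = - 2 * ?d" by (simp add: algebra_simps)
    also have "\<dots> = int N * (- 2 * t) + - 2 * residue (det A) N" unfolding t by (simp add: algebra_simps)
    finally have e: "2 * (?r 1 1 * (- ?r 2 2) - (- ?r 2 1) * ?r 1 2) = int N * (- 2 * t) + - 2 * residue (det A) N" .
    have "of_int (2 * (?r 1 1 * (- ?r 2 2) - (- ?r 2 1) * ?r 1 2)) / of_nat N =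
        of_int (- 2 * t) + of_int (- 2 * residue (det A) N) / (of_nat N :: complex)"
      unfolding e using N0 by (simp add: field_simps)
    then show ?thesis by (simp only: expi_add expi_of_int mult_1_left)
  qed
  ultimately show ?thesis by simp
qed

section \<open>The Galois action on the component of a point\<close>

interpretation int_zhat: comm_ring_hom "of_int :: int \<Rightarrow> zhat"
  by unfold_locales simp_all

lemma canonical_actionD:
  assumes "canonical_action act"
  shows "\<sigma> \<in> Aut_C \<Longrightarrow> bij_betw (act \<sigma>) Shimura Shimura"
    and "\<sigma> \<in> Aut_C \<Longrightarrow> \<rho> \<in> Aut_C \<Longrightarrow> x \<in> Shimura \<Longrightarrow> act (\<sigma> \<circ> \<rho>) x = act \<sigma> (act \<rho> x)"
    and "\<sigma> \<in> Aut_C \<Longrightarrow> g \<in> GL2Af \<Longrightarrow> x \<in> Shimura \<Longrightarrow> act \<sigma> (hecke g x) = hecke g (act \<sigma> x)"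
    and "0 < N \<Longrightarrow> \<exists>\<phi>. canonical_model N \<phi> \<and> (\<forall>\<sigma>\<in>Aut_C. \<forall>x\<in>Shimura. \<phi> (act \<sigma> x) = \<sigma> \<circ> \<phi> x)"
  using assms unfolding canonical_action_def by blast+

text \<open>The class of \<open>(\<tau>, a)\<close> is a Hecke translate of that of
  \<open>(\<tau>, 1)\<close>, and the action commutes with Hecke operators.\<close>

lemma act_cls_mult:
  assumes act: "canonical_action act" and s: "\<sigma> \<in> Aut_C" and \<tau>: "Im \<tau> \<noteq> 0"
    and b: "act \<sigma> (cls \<tau> (mat 1)) = cls \<tau>' b" and a: "a \<in> GL2Af"
  shows "act \<sigma> (cls \<tau> a) = cls \<tau>' (b ** a)"
proof -
  have "cls \<tau> a = hecke (matrix_inv a) (cls \<tau> (mat 1))"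
    using hecke_inverse_cls[OF a, of \<tau> "mat 1"] by (simp add: matrix_mul_lid)
  moreover have "cls \<tau> (mat 1) \<in> Shimura"
    using \<tau> by (intro Shimura_cls) (simp_all add: GL2Af_def invertible_2_iff)
  ultimately have "act \<sigma> (cls \<tau> a) = hecke (matrix_inv a) (cls \<tau>' b)"
    using canonical_actionD(3)[OF act s GL2Af_inverse[OF a]] b by simp
  then show ?thesis using hecke_inverse_cls[OF a] by simp
qed

text \<open>An integral matrix \<open>g\<close> of unit determinant keeps the representatives on
  both sides in \<open>GL2Zhat\<close>, where the moduli property of the canonical model is
  available. The factor \<open>mat 1\<close> gives both level curves the shape expected by
  \<open>level_curve_x\<close>.\<close>

lemma galois_level_curve:
  fixes A :: "zhat^2^2" and g :: "int^2^2"
  assumes act: "canonical_action act" and s: "\<sigma> \<in> Aut_C" and \<tau>: "0 < Im \<tau>" "0 < Im \<tau>'"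
    and A: "invertible A" "act \<sigma> (cls \<tau> (mat 1)) = cls \<tau>' (map_matrix adele_of_zhat A)"
    and g: "det g dvd 1" and N: "0 < N"
  shows "iso_level_curve (conj_level_curve \<sigma> (level_curve_of N \<tau> (map_matrix adele_of_zhat (mat 1 ** map_matrix of_int g))))
    (level_curve_of N \<tau>' (map_matrix adele_of_zhat (A ** map_matrix of_int g)))"
proof -
  define G where "G = (map_matrix of_int g :: zhat^2^2)"
  have G: "invertible G" unfolding G_def using g by (intro int_zhat.invertible_map_matrix) (simp add: invertible_2_iff)
  define h where "h = map_matrix adele_of_zhat G"
  have h: "h \<in> GL2Zhat" "h \<in> GL2Af" using G GL2Zhat_GL2Af by (auto simp: h_def GL2Zhat_def)
  have Ah: "map_matrix adele_of_zhat A ** h = map_matrix adele_of_zhat (A ** G)"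
    by (simp add: h_def of_zhat.map_matrix_mult)
  have AG: "map_matrix adele_of_zhat (A ** G) \<in> GL2Zhat"
    using invertible_matrix_mult(1)[OF A(1) G] by (auto simp: GL2Zhat_def)
  obtain \<phi> where phi: "canonical_model N \<phi>" "\<forall>\<sigma>\<in>Aut_C. \<forall>x\<in>Shimura. \<phi> (act \<sigma> x) = \<sigma> \<circ> \<phi> x"
    using canonical_actionD(4)[OF act N] by blast
  have "cls \<tau> h \<in> Shimura" using \<tau> h by (intro Shimura_cls) auto
  then have "\<phi> (act \<sigma> (cls \<tau> h)) = \<sigma> \<circ> \<phi> (cls \<tau> h)" using phi(2) s by blast
  moreover have "act \<sigma> (cls \<tau> h) = cls \<tau>' (map_matrix adele_of_zhat (A ** G))"
    using act_cls_mult[OF act s _ A(2) h(2)] \<tau> by (simp add: Ah)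
  ultimately have "\<phi> (cls \<tau>' (map_matrix adele_of_zhat (A ** G))) = \<sigma> \<circ> \<phi> (cls \<tau> h)" by simp
  moreover have "\<tau> \<in> double_half_plane" "\<tau>' \<in> double_half_plane" using \<tau> by (auto simp: double_half_plane_iff)
  ultimately have "iso_level_curve (conj_level_curve \<sigma> (level_curve_of N \<tau> h)) (level_curve_of N \<tau>' (map_matrix adele_of_zhat (A ** G)))"
    using phi(1) s h(1) AG unfolding canonical_model_def by blast
  then show ?thesis by (simp add: G_def h_def matrix_mul_lid)
qed

text \<open>The isomorphism supplies a scaling \<open>u\<close> that could depend on
  \<open>g\<close>. Its square, however, is the quotient of \<open>u ^ 6\<close> and
  \<open>u ^ 4\<close>, which are read off from the Weierstrass coefficients alone.\<close>

lemma galois_torsion_x: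
  fixes A :: "zhat^2^2" and g :: "int^2^2"
  assumes act: "canonical_action act" and s: "\<sigma> \<in> Aut_C" and \<tau>: "0 < Im \<tau>" "0 < Im \<tau>'"
    and A: "invertible A" "act \<sigma> (cls \<tau> (mat 1)) = cls \<tau>' (map_matrix adele_of_zhat A)"
    and nz: "g2 \<tau> \<noteq> 0" "g3 \<tau> \<noteq> 0"
    and g: "det g dvd 1" and N: "0 < N"
    and z: "z = of_int (g$1$j) * basis_point N \<tau> (mat 1) 1 + of_int (g$2$j) * basis_point N \<tau> (mat 1) 2"
    and z': "z' = of_int (g$1$j) * basis_point N \<tau>' A 1 + of_int (g$2$j) * basis_point N \<tau>' A 2"
    and zL: "z \<notin> lattice \<tau>"
  shows "wp \<tau>' z' = (g3 \<tau>' / \<sigma> (g3 \<tau>)) / (g2 \<tau>' / \<sigma> (g2 \<tau>)) * \<sigma> (wp \<tau> z)"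
    and "(g3 \<tau>' / \<sigma> (g3 \<tau>)) / (g2 \<tau>' / \<sigma> (g2 \<tau>)) \<noteq> 0"
proof -
  let ?L = "level_curve_of N \<tau> (map_matrix adele_of_zhat (mat 1 ** map_matrix of_int g))"
  let ?L' = "level_curve_of N \<tau>' (map_matrix adele_of_zhat (A ** map_matrix of_int g))"
  have L: "fst ?L = g2 \<tau>" "fst (snd ?L) = g3 \<tau>" "fst ?L' = g2 \<tau>'" "fst (snd ?L') = g3 \<tau>'"
    by (simp_all add: level_curve_of_def)
  obtain u where u: "u \<noteq> 0" "fst ?L' = u ^ 4 * \<sigma> (fst ?L)" "fst (snd ?L') = u ^ 6 * \<sigma> (fst (snd ?L))"
    "\<forall>j. snd (snd ?L') j = map_option (\<lambda>(x, y). (u ^ 2 * x, u ^ 3 * y)) (map_option (map_prod \<sigma> \<sigma>) (snd (snd ?L) j))"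
    using galois_level_curve[OF act s \<tau> A g N]
    unfolding iso_level_curve_def conj_level_curve_def by (auto simp: split_beta)
  have g: "g2 \<tau>' / \<sigma> (g2 \<tau>) = u ^ 4" "g3 \<tau>' / \<sigma> (g3 \<tau>) = u ^ 6"
    using u(2,3) nz unfolding L by (simp_all add: Aut_CD(9)[OF s])
  have c: "(g3 \<tau>' / \<sigma> (g3 \<tau>)) / (g2 \<tau>' / \<sigma> (g2 \<tau>)) = u ^ 2"
    unfolding g using u(1) by (simp add: field_simps power_add[symmetric])
  show "(g3 \<tau>' / \<sigma> (g3 \<tau>)) / (g2 \<tau>' / \<sigma> (g2 \<tau>)) \<noteq> 0" unfolding c using u(1) by simp
  have "map_option fst (snd (snd ?L') j) = map_option (\<lambda>x. u ^ 2 * \<sigma> x) (map_option fst (snd (snd ?L) j))"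
    unfolding u(4)[rule_format] by (simp add: option.map_comp o_def split_beta)
  then have "(if z' \<in> lattice \<tau>' then None else Some (wp \<tau>' z')) =
      map_option (\<lambda>x. u ^ 2 * \<sigma> x) (if z \<in> lattice \<tau> then None else Some (wp \<tau> z))"
    unfolding level_curve_x[OF \<tau>(1) N z] level_curve_x[OF \<tau>(2) N z'] .
  then show "wp \<tau>' z' = (g3 \<tau>' / \<sigma> (g3 \<tau>)) / (g2 \<tau>' / \<sigma> (g2 \<tau>)) * \<sigma> (wp \<tau> z)"
    unfolding c using zL by (simp split: if_splits)
qed

text \<open>Every point in the product has a coefficient 1 or -1 in the basis. It is therefore the
  first column of a matrix of unit determinant, whose second column is chosen for that purpose, and
  it is not a lattice point. The common scaling cancels in each ratio.\<close>

lemma galois_weil_product: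
  fixes A :: "zhat^2^2"
  assumes act: "canonical_action act" and s: "\<sigma> \<in> Aut_C" and \<tau>: "0 < Im \<tau>" "0 < Im \<tau>'"
    and A: "invertible A" "act \<sigma> (cls \<tau> (mat 1)) = cls \<tau>' (map_matrix adele_of_zhat A)"
    and nz: "g2 \<tau> \<noteq> 0" "g3 \<tau> \<noteq> 0" and N: "2 < N"
  shows "weil_product N \<tau>' A = \<sigma> (weil_product N \<tau> (mat 1))"
proof -
  have N0: "0 < N" using N by simp
  define c where "c = (g3 \<tau>' / \<sigma> (g3 \<tau>)) / (g2 \<tau>' / \<sigma> (g2 \<tau>))"
  let ?P = "basis_point N \<tau> (mat 1) 1" and ?Q = "basis_point N \<tau> (mat 1) 2"
  let ?P' = "basis_point N \<tau>' A 1" and ?Q' = "basis_point N \<tau>' A 2"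
  have I: "invertible (mat 1 :: zhat^2^2)" by (simp add: invertible_2_iff)
  have n1: "\<not> int N dvd 1" "\<not> int N dvd - 1" using N by (auto dest: zdvd_imp_le)
  note lat = basis_point_lattice[OF \<tau>(1) N0 I]
  note gal = galois_torsion_x[OF act s \<tau> A nz _ N0 refl refl, where j = 1]
  have c0: "c \<noteq> 0"
    unfolding c_def
    by (rule gal(2)[of "mat 1"]) (use lat(1)[of 1 0] n1 in auto)
  have P: "wp \<tau>' ?P' = c * \<sigma> (wp \<tau> ?P)"
    using gal(1)[of "mat 1"] lat(1)[of 1 0] n1 by (auto simp: c_def)
  have Q: "wp \<tau>' ?Q' = c * \<sigma> (wp \<tau> ?Q)"
    \<comment> \<open>The permutation matrix brings the second basis point into the first
      column.\<close>
    using gal(1)[of "mat2 0 1 1 0"] lat(2)[of 0 1] n1 by (auto simp: c_def det_2)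
  have 1: "wp \<tau>' (of_nat k * ?P' + ?Q') = c * \<sigma> (wp \<tau> (of_nat k * ?P + ?Q))" for k
    using gal(1)[of "mat2 (int k) 1 1 0"] lat(2)[of "int k" 1] n1 by (auto simp: c_def det_2)
  have 2: "wp \<tau>' (of_nat k * ?P' - ?Q') = c * \<sigma> (wp \<tau> (of_nat k * ?P - ?Q))" for k
    using gal(1)[of "mat2 (int k) 1 (- 1) 0"] lat(2)[of "int k" "- 1"] n1 by (auto simp: c_def det_2)
  have 3: "wp \<tau>' (of_nat k * ?Q' + ?P') = c * \<sigma> (wp \<tau> (of_nat k * ?Q + ?P))" for k
    using gal(1)[of "mat2 1 0 (int k) 1"] lat(1)[of 1 "int k"] n1 by (auto simp: c_def det_2 add.commute)
  have 4: "wp \<tau>' (of_nat k * ?Q' - ?P') = c * \<sigma> (wp \<tau> (of_nat k * ?Q - ?P))" for k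
    using gal(1)[of "mat2 (- 1) 0 (int k) 1"] lat(1)[of "- 1" "int k"] n1 by (auto simp: c_def det_2 add.commute)
  have ratio: "(c * \<sigma> x - c * \<sigma> y) / (c * \<sigma> v - c * \<sigma> y) = \<sigma> ((x - y) / (v - y))" for x y v
    using c0 by (simp add: Aut_CD(7,8)[OF s] right_diff_distrib[symmetric])
  have "wp_ratio \<tau>' ?P' ?Q' k = \<sigma> (wp_ratio \<tau> ?P ?Q k)" "wp_ratio \<tau>' ?Q' ?P' k = \<sigma> (wp_ratio \<tau> ?Q ?P k)" for k
    unfolding wp_ratio_def P Q 1 2 3 4 by (rule ratio)+
  then show ?thesis
    by (simp add: weil_product_def Aut_CD(6,8,10)[OF s])
qed

text \<open>On one side the Weil product of the conjugate curve is a root of unity with exponent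
  \<open>det A\<close>; on the other it is the image under \<open>\<sigma>\<close> of a root of
  unity of the same order, which the character raises to the power \<open>\<mu>\<close>.\<close>

lemma galois_det_integral:
  fixes A :: "zhat^2^2"
  assumes act: "canonical_action act" and s: "\<sigma> \<in> Aut_C" "raises_roots \<sigma> \<mu>" and \<tau>: "0 < Im \<tau>" "0 < Im \<tau>'"
    and A: "invertible A" "act \<sigma> (cls \<tau> (mat 1)) = cls \<tau>' (map_matrix adele_of_zhat A)"
    and nz: "g2 \<tau> \<noteq> 0" "g3 \<tau> \<noteq> 0"
  shows "det A = \<mu>"
proof (rule zhat_eqI)
  fix n :: nat assume n: "0 < n"
  \<comment> \<open>The product has twice the determinant in its exponent, so level
    \<open>4 * n\<close> shows the determinant modulo \<open>2 * n\<close>. It is also even and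
    larger than 2 for every positive \<open>n\<close>.\<close>
  define N where "N = 4 * n"
  have N: "even N" "2 < N" "N = 2 * (2 * n)" "0 < N" using n by (auto simp: N_def)
  define R where "R = residue (det A) N"
  define m where "m = residue \<mu> (2 * n)"
  have m0: "0 \<le> m" using residue_bounds(1)[of "2 * n"] n by (simp add: m_def)
  have I: "invertible (mat 1 :: zhat^2^2)" by (simp add: invertible_2_iff)
  have half: "expi (of_int (- 2 * k) / of_nat N) = expi (of_int (- k) / of_nat (2 * n))" for k
    using n by (simp add: N(3))
  have "residue (det (mat 1 :: zhat^2^2)) N = 1" using residue_of_int[OF N(4), of 1] N(2) by simp
  then have "weil_product N \<tau> (mat 1) = expi (of_int (- 1) / of_nat (2 * n))"
    using weil_product_eq[OF \<tau>(1) N(1,2) I] half[of 1] by simp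
  moreover have "weil_product N \<tau>' A = expi (of_int (- R) / of_nat (2 * n))"
    using weil_product_eq[OF \<tau>(2) N(1,2) A(1)] half[of R] by (simp add: R_def)
  moreover have "\<sigma> (expi (of_int (- 1) / of_nat (2 * n))) = expi (of_int (- m) / of_nat (2 * n))"
  proof -
    let ?z = "expi (of_int (- 1) / of_nat (2 * n))"
    have "?z ^ (2 * n) = expi (of_int (- 1))" unfolding expi_power using n by simp
    then have "?z ^ (2 * n) = 1" by (simp only: expi_of_int)
    then have "\<sigma> ?z = ?z ^ nat m" using s(2) n by (simp add: raises_roots_def m_def)
    also have "\<dots> = expi (of_int (- m) / of_nat (2 * n))" unfolding expi_power using m0 by simp
    finally show ?thesis .
  qed
  ultimately have "expi (of_int (- R) / of_nat (2 * n)) = expi (of_int (- m) / of_nat (2 * n))"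
    using galois_weil_product[OF act s(1) \<tau> A nz N(2)] by simp
  then have "expi (of_int (- R) / of_nat (2 * n) - of_int (- m) / of_nat (2 * n)) = 1"
    by (simp only: expi_diff) simp
  then obtain k where "of_int (- R) / of_nat (2 * n) - of_int (- m) / of_nat (2 * n) = (of_int k :: complex)"
    unfolding expi_eq_1_iff by blast
  then have "(of_int (m - R) :: complex) = of_int (k * int (2 * n))"
    using n by (simp add: field_simps)
  then have "m - R = k * int (2 * n)" unfolding of_int_eq_iff .
  then have mR: "m = R + int n * (2 * k)" by (simp add: algebra_simps)
  have "residue \<mu> n = m mod int n" using residue_dvd[of "2 * n" n \<mu>] n by (simp add: m_def)
  moreover have "residue (det A) n = R mod int n" using residue_dvd[of N n "det A"] n by (simp add: R_def N_def)
  ultimately show "residue (det A) n = residue \<mu> n" by (simp add: mR)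
qed

text \<open>The integral case is applied to \<open>n * \<tau>\<close>, with \<open>n\<close> so
  large that both Weierstrass coefficients are nonzero. Returning to \<open>\<tau>\<close>
  multiplies the matrix by the rational diagonal matrix \<open>D\<close>, and \<open>q = n\<close>
  is its determinant.\<close>

lemma galois_det:
  assumes act: "canonical_action act" and s: "\<sigma> \<in> Aut_C" "raises_roots \<sigma> \<mu>" and \<tau>: "0 < Im \<tau>"
  obtains \<tau>' b q where "0 < Im \<tau>'" "b \<in> GL2Af" "act \<sigma> (cls \<tau> (mat 1)) = cls \<tau>' b" "0 < q"
    "det b = adele_of_zhat \<mu> * adele_of_rat q"
proof -
  obtain K4 where K4: "\<forall>n\<ge>K4. eisenstein 4 (of_nat n * \<tau>) \<noteq> 0" by (rule eisenstein_nonzero[OF \<tau>, of 4]) auto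
  obtain K6 where K6: "\<forall>n\<ge>K6. eisenstein 6 (of_nat n * \<tau>) \<noteq> 0" by (rule eisenstein_nonzero[OF \<tau>, of 6]) auto
  define n where "n = K4 + K6 + 1"
  define \<tau>0 where "\<tau>0 = of_nat n * \<tau>"
  have n: "0 < n" by (simp add: n_def)
  have "K4 \<le> n" "K6 \<le> n" by (simp_all add: n_def)
  then have nz: "g2 \<tau>0 \<noteq> 0" "g3 \<tau>0 \<noteq> 0" using K4 K6 by (simp_all add: g2_def g3_def \<tau>0_def)
  have \<tau>0: "0 < Im \<tau>0" using \<tau> n by (simp add: \<tau>0_def)
  have one: "(mat 1 :: adelic_matrix) \<in> GL2Af" by (simp add: GL2Af_def invertible_2_iff)
  have "cls \<tau>0 (mat 1) \<in> Shimura" using \<tau>0 one by (intro Shimura_cls) auto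
  then have "act \<sigma> (cls \<tau>0 (mat 1)) \<in> Shimura"
    using canonical_actionD(1)[OF act s(1)] by (auto dest: bij_betwE)
  then obtain \<tau>' A where A: "0 < Im \<tau>'" "invertible A" "act \<sigma> (cls \<tau>0 (mat 1)) = cls \<tau>' (map_matrix adele_of_zhat A)"
    by (rule Shimura_representative)
  have detA: "det A = \<mu>" by (rule galois_det_integral[OF act s \<tau>0 A nz])
  define D where "D = (mat2 (of_nat n) 0 0 1 :: rat^2^2)"
  have D: "D \<in> GL2Q" using n by (simp add: GL2Q_det D_def det_2)
  have "mobius D \<tau> = \<tau>0" by (simp add: mobius_def D_def \<tau>0_def)
  then have "cls \<tau> (mat 1) = cls \<tau>0 (map_matrix adele_of_rat D)"
    using cls_mobius[OF D, of \<tau> "mat 1"] \<tau> by (simp add: matrix_mul_rid)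
  then have eq: "act \<sigma> (cls \<tau> (mat 1)) = cls \<tau>' (map_matrix adele_of_zhat A ** map_matrix adele_of_rat D)"
    using act_cls_mult[OF act s(1) _ A(3) GL2Q_GL2Af[OF D]] \<tau>0 by simp
  show ?thesis
  proof (rule that[OF A(1) _ eq])
    show "map_matrix adele_of_zhat A ** map_matrix adele_of_rat D \<in> GL2Af"
      by (intro GL2Af_mult GL2Q_GL2Af[OF D] GL2Zhat_GL2Af) (use A(2) in \<open>auto simp: GL2Zhat_def\<close>)
    show "0 < (of_nat n :: rat)" using n by simp
    show "det (map_matrix adele_of_zhat A ** map_matrix adele_of_rat D) = adele_of_zhat \<mu> * adele_of_rat (of_nat n)"
      by (simp only: det_mul of_zhat.det_map_matrix of_ratA.det_map_matrix detA) (simp add: D_def det_2)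
  qed
qed

section \<open>Transport of graphs\<close>

definition diag_unit :: "zhat \<Rightarrow> adelic_matrix" where
  "diag_unit \<mu> = mat2 (adele_of_zhat \<mu>) 0 0 1"

lemma diag_unit_mult: "diag_unit \<mu> ** diag_unit \<nu> = diag_unit (\<mu> * \<nu>)"
  by (simp add: diag_unit_def mat2_eq_iff mat2_mult_nth of_zhat.mult)

lemma diag_unit_1: "diag_unit 1 = mat 1"
  by (simp add: diag_unit_def mat2_eq_iff of_zhat.one)

lemma det_diag_unit: "det (diag_unit \<mu>) = adele_of_zhat \<mu>"
  by (simp add: diag_unit_def det_2)

lemma diag_unit_inverse:
  assumes "\<mu> * \<nu> = 1"
  shows "diag_unit \<mu> ** diag_unit \<nu> = mat 1" "diag_unit \<nu> ** diag_unit \<mu> = mat 1"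
    "matrix_inv (diag_unit \<mu>) = diag_unit \<nu>" "diag_unit \<mu> \<in> GL2Af"
proof -
  show 1: "diag_unit \<mu> ** diag_unit \<nu> = mat 1" and 2: "diag_unit \<nu> ** diag_unit \<mu> = mat 1"
    using assms by (simp_all add: diag_unit_mult diag_unit_1 mult.commute)
  show "matrix_inv (diag_unit \<mu>) = diag_unit \<nu>" by (rule matrix_inv_eqI[OF 1 2])
  show "diag_unit \<mu> \<in> GL2Af" using 1 2 unfolding GL2Af_def invertible_def by blast
qed

lemma zhat_units_iff: "\<mu> \<in> zhat_units \<longleftrightarrow> (\<exists>\<nu>. \<mu> * \<nu> = 1)"
  unfolding zhat_units_def dvd_def mem_Collect_eq by (rule ex_cong1) (rule eq_commute)

lemma zhat_unitsI:
  assumes "\<mu> * \<nu> = 1" shows "\<mu> \<in> zhat_units" "\<nu> \<in> zhat_units"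
  using assms unfolding zhat_units_def by (metis dvd_triv_left dvd_triv_right mem_Collect_eq)+

lemma Delta_eq: "Delta = diag_unit ` zhat_units"
  unfolding Delta_def diag_unit_def by blast

lemma Delta_orbit_cls: "Delta_orbit (cls \<tau> a) = (\<lambda>\<nu>. cls \<tau> (a ** diag_unit \<nu>)) ` zhat_units"
proof -
  have "Delta_orbit (cls \<tau> a) = (\<lambda>\<mu>. cls \<tau> (a ** matrix_inv (diag_unit \<mu>))) ` zhat_units"
    unfolding Delta_orbit_def Delta_eq image_image hecke_cls ..
  also have "\<dots> = (\<lambda>\<nu>. cls \<tau> (a ** diag_unit \<nu>)) ` zhat_units"
  proof (intro equalityI subsetI)
    fix x assume "x \<in> (\<lambda>\<mu>. cls \<tau> (a ** matrix_inv (diag_unit \<mu>))) ` zhat_units"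
    then obtain \<mu> \<nu> where mn: "\<mu> * \<nu> = 1" and x: "x = cls \<tau> (a ** matrix_inv (diag_unit \<mu>))"
      by (auto simp: zhat_units_iff)
    show "x \<in> (\<lambda>\<nu>. cls \<tau> (a ** diag_unit \<nu>)) ` zhat_units"
      unfolding x diag_unit_inverse(3)[OF mn] using zhat_unitsI(2)[OF mn] by (rule imageI)
  next
    fix x assume "x \<in> (\<lambda>\<nu>. cls \<tau> (a ** diag_unit \<nu>)) ` zhat_units"
    then obtain \<mu> \<nu> where mn: "\<nu> * \<mu> = 1" and x: "x = cls \<tau> (a ** diag_unit \<nu>)"
      by (auto simp: zhat_units_iff)
    have nm: "\<mu> * \<nu> = 1" using mn by (simp add: mult.commute)
    show "x \<in> (\<lambda>\<mu>. cls \<tau> (a ** matrix_inv (diag_unit \<mu>))) ` zhat_units"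
      unfolding x diag_unit_inverse(3)[OF nm, symmetric] using zhat_unitsI(1)[OF nm] by (rule imageI)
  qed
  finally show ?thesis .
qed

lemma zhat_units_mult: "\<mu> \<in> zhat_units \<Longrightarrow> \<nu> \<in> zhat_units \<Longrightarrow> \<mu> * \<nu> \<in> zhat_units"
  unfolding zhat_units_def using mult_dvd_mono[of \<mu> 1 \<nu> 1] by simp

lemma Delta_orbit_diag_unit:
  assumes "\<mu> * \<nu> = 1"
  shows "Delta_orbit (cls \<tau> (a ** diag_unit \<mu>)) = Delta_orbit (cls \<tau> a)"
proof -
  have u: "\<mu> \<in> zhat_units" "\<nu> \<in> zhat_units" using assms by (auto simp: zhat_units_iff mult.commute)
  have "(\<lambda>\<kappa>. \<mu> * \<kappa>) ` zhat_units = zhat_units"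
  proof (intro equalityI subsetI)
    fix \<kappa> assume k: "\<kappa> \<in> zhat_units"
    have "\<kappa> = \<mu> * (\<nu> * \<kappa>)" using assms by (simp add: mult.assoc[symmetric])
    then show "\<kappa> \<in> (\<lambda>\<kappa>. \<mu> * \<kappa>) ` zhat_units" using zhat_units_mult[OF u(2) k] by blast
  qed (use zhat_units_mult[OF u(1)] in auto)
  then have "(\<lambda>\<kappa>. cls \<tau> (a ** diag_unit \<kappa>)) ` zhat_units = (\<lambda>\<kappa>. cls \<tau> (a ** diag_unit \<kappa>)) ` (\<lambda>\<kappa>. \<mu> * \<kappa>) ` zhat_units"
    by simp
  then show ?thesis
    unfolding Delta_orbit_cls image_image by (simp add: diag_unit_mult matrix_mul_assoc[symmetric])
qed

lemma act_Delta_orbit: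
  assumes act: "canonical_action act" and s: "\<sigma> \<in> Aut_C" and x: "x \<in> Shimura"
  shows "act \<sigma> ` Delta_orbit x = Delta_orbit (act \<sigma> x)"
proof -
  have "act \<sigma> (hecke d x) = hecke d (act \<sigma> x)" if "d \<in> Delta" for d
    using canonical_actionD(3)[OF act s _ x, of d] diag_unit_inverse(4) that
    unfolding Delta_eq by (auto simp: zhat_units_iff)
  then show ?thesis unfolding Delta_orbit_def image_image by (auto simp: image_iff)
qed

lemma Delta_orbit_subset_Shimura:
  assumes "Im \<tau> \<noteq> 0" "a \<in> GL2Af" shows "Delta_orbit (cls \<tau> a) \<subseteq> Shimura"
  unfolding Delta_orbit_cls
  using assms diag_unit_inverse(4) by (auto simp: zhat_units_iff intro!: Shimura_cls GL2Af_mult)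

text \<open>The conjugate of \<open>h\<close> by the diagonal matrix of \<open>\<mu>\<close>, with
  \<open>\<nu>\<close> standing for the inverse of \<open>\<mu>\<close>. Exchanging the two
  arguments undoes it.\<close>

definition diag_conj :: "zhat \<Rightarrow> zhat \<Rightarrow> adelic_matrix \<Rightarrow> adelic_matrix" where
  "diag_conj \<mu> \<nu> h = diag_unit \<mu> ** h ** diag_unit \<nu>"

lemma diag_conj_mat2:
  assumes "\<mu> * \<nu> = 1"
  shows "diag_conj \<mu> \<nu> (mat2 a b c d) = mat2 a (adele_of_zhat \<mu> * b) (adele_of_zhat \<nu> * c) d"
proof -
  have "adele_of_zhat \<mu> * adele_of_zhat \<nu> = 1" using assms by (simp add: of_zhat.mult[symmetric] of_zhat.one)
  then have "adele_of_zhat \<mu> * a * adele_of_zhat \<nu> = a" by (simp add: mult_ac)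
  then show ?thesis
    by (simp add: diag_conj_def mat2_eq_iff mat2_mult_nth diag_unit_def mult_ac)
qed

lemma diag_conj_diag_conj:
  assumes "\<mu> * \<nu> = 1" shows "diag_conj \<nu> \<mu> (diag_conj \<mu> \<nu> h) = h"
proof -
  have "diag_conj \<nu> \<mu> (diag_conj \<mu> \<nu> h) = (diag_unit \<nu> ** diag_unit \<mu>) ** h ** (diag_unit \<nu> ** diag_unit \<mu>)"
    unfolding diag_conj_def by (simp only: matrix_mul_assoc)
  then show ?thesis unfolding diag_unit_inverse[OF assms] by (simp add: matrix_mul_lid matrix_mul_rid)
qed

lemma Gtilde_GL2Af: "h \<in> Gtilde \<Longrightarrow> h \<in> GL2Af"
proof -
  assume "h \<in> Gtilde"
  then obtain q s where q: "0 < q" "det s = 1" "h = mat2 (adele_of_rat q) 0 0 1 ** s"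
    unfolding Gtilde_def by blast
  then have "det h * adele_of_rat (inverse q) = 1"
    using adele_of_rat_inverse[of q] by (simp add: det_mul) (simp add: det_2)
  then show "h \<in> GL2Af" unfolding GL2Af_def mem_Collect_eq invertible_2_iff by (metis dvd_triv_left)
qed

text \<open>Diagonal matrices commute, so conjugation only changes the factor of determinant
  1.\<close>

lemma Gtilde_diag_conj:
  assumes mn: "\<mu> * \<nu> = 1" and h: "h \<in> Gtilde" shows "diag_conj \<mu> \<nu> h \<in> Gtilde"
proof -
  obtain q s where q: "0 < q" "det s = 1" "h = mat2 (adele_of_rat q) 0 0 1 ** s"
    using h unfolding Gtilde_def by blast
  have comm: "diag_unit \<mu> ** mat2 (adele_of_rat q) 0 0 1 = mat2 (adele_of_rat q) 0 0 1 ** diag_unit \<mu>"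
    by (simp add: mat2_eq_iff mat2_mult_nth diag_unit_def mult.commute)
  have "diag_conj \<mu> \<nu> h = mat2 (adele_of_rat q) 0 0 1 ** (diag_unit \<mu> ** s ** diag_unit \<nu>)"
    unfolding diag_conj_def q(3) by (simp only: matrix_mul_assoc comm)
  moreover have "det (diag_unit \<mu> ** s ** diag_unit \<nu>) = 1"
    using mn q(2) by (simp add: det_mul det_diag_unit of_zhat.mult[symmetric] of_zhat.one)
  ultimately show ?thesis using q(1) unfolding Gtilde_def by blast
qed

text \<open>The image of \<open>(\<tau>, a)\<close> is \<open>(\<tau>', b ** a)\<close>, whose
  determinant is \<open>\<mu>\<close> times a positive rational. Before \<open>h\<close> can act,
  the representative has to be corrected by the diagonal matrix of \<open>\<mu>\<close>; moving this
  matrix past the inverse of \<open>h\<close> is the conjugation.\<close>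

lemma transport_graph_subset:
  assumes act: "canonical_action act" and s: "\<sigma> \<in> Aut_C" "raises_roots \<sigma> \<mu>" and mn: "\<mu> * \<nu> = 1"
    and h: "h \<in> GL2Af"
  shows "transport (act \<sigma>) (graph h) \<subseteq> graph (diag_conj \<mu> \<nu> h)"
proof
  fix p assume "p \<in> transport (act \<sigma>) (graph h)"
  then obtain \<tau> a r where \<tau>: "0 < Im \<tau>" and a: "a \<in> GL2Af" and r: "0 < r" "det a = adele_of_rat r"
    and p: "p = (act \<sigma> ` Delta_orbit (cls \<tau> a), act \<sigma> ` Delta_orbit (cls \<tau> (a ** matrix_inv h)))"
    unfolding transport_def graph_def by auto
  have nm: "\<nu> * \<mu> = 1" using mn by (simp add: mult.commute)
  obtain \<tau>' b q where b: "0 < Im \<tau>'" "b \<in> GL2Af" "act \<sigma> (cls \<tau> (mat 1)) = cls \<tau>' b" "0 < q"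
    "det b = adele_of_zhat \<mu> * adele_of_rat q"
    by (rule galois_det[OF act s \<tau>])
  \<comment> \<open>The factor \<open>\<nu>\<close> removes \<open>\<mu>\<close> from the
    determinant without changing the orbit under \<open>Delta\<close>, so \<open>a'\<close> is an
    admissible representative in the graph.\<close>
  define a' where "a' = b ** a ** diag_unit \<nu>"
  have a': "a' \<in> GL2Af"
    unfolding a'_def using b(2) a diag_unit_inverse(4)[OF nm] by (intro GL2Af_mult)
  have ba: "b ** a = a' ** diag_unit \<mu>"
    unfolding a'_def by (simp only: matrix_mul_assoc[symmetric] diag_unit_inverse(1)[OF nm] matrix_mul_rid)
  have ah: "a ** matrix_inv h \<in> GL2Af" using a h by (intro GL2Af_mult GL2Af_inverse)
  have orb: "act \<sigma> ` Delta_orbit (cls \<tau> x) = Delta_orbit (cls \<tau>' (b ** x))" if "x \<in> GL2Af" for x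
    using act_Delta_orbit[OF act s(1) Shimura_cls[OF _ that]] act_cls_mult[OF act s(1) _ b(3) that] \<tau> by simp
  have 1: "act \<sigma> ` Delta_orbit (cls \<tau> a) = Delta_orbit (cls \<tau>' a')"
    unfolding orb[OF a] ba by (rule Delta_orbit_diag_unit[OF mn])
  have "matrix_inv (diag_conj \<mu> \<nu> h) = diag_unit \<mu> ** matrix_inv h ** diag_unit \<nu>"
  proof -
    have inv: "invertible (diag_unit \<mu>)" "invertible (diag_unit \<nu>)" "invertible h"
      using diag_unit_inverse(4)[OF mn] diag_unit_inverse(4)[OF nm] h by (auto simp: GL2Af_def)
    then show ?thesis
      unfolding diag_conj_def
      by (simp add: invertible_matrix_mult diag_unit_inverse(3)[OF mn] diag_unit_inverse(3)[OF nm] matrix_mul_assoc)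
  qed
  then have "b ** (a ** matrix_inv h) = (a' ** matrix_inv (diag_conj \<mu> \<nu> h)) ** diag_unit \<mu>"
    using ba by (simp add: matrix_mul_assoc) (simp add: matrix_mul_assoc[symmetric] diag_unit_inverse(1)[OF nm] matrix_mul_rid)
  then have 2: "act \<sigma> ` Delta_orbit (cls \<tau> (a ** matrix_inv h)) = Delta_orbit (cls \<tau>' (a' ** matrix_inv (diag_conj \<mu> \<nu> h)))"
    unfolding orb[OF ah] using Delta_orbit_diag_unit[OF mn] by simp
  have "adele_of_zhat \<mu> * adele_of_zhat \<nu> = 1" using mn by (simp add: of_zhat.mult[symmetric] of_zhat.one)
  then have "det a' = adele_of_rat (q * r)"
    unfolding a'_def by (simp add: det_mul b(5) r(2) det_diag_unit of_ratA.mult mult_ac)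
  moreover have "0 < q * r" using b(4) r(1) by simp
  ultimately show "p \<in> graph (diag_conj \<mu> \<nu> h)"
    unfolding p 1 2 graph_def using b(1) a' by blast
qed

text \<open>That the identity acts trivially follows from
  \<open>act id (act id x) = act id x\<close> and injectivity.\<close>

lemma act_inverse:
  assumes act: "canonical_action act" and s: "\<sigma> \<in> Aut_C" and x: "x \<in> Shimura"
  shows "act \<sigma> (act (inv \<sigma>) x) = x"
proof -
  have id: "id \<in> Aut_C" by (simp add: Aut_C_def)
  note b = canonical_actionD(1)[OF act id]
  have "act id (act id x) = act id x" using canonical_actionD(2)[OF act id id x] by simp
  moreover have "act id x \<in> Shimura" using b x by (auto dest: bij_betwE)
  ultimately have "act id x = x" using b x by (meson bij_betw_def inj_onD)
  moreover have "\<sigma> \<circ> inv \<sigma> = id" using Aut_CD(1)[OF s] by (meson bij_is_surj surj_iff)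
  ultimately show ?thesis using canonical_actionD(2)[OF act s Aut_C_inv[OF s] x] by simp
qed

lemma zhat_inverse_eq:
  assumes "\<mu> * \<nu> = 1" shows "zhat_inverse \<mu> = \<nu>"
  unfolding zhat_inverse_def
proof (rule the_equality)
  show "\<mu> * \<nu> = 1" by (rule assms)
  fix \<kappa> assume k: "\<mu> * \<kappa> = 1"
  have "\<kappa> = \<kappa> * (\<mu> * \<nu>)" by (simp add: assms)
  also have "\<dots> = (\<mu> * \<kappa>) * \<nu>" by (simp only: mult_ac)
  finally show "\<kappa> = \<nu>" by (simp add: k)
qed

text \<open>The reverse inclusion is the forward one for the inverse automorphism, whose character
  is \<open>\<nu>\<close> and which conjugates back to \<open>h\<close>.\<close>

lemma transport_graph:
  assumes act: "canonical_action act" and s: "\<sigma> \<in> Aut_C" "raises_roots \<sigma> \<mu>" and mn: "\<mu> * \<nu> = 1"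
    and h: "h \<in> Gtilde"
  shows "transport (act \<sigma>) (graph h) = graph (diag_conj \<mu> \<nu> h)"
proof
  show "transport (act \<sigma>) (graph h) \<subseteq> graph (diag_conj \<mu> \<nu> h)"
    by (rule transport_graph_subset[OF act s mn Gtilde_GL2Af[OF h]])
  let ?h = "diag_conj \<mu> \<nu> h"
  have h': "?h \<in> GL2Af" by (rule Gtilde_GL2Af[OF Gtilde_diag_conj[OF mn h]])
  obtain \<kappa> where k: "raises_roots (inv \<sigma>) \<kappa>" "\<mu> * \<kappa> = 1" by (rule raises_roots_inverse[OF s])
  have "\<kappa> = \<nu>" using zhat_inverse_eq[OF k(2)] zhat_inverse_eq[OF mn] by simp
  then have n: "raises_roots (inv \<sigma>) \<nu>" using k(1) by simp
  have nm: "\<nu> * \<mu> = 1" using mn by (simp add: mult.commute)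
  have sub: "transport (act (inv \<sigma>)) (graph ?h) \<subseteq> graph h"
    using transport_graph_subset[OF act Aut_C_inv[OF s(1)] n nm h'] diag_conj_diag_conj[OF mn] by simp
  show "graph ?h \<subseteq> transport (act \<sigma>) (graph h)"
  proof
    fix p assume p: "p \<in> graph ?h"
    then obtain \<tau> a where a: "0 < Im \<tau>" "a \<in> GL2Af"
      and pe: "p = (Delta_orbit (cls \<tau> a), Delta_orbit (cls \<tau> (a ** matrix_inv ?h)))"
      unfolding graph_def by blast
    have S: "Delta_orbit (cls \<tau> a) \<subseteq> Shimura" "Delta_orbit (cls \<tau> (a ** matrix_inv ?h)) \<subseteq> Shimura"
      using a h' by (auto intro!: Delta_orbit_subset_Shimura GL2Af_mult GL2Af_inverse del: subsetI)
    have undo: "act \<sigma> ` act (inv \<sigma>) ` X = X" if "X \<subseteq> Shimura" for X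
      using act_inverse[OF act s(1)] that by (force simp: image_image)
    define p' where "p' = (act (inv \<sigma>) ` fst p, act (inv \<sigma>) ` snd p)"
    have "p' \<in> graph h" using sub p unfolding transport_def p'_def by (force simp: split_beta)
    moreover have "p = (act \<sigma> ` fst p', act \<sigma> ` snd p')"
      unfolding p'_def pe using S by (simp add: undo)
    ultimately show "p \<in> transport (act \<sigma>) (graph h)"
      unfolding transport_def by (auto simp: split_beta intro!: image_eqI[of _ _ p'])
  qed
qed

theorem mainTheorem4:
  fixes act :: "(complex \<Rightarrow> complex) \<Rightarrow> shimura_point \<Rightarrow> shimura_point"
  assumes "canonical_action act"
  shows
    "(\<forall>\<sigma>\<in>Aut_C. \<exists>!\<mu>. cyclotomic (restrict \<sigma> Q_ab) \<mu>) \<and>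
     (\<forall>\<mu>\<in>zhat_units. \<exists>\<sigma>\<in>Aut_C. cyclotomic (restrict \<sigma> Q_ab) \<mu>) \<and>
     (\<forall>\<sigma>\<in>Aut_C. \<forall>\<rho>\<in>Aut_C. restrict \<sigma> Q_ab = restrict \<rho> Q_ab \<longrightarrow>
        (\<forall>h\<in>Gtilde. transport (act \<sigma>) (graph h) = transport (act \<rho>) (graph h))) \<and>
     (\<forall>\<mu>\<in>zhat_units. \<forall>\<sigma>\<in>Aut_C. cyclotomic (restrict \<sigma> Q_ab) \<mu> \<longrightarrow>
        (\<forall>a b c d. mat2 a b c d \<in> Gtilde \<longrightarrow>
           mat2 a (adele_of_zhat \<mu> * b) (adele_of_zhat (zhat_inverse \<mu>) * c) d \<in> Gtilde \<and>
           transport (act \<sigma>) (graph (mat2 a b c d)) =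
             graph (mat2 a (adele_of_zhat \<mu> * b) (adele_of_zhat (zhat_inverse \<mu>) * c) d)))"
proof (intro conjI ballI allI impI)
  show "\<exists>!\<mu>. cyclotomic (restrict \<sigma> Q_ab) \<mu>" if "\<sigma> \<in> Aut_C" for \<sigma>
    by (rule ex1_cyclotomic[OF that])
  show "\<exists>\<sigma>\<in>Aut_C. cyclotomic (restrict \<sigma> Q_ab) \<mu>" if "\<mu> \<in> zhat_units" for \<mu>
    using ex_Aut_C_raises_roots[OF that] that by (auto simp: cyclotomic_iff)
next
  fix \<sigma> \<rho> h
  assume s: "\<sigma> \<in> Aut_C" and r: "\<rho> \<in> Aut_C" and eq: "restrict \<sigma> Q_ab = restrict \<rho> Q_ab" and h: "h \<in> Gtilde"
  obtain \<mu> where c: "cyclotomic (restrict \<sigma> Q_ab) \<mu>" using ex1_cyclotomic[OF s] by blast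
  \<comment> \<open>Automorphisms that agree on \<open>Q_ab\<close> share their character, and the
    transported graph depends on the character alone.\<close>
  have m: "raises_roots \<sigma> \<mu>" "raises_roots \<rho> \<mu>" "\<mu> \<in> zhat_units"
    using c[unfolded cyclotomic_iff[OF s]] c[unfolded eq cyclotomic_iff[OF r]] by blast+
  then obtain \<nu> where "\<mu> * \<nu> = 1" by (auto simp: zhat_units_iff)
  then show "transport (act \<sigma>) (graph h) = transport (act \<rho>) (graph h)"
    using transport_graph[OF assms s m(1) _ h] transport_graph[OF assms r m(2) _ h] by simp
next
  fix \<mu> \<sigma> a b c d
  assume m: "\<mu> \<in> zhat_units" and s: "\<sigma> \<in> Aut_C" and cyc: "cyclotomic (restrict \<sigma> Q_ab) \<mu>"
    and h: "mat2 a b c d \<in> Gtilde"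
  obtain \<nu> where mn: "\<mu> * \<nu> = 1" using m by (auto simp: zhat_units_iff)
  have rr: "raises_roots \<sigma> \<mu>" using cyc by (simp add: cyclotomic_iff[OF s])
  have eq: "mat2 a (adele_of_zhat \<mu> * b) (adele_of_zhat (zhat_inverse \<mu>) * c) d = diag_conj \<mu> \<nu> (mat2 a b c d)"
    unfolding diag_conj_mat2[OF mn] zhat_inverse_eq[OF mn] ..
  show "mat2 a (adele_of_zhat \<mu> * b) (adele_of_zhat (zhat_inverse \<mu>) * c) d \<in> Gtilde"
    unfolding eq by (rule Gtilde_diag_conj[OF mn h])
  show "transport (act \<sigma>) (graph (mat2 a b c d)) =
      graph (mat2 a (adele_of_zhat \<mu> * b) (adele_of_zhat (zhat_inverse \<mu>) * c) d)"
    unfolding eq by (rule transport_graph[OF assms s rr mn h])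
qed

end
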